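(* Suppose $\mathbb{K}$ has characteristic zero. Put $d=\sum_{j=1}^{n+2} b_j-\sum_{i=1}^n a_i$ and $d'=\sum_{i=1}^n (b_i-a_i)$. If $a_1=0$ and one of the following holds: (a) $d$ is even and $d'+2+b_{n+1}>b_{n+2}$; (b) $d$ is odd and $d'+1+b_{n+1}>b_{n+2}$, then $M$ has the Weak Lefschetz Property.
   Context: Let $\mathbb{K}$ be an algebraically closed field, $R=\mathbb{K}[x,y,z]$ with the standard grading, $n>0$ an integer, and $a_1\le a_2\le\cdots\le a_n$, $b_1\le b_2\le\cdots\le b_{n+2}$ integers. Let $\varphi:\bigoplus_{j=1}^{n+2}R(-b_j)\to\bigoplus_{i=1}^nR(-a_i)$ be a degree-zero graded $R$-linear map with matrix $(\varphi_{i,j})$, such that each entry $\varphi_{i,j}$ is either $0$ or homogeneous of positive degree (necessarily equal to $b_j-a_i$). Let $I\subset R$ be the ideal generated by the $n\times n$ minors of $\varphi$, and assume that $I$ has codimension $3$. Let $M=\operatorname{coker}(\varphi)$; it is a graded $R$-module of finite length. A finite length graded module $N$ over a standard graded polynomial ring $S$ over $\mathbb{K}$ has the Weak Lefschetz Property (WLP) if there is a general linear form $\ell\in S_1$ (equivalently, some $\ell\in S_1$) such that the $\mathbb{K}$-linear map $\times\ell:N_j\to N_{j+1}$ has maximal rank (is injective or surjective) for all $j$. *)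

theory Defs
  imports
    "HOL-Library.Poly_Mapping"
    "HOL-Library.Numeral_Type"
    "HOL-Library.Extended_Nat"
    "HOL-Algebra.Algebraic_Closure_Type"
    "HOL-Algebra.Module"
    "Jordan_Normal_Form.Determinant"
    "Jordan_Normal_Form.DL_Submatrix"
begin

section \<open>Graded polynomial rings\<close>

text \<open>A monomial is its exponent vector, a finitely supported map from the variables to
  \<open>nat\<close>; a polynomial is a finitely supported map from monomials to coefficients, so that the
  convolution product of \<open>poly_mapping\<close> is the product of polynomials. For a finite type \<open>'v\<close>
  this is the polynomial ring in \<open>CARD('v)\<close> variables.\<close>

type_synonym ('v, 'k) mpoly = "('v \<Rightarrow>\<^sub>0 nat) \<Rightarrow>\<^sub>0 'k"

definition monomial_degree :: "('v::finite \<Rightarrow>\<^sub>0 nat) \<Rightarrow> nat" where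
  "monomial_degree t = (\<Sum>v\<in>UNIV. Poly_Mapping.lookup t v)"

text \<open>The zero polynomial is homogeneous of every degree, and it is the only one that is
  homogeneous of a negative degree.\<close>

definition homogeneous :: "int \<Rightarrow> ('v::finite, 'k::zero) mpoly \<Rightarrow> bool" where
  "homogeneous d p \<longleftrightarrow> (\<forall>t\<in>Poly_Mapping.keys p. int (monomial_degree t) = d)"

section \<open>Codimension of an ideal\<close>

definition prime_height :: "('a, 'm) ring_scheme \<Rightarrow> 'a set \<Rightarrow> enat" where
  "prime_height R P = (SUP m \<in> {m. \<exists>Q :: nat \<Rightarrow> 'a set.
       (\<forall>i\<le>m. primeideal (Q i) R) \<and> (\<forall>i<m. Q i \<subset> Q (Suc i)) \<and> Q m = P}. enat m)"

text \<open>The codimension of an ideal is its height; the unit ideal gets \<open>\<infinity>\<close>.\<close>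

definition codimension :: "('a, 'm) ring_scheme \<Rightarrow> 'a set \<Rightarrow> enat" where
  "codimension R I = (INF P \<in> {P. primeideal P R \<and> I \<subseteq> P}. prime_height R P)"

definition minors_ideal :: "nat \<Rightarrow> 'a::comm_ring_1 mat \<Rightarrow> 'a set" where
  "minors_ideal k A = genideal ring_of_type_algebra
     {det (submatrix A I J) | I J.
        I \<subseteq> {..<dim_row A} \<and> card I = k \<and> J \<subseteq> {..<dim_col A} \<and> card J = k}"

section \<open>Quotient modules and graded cokernels\<close>

text \<open>The \<open>mult\<close> and \<open>one\<close> fields of a module record carry no meaning.\<close>

definition quotient_module ::
    "('r, 'b, 'm) module_scheme \<Rightarrow> 'b set \<Rightarrow> ('r, 'b set) module" where
  "quotient_module M H =
     \<lparr>carrier = a_rcosets\<^bsub>M\<^esub> H, monoid.mult = undefined, one = undefined,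
      zero = H, add = set_add M,
      module.smult = (\<lambda>r C. \<Union>x\<in>C. H +>\<^bsub>M\<^esub> (r \<odot>\<^bsub>M\<^esub> x))\<rparr>"

definition matrix_image :: "'a::comm_ring_1 mat \<Rightarrow> 'a vec set" where
  "matrix_image A = {A *\<^sub>v w | w. w \<in> carrier_vec (dim_col A)}"

definition coker :: "'a::comm_ring_1 mat \<Rightarrow> ('a, 'a vec set) module" where
  "coker A = quotient_module (module_vec TYPE('a) (dim_row A)) (matrix_image A)"

text \<open>The degree \<open>j\<close> part of \<open>R(-a\<^sub>0) \<oplus> \<dots> \<oplus> R(-a\<^bsub>n-1\<^esub>)\<close>, where \<open>R(-c)\<^sub>j = R\<^bsub>j-c\<^esub>\<close>.\<close>

definition free_degree_part ::
    "nat \<Rightarrow> (nat \<Rightarrow> int) \<Rightarrow> int \<Rightarrow> ('v::finite, 'k::zero) mpoly vec set" where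
  "free_degree_part n a j = {v \<in> carrier_vec n. \<forall>i<n. homogeneous (j - a i) (vec_index v i)}"

text \<open>The grading of the cokernel is the one induced by that of its target: the degree \<open>j\<close>
  part consists of the classes of the elements of degree \<open>j\<close>.\<close>

definition coker_degree_part ::
    "('v::finite, 'k::comm_ring_1) mpoly mat \<Rightarrow> (nat \<Rightarrow> int) \<Rightarrow> int
       \<Rightarrow> ('v, 'k) mpoly vec set set" where
  "coker_degree_part A a j =
     (\<lambda>v. matrix_image A +>\<^bsub>module_vec TYPE(('v, 'k) mpoly) (dim_row A)\<^esub> v)
       ` free_degree_part (dim_row A) a j"

section \<open>The Weak Lefschetz Property\<close>

text \<open>\<open>N\<close> is a graded module of finite length with degree parts \<open>G j\<close>. A linear map
  between finite-dimensional spaces has maximal rank iff it is injective or surjective.\<close>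

definition weak_Lefschetz_property ::
    "(('v::finite, 'k::comm_ring_1) mpoly, 'b, 'm) module_scheme \<Rightarrow> (int \<Rightarrow> 'b set) \<Rightarrow> bool"
  where
  "weak_Lefschetz_property N G \<longleftrightarrow>
     (\<exists>l. homogeneous 1 l \<and>
        (\<forall>j. inj_on (\<lambda>x. l \<odot>\<^bsub>N\<^esub> x) (G j) \<or> (\<lambda>x. l \<odot>\<^bsub>N\<^esub> x) ` G j = G (j + 1)))"

end

theory Submission
  imports Defs "Berlekamp_Zassenhaus.Unique_Factorization_Poly"
begin

text \<open>Restrict \<open>\<phi>\<close> to the generic line \<open>z = \<alpha> x + \<beta> y\<close>, where its kernel is free of rank two over a polynomial
  ring in one variable. The derivation that moves the line and fixes a point on it sends a kernel vector of
  small degree to a multiple of itself, since two independent kernel vectors have degrees adding up to at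
  least \<open>d\<close>; in characteristic zero such a vector descends, up to a factor, to a syzygy of \<open>\<phi>\<close> on the
  plane. As the codimension is three, the syzygies of \<open>\<phi>\<close>
  are combinations of the Buchsbaum-Rim relations, and the numerical hypothesis makes the degrees of these
  too large. So the kernel on a general line vanishes in degrees below about \<open>d / 2\<close>, the splitting is
  balanced, and a dimension count shows that \<open>\<phi>\<close> on the line is surjective from the next degree on.
  If \<open>l\<close> is the equation of the line, injectivity on the line makes multiplication by \<open>l\<close> on the cokernel
  injective, and surjectivity makes it surjective.\<close>

text \<open>All bounds come from \<open>m = d div 2\<close>. The derivation raises the degree by
  one, so a kernel vector of degree e and its derivative are dependent once 2 e + 1 < d, and e = m -
  1 is the last such degree. The Buchsbaum-Rim relations have degrees d - b_k, which exceed m - 1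
  when every b_k is at most m; in either parity the numerical hypothesis says just that of the
  largest b_k. A class of degree j killed by l comes from a kernel vector on the line in degree j +
  1, and the cokernel of l in that degree is the cokernel on the line. So a kernel that vanishes up
  to m - 1 and surjectivity from m on leave no degree uncovered. Codimension three is used in the
  form that powers of all three variables lie in the ideal of minors. They are an explicit regular
  sequence, and they show that the minors have no common zero on a line, its point at infinity
  included. The generic line has coefficients in K[\<alpha>][\<beta>] and not in a field of
  fractions: elimination without division yields one polynomial whose nonvanishing selects a line
  over K.\<close>

declare add_2_eq_Suc' [simp del] add_2_eq_Suc [simp del]

section \<open>Maximal minors of an \<open>n \<times> (n + 2)\<close> matrix\<close>

definition std_row :: "nat \<Rightarrow> nat \<Rightarrow> 'a::zero_neq_one" where
  "std_row i c = (if c = i then 1 else 0)"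

definition bordered :: "nat \<Rightarrow> (nat \<Rightarrow> nat \<Rightarrow> 'a) \<Rightarrow> (nat \<Rightarrow> 'a) \<Rightarrow> (nat \<Rightarrow> 'a) \<Rightarrow> 'a mat" where
  "bordered n M p q = mat (n + 2) (n + 2)
     (\<lambda>(r, c). if r < n then M r c else if r = n then p c else q c)"

text \<open>Up to sign this is the maximal minor of \<open>M\<close> without the columns
  \<open>i\<close> and \<open>k\<close>. As a square determinant it is alternating in
  \<open>i\<close> and \<open>k\<close>, so no signs have to be tracked. Read as a matrix in
  \<open>i\<close> and \<open>k\<close>, it is the middle map of the Buchsbaum-Rim complex 0 -> R^n
  -> R^(n+2) -> R^(n+2) -> R^n, whose outer maps are the transpose of \<open>M\<close> and
  \<open>M\<close> itself.\<close>

definition cominor :: "nat \<Rightarrow> (nat \<Rightarrow> nat \<Rightarrow> 'a::comm_ring_1) \<Rightarrow> nat \<Rightarrow> nat \<Rightarrow> 'a" where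
  "cominor n M i k = det (bordered n M (std_row i) (std_row k))"

lemma bordered_carrier [simp]: "bordered n M p q \<in> carrier_mat (n + 2) (n + 2)"
  by (simp add: bordered_def)

lemma bordered_dim [simp]: "dim_row (bordered n M p q) = n + 2" "dim_col (bordered n M p q) = n + 2"
  by (simp_all add: bordered_def)

lemma bordered_index:
  assumes "r < n + 2" "c < n + 2"
  shows "bordered n M p q $$ (r, c) = (if r < n then M r c else if r = n then p c else q c)"
  using assms by (simp add: bordered_def)

lemma cofactor_bordered:
  "cofactor (bordered n M p q) n c = cofactor (bordered n M p' q) n c"
  "cofactor (bordered n M p q) (n + 1) c = cofactor (bordered n M p q') (n + 1) c"
proof -
  have "mat_delete (bordered n M p q) n c = mat_delete (bordered n M p' q) n c"
    by (rule eq_matI) (auto simp: mat_delete_def bordered_def)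
  then show "cofactor (bordered n M p q) n c = cofactor (bordered n M p' q) n c"
    by (simp add: cofactor_def)
  have "mat_delete (bordered n M p q) (n + 1) c = mat_delete (bordered n M p q') (n + 1) c"
    by (rule eq_matI) (auto simp: mat_delete_def bordered_def)
  then show "cofactor (bordered n M p q) (n + 1) c = cofactor (bordered n M p q') (n + 1) c"
    by (simp add: cofactor_def)
qed

lemma det_bordered_expand1:
  "det (bordered n M p q) = (\<Sum>c<n+2. p c * det (bordered n M (std_row c) q))"
proof -
  have cof: "det (bordered n M (std_row c) q) = cofactor (bordered n M p q) n c" if "c < n + 2" for c
  proof -
    have "det (bordered n M (std_row c) q)
        = (\<Sum>j<n+2. bordered n M (std_row c) q $$ (n, j) * cofactor (bordered n M (std_row c) q) n j)"
      by (rule laplace_expansion_row) auto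
    also have "\<dots> = (\<Sum>j<n+2. if j = c then cofactor (bordered n M (std_row c) q) n j else 0)"
      by (rule sum.cong) (auto simp: bordered_index std_row_def)
    also have "\<dots> = cofactor (bordered n M (std_row c) q) n c"
      using that by simp
    finally show ?thesis using cofactor_bordered(1) by metis
  qed
  have "det (bordered n M p q)
      = (\<Sum>j<n+2. bordered n M p q $$ (n, j) * cofactor (bordered n M p q) n j)"
    by (rule laplace_expansion_row) auto
  also have "\<dots> = (\<Sum>c<n+2. p c * det (bordered n M (std_row c) q))"
    by (rule sum.cong) (auto simp: bordered_index cof)
  finally show ?thesis .
qed

lemma det_bordered_swap: "det (bordered n M q p) = - det (bordered n M p q)"
proof -
  have "swaprows n (n + 1) (bordered n M p q) = bordered n M q p"
    by (rule eq_matI) (auto simp: mat_swaprows_def bordered_index)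
  moreover have "det (swaprows n (n + 1) (bordered n M p q)) = - det (bordered n M p q)"
    by (rule det_swaprows[of n "n + 2" "n + 1"]) (simp_all)
  ultimately show ?thesis by metis
qed

lemma det_bordered_expand2:
  "det (bordered n M p q) = (\<Sum>c<n+2. q c * det (bordered n M p (std_row c)))"
proof -
  have "det (bordered n M p q) = - det (bordered n M q p)"
    by (metis det_bordered_swap)
  also have "det (bordered n M q p) = (\<Sum>c<n+2. q c * - det (bordered n M p (std_row c)))"
    unfolding det_bordered_expand1[of n M q p] by (metis det_bordered_swap)
  finally show ?thesis by (simp add: sum_negf)
qed

lemma cominor_swap: "cominor n M k i = - cominor n M i k"
  unfolding cominor_def by (rule det_bordered_swap)

lemma det_bordered_row:
  assumes "r < n"
  shows "det (bordered n M p (M r)) = 0"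
proof (rule det_identical_rows[of _ "n + 2" r "n + 1"])
  show "row (bordered n M p (M r)) r = row (bordered n M p (M r)) (n + 1)"
    by (rule eq_vecI) (use assms in \<open>auto simp: bordered_index\<close>)
qed (use assms in auto)

text \<open>Bordering by a row of \<open>M\<close> repeats that row: successive maps of the
  Buchsbaum-Rim complex compose to zero.\<close>

lemma cominor_row:
  assumes "r < n"
  shows "(\<Sum>k<n+2. cominor n M c k * M r k) = 0"
proof -
  have "(\<Sum>k<n+2. cominor n M c k * M r k) = det (bordered n M (std_row c) (M r))"
    unfolding det_bordered_expand2[of n M "std_row c" "M r"] cominor_def by (simp add: mult.commute)
  then show ?thesis using det_bordered_row[OF assms] by simp
qed

text \<open>The cofactors along a border row do not see that row, so putting a unit row there picks
  out one of them.\<close>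

lemma adj_bordered_index:
  assumes "c < n + 2"
  shows "adj_mat (bordered n M p q) $$ (c, n) = det (bordered n M (std_row c) q)"
    and "adj_mat (bordered n M p q) $$ (c, n + 1) = det (bordered n M p (std_row c))"
proof -
  have "det (bordered n M (std_row c) q)
      = (\<Sum>j<n+2. bordered n M (std_row c) q $$ (n, j) * cofactor (bordered n M (std_row c) q) n j)"
    by (rule laplace_expansion_row) auto
  also have "\<dots> = (\<Sum>j<n+2. if j = c then cofactor (bordered n M (std_row c) q) n j else 0)"
    by (rule sum.cong) (auto simp: bordered_index std_row_def)
  also have "\<dots> = cofactor (bordered n M p q) n c"
    using assms cofactor_bordered(1)[of n M "std_row c" q c p] by simp
  finally show "adj_mat (bordered n M p q) $$ (c, n) = det (bordered n M (std_row c) q)"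
    using assms by (simp add: adj_mat_def)
  have "det (bordered n M p (std_row c))
      = (\<Sum>j<n+2. bordered n M p (std_row c) $$ (n+1, j) * cofactor (bordered n M p (std_row c)) (n+1) j)"
    by (rule laplace_expansion_row) auto
  also have "\<dots> = (\<Sum>j<n+2. if j = c then cofactor (bordered n M p (std_row c)) (n+1) j else 0)"
    by (rule sum.cong) (auto simp: bordered_index std_row_def)
  also have "\<dots> = cofactor (bordered n M p q) (n+1) c"
    using assms cofactor_bordered(2)[of n M p "std_row c" c q] by simp
  finally show "adj_mat (bordered n M p q) $$ (c, n + 1) = det (bordered n M p (std_row c))"
    using assms by (simp add: adj_mat_def)
qed

lemma adj_bordered:
  fixes n M p q
  defines "B \<equiv> bordered n M p q"
  shows "c < n + 2 \<Longrightarrow> c' < n + 2 \<Longrightarrow>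
      (\<Sum>r<n+2. adj_mat B $$ (c, r) * B $$ (r, c')) = (if c = c' then det B else 0)"
    and "c < n + 2 \<Longrightarrow> c' < n + 2 \<Longrightarrow>
      (\<Sum>r<n+2. B $$ (c, r) * adj_mat B $$ (r, c')) = (if c = c' then det B else 0)"
proof -
  have B: "B \<in> carrier_mat (n + 2) (n + 2)" by (simp add: B_def)
  have A: "adj_mat B \<in> carrier_mat (n + 2) (n + 2)" using adj_mat(1)[OF B] .
  note dims = carrier_matD[OF B] carrier_matD[OF A]
  { assume c: "c < n + 2" "c' < n + 2"
    have "(adj_mat B * B) $$ (c, c') = (if c = c' then det B else 0)"
      unfolding adj_mat(3)[OF B] using c by simp
    moreover have "(adj_mat B * B) $$ (c, c') = (\<Sum>r<n+2. adj_mat B $$ (c, r) * B $$ (r, c'))"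
      using c dims by (simp add: scalar_prod_def lessThan_atLeast0)
    ultimately show "(\<Sum>r<n+2. adj_mat B $$ (c, r) * B $$ (r, c')) = (if c = c' then det B else 0)"
      by simp }
  { assume c: "c < n + 2" "c' < n + 2"
    have "(B * adj_mat B) $$ (c, c') = (if c = c' then det B else 0)"
      unfolding adj_mat(2)[OF B] using c by simp
    moreover have "(B * adj_mat B) $$ (c, c') = (\<Sum>r<n+2. B $$ (c, r) * adj_mat B $$ (r, c'))"
      using c dims by (simp add: scalar_prod_def lessThan_atLeast0)
    ultimately show "(\<Sum>r<n+2. B $$ (c, r) * adj_mat B $$ (r, c')) = (if c = c' then det B else 0)"
      by simp }
qed

lemma sum_bordered_rows:
  fixes n :: nat and f :: "nat \<Rightarrow> 'a::comm_monoid_add"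
  shows "(\<Sum>r<n+2. f r) = (\<Sum>r<n. f r) + f n + f (n + 1)"
  by (simp add: numeral_2_eq_2)

lemma sum_std_row:
  fixes f :: "nat \<Rightarrow> 'a::comm_ring_1"
  assumes "i < n"
  shows "(\<Sum>c<n. std_row i c * f c) = f i" "(\<Sum>c<n. f c * std_row i c) = f i"
proof -
  have "(\<Sum>c<n. std_row i c * f c) = (\<Sum>c<n. if c = i then f c else 0)"
    by (rule sum.cong) (auto simp: std_row_def)
  then show "(\<Sum>c<n. std_row i c * f c) = f i" using assms by simp
  then show "(\<Sum>c<n. f c * std_row i c) = f i" by (simp add: mult.commute)
qed

text \<open>Cramer's rule. Since \<open>M\<close> kills \<open>u\<close>, the product of the
  bordered matrix with \<open>u\<close> has only the two border entries \<open>u i\<close> and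
  \<open>u k\<close>, and the adjugate turns it into the determinant times \<open>u\<close>.\<close>

lemma cominor_kernel:
  fixes M :: "nat \<Rightarrow> nat \<Rightarrow> 'a::comm_ring_1"
  assumes ker: "\<And>r. r < n \<Longrightarrow> (\<Sum>c<n+2. M r c * u c) = 0"
    and i: "i < n + 2" and k: "k < n + 2" and c: "c < n + 2"
  shows "cominor n M i k * u c = u i * cominor n M c k + u k * cominor n M i c"
proof -
  define B where "B = bordered n M (std_row i) (std_row k)"
  have row: "(\<Sum>j<n+2. B $$ (r, j) * u j) = (if r < n then 0 else if r = n then u i else u k)"
    if "r < n + 2" for r
  proof -
    have "(\<Sum>j<n+2. B $$ (r, j) * u j)
        = (\<Sum>j<n+2. (if r < n then M r j else if r = n then std_row i j else std_row k j) * u j)"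
      by (rule sum.cong) (use that in \<open>auto simp: B_def bordered_index\<close>)
    then show ?thesis using ker sum_std_row[OF i] sum_std_row[OF k] by auto
  qed
  have "cominor n M i k * u c = (\<Sum>j<n+2. (if c = j then det B else 0) * u j)"
  proof -
    have "(\<Sum>j<n+2. (if c = j then det B else 0) * u j) = (\<Sum>j<n+2. if j = c then det B * u j else 0)"
      by (rule sum.cong) auto
    then show ?thesis using c by (simp add: cominor_def B_def)
  qed
  also have "\<dots> = (\<Sum>j<n+2. (\<Sum>r<n+2. adj_mat B $$ (c, r) * B $$ (r, j)) * u j)"
    using c by (intro sum.cong refl) (simp add: adj_bordered(1)[of c n _ M "std_row i" "std_row k", folded B_def])
  also have "\<dots> = (\<Sum>r<n+2. adj_mat B $$ (c, r) * (\<Sum>j<n+2. B $$ (r, j) * u j))"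
    unfolding sum_distrib_left sum_distrib_right mult.assoc by (rule sum.swap)
  also have "\<dots> = (\<Sum>r<n+2. adj_mat B $$ (c, r) * (if r < n then 0 else if r = n then u i else u k))"
    by (intro sum.cong refl) (simp add: row)
  also have "\<dots> = adj_mat B $$ (c, n) * u i + adj_mat B $$ (c, n + 1) * u k"
    by (simp add: sum_bordered_rows)
  also have "\<dots> = u i * cominor n M c k + u k * cominor n M i c"
    using c unfolding B_def cominor_def by (simp only: adj_bordered_index) (simp add: mult.commute)
  finally show ?thesis .
qed

text \<open>Cramer's rule from the left: \<open>w\<close> times the adjugate has n entries that
  combine the rows of \<open>M\<close> and two border entries that pair \<open>w\<close> with
  cominors. The border entries vanish when \<open>w\<close> lies in the kernel of the matrix of
  cominors.\<close>

lemma cominor_corow: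
  fixes M :: "nat \<Rightarrow> nat \<Rightarrow> 'a::comm_ring_1"
  assumes i: "i < n + 2" and k: "k < n + 2"
  obtains p where "\<And>c. c < n + 2 \<Longrightarrow> cominor n M i k * w c = (\<Sum>r<n. p r * M r c)
      + (\<Sum>j<n+2. w j * cominor n M j k) * std_row i c + (\<Sum>j<n+2. w j * cominor n M i j) * std_row k c"
proof -
  define B where "B = bordered n M (std_row i) (std_row k)"
  define p where "p r = (\<Sum>j<n+2. w j * adj_mat B $$ (j, r))" for r
  have "cominor n M i k * w c = (\<Sum>r<n. p r * M r c)
      + (\<Sum>j<n+2. w j * cominor n M j k) * std_row i c + (\<Sum>j<n+2. w j * cominor n M i j) * std_row k c"
    if c: "c < n + 2" for c
  proof -
    have "cominor n M i k * w c = (\<Sum>j<n+2. w j * (if j = c then det B else 0))"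
    proof -
      have "(\<Sum>j<n+2. w j * (if j = c then det B else 0)) = (\<Sum>j<n+2. if j = c then w j * det B else 0)"
        by (rule sum.cong) auto
      then show ?thesis using c by (simp add: cominor_def B_def mult.commute)
    qed
    also have "\<dots> = (\<Sum>j<n+2. w j * (\<Sum>r<n+2. adj_mat B $$ (j, r) * B $$ (r, c)))"
      using c by (intro sum.cong refl) (simp add: adj_bordered(1)[of _ n c M "std_row i" "std_row k", folded B_def])
    also have "\<dots> = (\<Sum>r<n+2. p r * B $$ (r, c))"
      unfolding p_def sum_distrib_left sum_distrib_right mult.assoc by (rule sum.swap)
    also have "\<dots> = (\<Sum>r<n. p r * B $$ (r, c)) + p n * B $$ (n, c) + p (n + 1) * B $$ (n + 1, c)"
      by (rule sum_bordered_rows)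
    also have "(\<Sum>r<n. p r * B $$ (r, c)) = (\<Sum>r<n. p r * M r c)"
      using c by (intro sum.cong refl) (simp add: B_def bordered_index)
    also have "B $$ (n, c) = std_row i c" using c by (simp add: B_def bordered_index)
    also have "B $$ (n + 1, c) = std_row k c" using c by (simp add: B_def bordered_index)
    also have "p n = (\<Sum>j<n+2. w j * cominor n M j k)"
      unfolding p_def cominor_def B_def
      by (intro sum.cong refl arg_cong2[where f="(*)"] adj_bordered_index) auto
    also have "p (n + 1) = (\<Sum>j<n+2. w j * cominor n M i j)"
      unfolding p_def cominor_def B_def
      by (intro sum.cong refl arg_cong2[where f="(*)"] adj_bordered_index) auto
    finally show ?thesis .
  qed
  then show ?thesis by (rule that)
qed

text \<open>Multiplying on the right by the adjugate shows that the minors annihilate the left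
  kernel.\<close>

lemma cominor_cokernel:
  fixes M :: "nat \<Rightarrow> nat \<Rightarrow> 'a::comm_ring_1"
  assumes ker: "\<And>c. c < n + 2 \<Longrightarrow> (\<Sum>r<n. p r * M r c) = 0" and r: "r < n"
  shows "cominor n M i k * p r = 0"
proof -
  define B where "B = bordered n M (std_row i) (std_row k)"
  have B: "(\<Sum>s<n. p s * B $$ (s, c)) = 0" if "c < n + 2" for c
    using ker[OF that] that by (simp add: B_def bordered_index)
  have "cominor n M i k * p r = (\<Sum>s<n. p s * (if s = r then det B else 0))"
  proof -
    have "(\<Sum>s<n. p s * (if s = r then det B else 0)) = (\<Sum>s<n. if s = r then p s * det B else 0)"
      by (rule sum.cong) auto
    then show ?thesis using r by (simp add: cominor_def B_def mult.commute)
  qed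
  also have "\<dots> = (\<Sum>s<n. p s * (\<Sum>c<n+2. B $$ (s, c) * adj_mat B $$ (c, r)))"
    using r by (intro sum.cong refl) (simp add: adj_bordered(2)[of _ n r M "std_row i" "std_row k", folded B_def])
  also have "\<dots> = (\<Sum>c<n+2. (\<Sum>s<n. p s * B $$ (s, c)) * adj_mat B $$ (c, r))"
    unfolding sum_distrib_left sum_distrib_right mult.assoc by (rule sum.swap)
  also have "\<dots> = 0" by (intro sum.neutral ballI) (simp add: B)
  finally show ?thesis .
qed

text \<open>A Pluecker relation: when \<open>M\<close> has full rank its kernel has rank two, and
  the 2 x 2 minors of two kernel vectors are proportional to the complementary maximal minors of
  \<open>M\<close>. It is obtained by elimination from four instances of Cramer's rule.\<close>

lemma cominor_wedge:
  fixes M :: "nat \<Rightarrow> nat \<Rightarrow> 'a::comm_ring_1"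
  assumes u: "\<And>r. r < n \<Longrightarrow> (\<Sum>c<n+2. M r c * u c) = 0"
    and v: "\<And>r. r < n \<Longrightarrow> (\<Sum>c<n+2. M r c * v c) = 0"
    and "i < n + 2" "k < n + 2" "c < n + 2" "f < n + 2"
  shows "cominor n M i k * (u c * v f - u f * v c) = (u i * v k - u k * v i) * cominor n M c f"
proof -
  note ku = cominor_kernel[of n M u, OF u] and kv = cominor_kernel[of n M v, OF v]
  have 1: "cominor n M c f * u i = u c * cominor n M i f + u f * cominor n M c i"
    using assms by (intro ku) auto
  have 2: "cominor n M c f * u k = u c * cominor n M k f + u f * cominor n M c k"
    using assms by (intro ku) auto
  have 3: "cominor n M i k * v f = v i * cominor n M f k + v k * cominor n M i f"
    using assms by (intro kv) auto
  have 4: "cominor n M i k * v c = v i * cominor n M c k + v k * cominor n M i c"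
    using assms by (intro kv) auto
  have "(u i * v k - u k * v i) * cominor n M c f
      = (cominor n M c f * u i) * v k - (cominor n M c f * u k) * v i" by (simp add: algebra_simps)
  also have "\<dots> = u c * (v i * cominor n M f k + v k * cominor n M i f)
      - u f * (v i * cominor n M c k + v k * cominor n M i c)"
    unfolding 1 2 cominor_swap[of n M k f] cominor_swap[of n M c i] by (simp add: algebra_simps)
  also have "\<dots> = cominor n M i k * (u c * v f - u f * v c)"
    unfolding 3[symmetric] 4[symmetric] by (simp add: algebra_simps)
  finally show ?thesis ..
qed


section \<open>Ideals of a ring given by its type, and the ideal of maximal minors\<close>

lemma ideal_ring_of_type_algebra_iff:
  fixes J :: "'a::comm_ring_1 set"
  shows "ideal J ring_of_type_algebra \<longleftrightarrow>
    0 \<in> J \<and> (\<forall>x\<in>J. \<forall>y\<in>J. x + y \<in> J) \<and> (\<forall>x\<in>J. \<forall>r. r * x \<in> J)"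
proof -
  let ?R = "ring_of_type_algebra :: 'a ring"
  interpret R: cring ?R by (rule cring_from_type_algebra)
  have [simp]: "carrier ?R = UNIV" "x \<otimes>\<^bsub>?R\<^esub> y = x * y" "x \<oplus>\<^bsub>?R\<^esub> y = x + y" "\<zero>\<^bsub>?R\<^esub> = 0" for x y
    by (simp_all add: ring_of_type_algebra_def)
  have neg: "\<ominus>\<^bsub>?R\<^esub> x = - x" for x
    by (rule R.minus_equality) auto
  show ?thesis
  proof
    assume "ideal J ?R"
    then interpret ideal J ?R .
    have add: "x + y \<in> J" if "x \<in> J" "y \<in> J" for x y using additive_subgroup.a_closed[OF additive_subgroup_axioms that] by simp
    have mult: "r * x \<in> J" if "x \<in> J" for x r using I_l_closed[OF that, of r] by simp
    have "0 \<in> J" using additive_subgroup.zero_closed[OF additive_subgroup_axioms] by simp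
    with add mult show "0 \<in> J \<and> (\<forall>x\<in>J. \<forall>y\<in>J. x + y \<in> J) \<and> (\<forall>x\<in>J. \<forall>r. r * x \<in> J)" by blast
  next
    assume J: "0 \<in> J \<and> (\<forall>x\<in>J. \<forall>y\<in>J. x + y \<in> J) \<and> (\<forall>x\<in>J. \<forall>r. r * x \<in> J)"
    have m: "- x \<in> J" if "x \<in> J" for x using J that mult_minus1[of x] by metis
    show "ideal J ?R"
    proof (rule idealI)
      show "subgroup J (add_monoid ?R)"
      proof
        fix x assume "x \<in> J"
        moreover have "inv\<^bsub>add_monoid ?R\<^esub> x = - x"
          using neg[of x] by (simp add: a_inv_def)
        ultimately show "inv\<^bsub>add_monoid ?R\<^esub> x \<in> J" using m by simp
      qed (use J in \<open>auto simp: ring_of_type_algebra_def\<close>)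
    qed (use J R.ring_axioms in \<open>auto simp: mult.commute[of _ "_::'a"]\<close>)
  qed
qed

lemma primeideal_ring_of_type_algebra_iff:
  fixes J :: "'a::comm_ring_1 set"
  shows "primeideal J ring_of_type_algebra \<longleftrightarrow>
    ideal J ring_of_type_algebra \<and> 1 \<notin> J \<and> (\<forall>x y. x * y \<in> J \<longrightarrow> x \<in> J \<or> y \<in> J)"
proof -
  let ?R = "ring_of_type_algebra :: 'a ring"
  interpret R: cring ?R by (rule cring_from_type_algebra)
  have [simp]: "carrier ?R = UNIV" "x \<otimes>\<^bsub>?R\<^esub> y = x * y" for x y
    by (simp_all add: ring_of_type_algebra_def)
  have "J = UNIV \<longleftrightarrow> 1 \<in> J" if "ideal J ?R"
    using that mult_1_right unfolding ideal_ring_of_type_algebra_iff by (metis UNIV_I UNIV_eq_I)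
  then show ?thesis
    using R.cring_axioms by (auto simp: primeideal_def primeideal_axioms_def)
qed

text \<open>The coefficients are explicit so that ring homomorphisms and homogeneous components can
  be applied to them.\<close>

definition cominor_span :: "nat \<Rightarrow> (nat \<Rightarrow> nat \<Rightarrow> 'a::comm_ring_1) \<Rightarrow> 'a set" where
  "cominor_span n M = {\<Sum>i<n+2. \<Sum>k<n+2. c i k * cominor n M i k | c. True}"

lemma ideal_cominor_span: "ideal (cominor_span n M) ring_of_type_algebra"
  unfolding ideal_ring_of_type_algebra_iff
proof (intro conjI ballI allI)
  show "0 \<in> cominor_span n M"
    unfolding cominor_span_def by (rule CollectI, rule exI[of _ "\<lambda>_ _. 0"]) simp
  fix x assume "x \<in> cominor_span n M"
  then obtain c where c: "x = (\<Sum>i<n+2. \<Sum>k<n+2. c i k * cominor n M i k)"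
    unfolding cominor_span_def by blast
  show "r * x \<in> cominor_span n M" for r
    unfolding cominor_span_def
    by (rule CollectI, rule exI[of _ "\<lambda>i k. r * c i k"]) (simp add: c sum_distrib_left mult.assoc)
  fix y assume "y \<in> cominor_span n M"
  then obtain e where e: "y = (\<Sum>i<n+2. \<Sum>k<n+2. e i k * cominor n M i k)"
    unfolding cominor_span_def by blast
  show "x + y \<in> cominor_span n M"
    unfolding cominor_span_def
    by (rule CollectI, rule exI[of _ "\<lambda>i k. c i k + e i k"])
      (simp add: c e distrib_right sum.distrib)
qed

lemma cominor_in_span:
  assumes "i < n + 2" "k < n + 2"
  shows "cominor n M i k \<in> cominor_span n M"
proof -
  have "(\<Sum>i'<n+2. \<Sum>k'<n+2. std_row i i' * std_row k k' * cominor n M i' k')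
      = (\<Sum>i'<n+2. std_row i i' * (\<Sum>k'<n+2. std_row k k' * cominor n M i' k'))"
    by (simp add: sum_distrib_left mult.assoc)
  also have "\<dots> = cominor n M i k"
    by (simp add: sum_std_row assms)
  finally show ?thesis
    unfolding cominor_span_def
    by (intro CollectI exI[of _ "\<lambda>i' k'. std_row i i' * std_row k k'"] conjI TrueI) (rule sym)
qed

text \<open>\<open>pick\<close> enumerates a set in increasing order, so an element is found by
  counting the smaller ones; the index jumps once at \<open>i\<close> and once more at
  \<open>k\<close>.\<close>

lemma pick_complement:
  assumes "i < k" "k < n + 2" "c < n"
  shows "pick ({..<n+2} - {i, k}) c = (if c < i then c else if Suc c < k then Suc c else Suc (Suc c))"
proof -
  let ?J = "{..<n+2} - {i, k}"
  define j where "j = (if c < i then c else if Suc c < k then Suc c else Suc (Suc c))"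
  have j: "j \<in> ?J" using assms by (auto simp: j_def)
  have "card {a \<in> ?J. a < j} = c"
  proof -
    have "{a \<in> ?J. a < j} = {..<j} - ({i, k} \<inter> {..<j})" using j by auto
    moreover have "card ({..<j} - ({i, k} \<inter> {..<j})) = j - card ({i, k} \<inter> {..<j})"
      by (subst card_Diff_subset) auto
    moreover have "{i, k} \<inter> {..<j} = (if c < i then {} else if Suc c < k then {i} else {i, k})"
      using assms by (auto simp: j_def)
    ultimately show ?thesis using assms by (auto simp: j_def)
  qed
  then show ?thesis using pick_card_in_set[OF j] by (simp add: j_def)
qed

text \<open>Expansion along the two border rows leaves the submatrix. The sign is recorded only as a
  unit, which suffices for membership in ideals.\<close>

lemma cominor_eq_minor:
  fixes A :: "'a::comm_ring_1 mat"
  assumes A: "A \<in> carrier_mat n (n + 2)" and ik: "i < k" "k < n + 2"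
  shows "\<exists>s. s * s = 1 \<and>
    cominor n (\<lambda>r c. A $$ (r, c)) i k = s * det (submatrix A {..<n} ({..<n+2} - {i, k}))"
proof -
  define M where "M = (\<lambda>r c. A $$ (r, c))"
  define B where "B = bordered n M (std_row i) (std_row k)"
  define C where "C = mat_delete B (n + 1) k"
  have C: "C \<in> carrier_mat (n + 1) (n + 1)"
    unfolding C_def using mat_delete_carrier[of B "n + 2" "n + 2" "n + 1" k] by (simp add: B_def)
  have Cidx: "C $$ (r, c) = B $$ (r, if c < k then c else Suc c)" if "r < n + 1" "c < n + 1" for r c
    using that by (simp add: C_def mat_delete_def B_def)
  have det1: "cominor n M i k = (-1) ^ (n + 1 + k) * det C"
  proof -
    have "cominor n M i k = (\<Sum>j<n+2. B $$ (n+1, j) * cofactor B (n+1) j)"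
      unfolding cominor_def B_def[symmetric] by (rule laplace_expansion_row) (auto simp: B_def)
    also have "\<dots> = (\<Sum>j<n+2. if j = k then cofactor B (n+1) j else 0)"
      by (rule sum.cong) (auto simp: B_def bordered_index std_row_def)
    finally show ?thesis using ik by (simp add: cofactor_def C_def)
  qed
  have det2: "det C = (-1) ^ (n + i) * det (mat_delete C n i)"
  proof -
    have "det C = (\<Sum>j<n+1. C $$ (n, j) * cofactor C n j)"
      by (rule laplace_expansion_row[OF C]) auto
    also have "\<dots> = (\<Sum>j<n+1. if j = i then cofactor C n j else 0)"
    proof (rule sum.cong)
      fix j assume j: "j \<in> {..<n+1}"
      then have "C $$ (n, j) = (if j = i then 1 else 0)"
        using ik by (auto simp: Cidx B_def bordered_index std_row_def)
      then show "C $$ (n, j) * cofactor C n j = (if j = i then cofactor C n j else 0)" by simp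
    qed simp
    finally show ?thesis using ik by (simp add: cofactor_def)
  qed
  have "mat_delete C n i = submatrix A {..<n} ({..<n+2} - {i, k})"
  proof (rule eq_matI)
    have d1: "{r. r < dim_row A \<and> r \<in> {..<n}} = {..<n}" using A by auto
    have d2: "{c. c < dim_col A \<and> c \<in> {..<n+2} - {i, k}} = {..<n+2} - {i, k}" using A by auto
    have d3: "card ({..<n+2} - {i, k}) = n" using ik by (subst card_Diff_subset) auto
    show dr: "dim_row (mat_delete C n i) = dim_row (submatrix A {..<n} ({..<n+2} - {i, k}))"
      using C unfolding dim_submatrix d1 by simp
    show dc: "dim_col (mat_delete C n i) = dim_col (submatrix A {..<n} ({..<n+2} - {i, k}))"
      using C unfolding dim_submatrix d2 d3 by simp
    fix r c assume "r < dim_row (submatrix A {..<n} ({..<n+2} - {i, k}))"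
      "c < dim_col (submatrix A {..<n} ({..<n+2} - {i, k}))"
    then have rc: "r < n" "c < n" unfolding dim_submatrix d1 d2 d3 by simp_all
    have pr: "pick {..<n} r = r"
    proof -
      have "{a \<in> {..<n}. a < r} = {..<r}" using rc by auto
      then show ?thesis using pick_card_in_set[of r "{..<n}"] rc by simp
    qed
    have "mat_delete C n i $$ (r, c) = C $$ (r, if c < i then c else Suc c)"
      using rc C by (simp add: mat_delete_def)
    also have "\<dots> = A $$ (r, pick ({..<n+2} - {i, k}) c)"
      using rc ik by (auto simp: Cidx pick_complement B_def bordered_index M_def)
    also have "\<dots> = submatrix A {..<n} ({..<n+2} - {i, k}) $$ (r, c)"
      using rc by (subst submatrix_index) (simp_all only: d1 d2 d3 pr card_lessThan)
    finally show "mat_delete C n i $$ (r, c) = submatrix A {..<n} ({..<n+2} - {i, k}) $$ (r, c)" .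
  qed
  then have "cominor n M i k = ((-1) ^ (n + 1 + k) * (-1) ^ (n + i)) * det (submatrix A {..<n} ({..<n+2} - {i, k}))"
    using det1 det2 by simp
  moreover have "((-1) ^ (n + 1 + k) * (-1) ^ (n + i)) * ((-1) ^ (n + 1 + k) * (-1) ^ (n + i)) = (1::'a)"
    by (simp flip: power_add power_mult_distrib)
  ultimately show ?thesis unfolding M_def by blast
qed

text \<open>A prime containing the span contains the minors, so the codimension hypothesis bounds
  its height.\<close>

lemma minors_ideal_subset_cominor_span:
  fixes A :: "'a::comm_ring_1 mat"
  assumes A: "A \<in> carrier_mat n (n + 2)"
  shows "minors_ideal n A \<subseteq> cominor_span n (\<lambda>r c. A $$ (r, c))"
proof -
  interpret R: cring "ring_of_type_algebra :: 'a ring" by (rule cring_from_type_algebra)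
  show ?thesis
    unfolding minors_ideal_def
  proof (rule R.genideal_minimal[OF ideal_cominor_span], rule subsetI)
    fix x assume "x \<in> {det (submatrix A I J) |I J.
        I \<subseteq> {..<dim_row A} \<and> card I = n \<and> J \<subseteq> {..<dim_col A} \<and> card J = n}"
    then obtain I J where x: "x = det (submatrix A I J)" and I: "I \<subseteq> {..<n}" "card I = n"
      and J: "J \<subseteq> {..<n+2}" "card J = n" using A by auto
    have I': "I = {..<n}" using I by (simp add: card_subset_eq)
    have "card ({..<n+2} - J) = 2" using J by (subst card_Diff_subset) (auto intro: finite_subset)
    then obtain i k where ik: "{..<n+2} - J = {i, k}" "i \<noteq> k" by (meson card_2_iff)
    obtain i k where ik: "{..<n+2} - J = {i, k}" "i < k"
      using ik by (metis insert_commute nat_neq_iff)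
    then have J': "J = {..<n+2} - {i, k}" and lt: "k < n + 2" "i < n + 2" using J(1) by blast+
    obtain s where s: "s * s = 1" "cominor n (\<lambda>r c. A $$ (r, c)) i k = s * x"
      using cominor_eq_minor[OF A ik(2) lt(1)] unfolding x I' J' by blast
    have "s * cominor n (\<lambda>r c. A $$ (r, c)) i k \<in> cominor_span n (\<lambda>r c. A $$ (r, c))"
      using ideal_cominor_span cominor_in_span[OF lt(2,1)] unfolding ideal_ring_of_type_algebra_iff by blast
    moreover have "s * cominor n (\<lambda>r c. A $$ (r, c)) i k = x"
      using s by (simp flip: mult.assoc)
    ultimately show "x \<in> cominor_span n (\<lambda>r c. A $$ (r, c))" by simp
  qed
qed

section \<open>Homogeneous polynomials\<close>

lemma mpoly_induct [case_names single add]: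
  fixes p :: "('v, 'k::comm_ring_1) mpoly"
  assumes "\<And>t c. P (Poly_Mapping.single t c)" and "\<And>p q. P p \<Longrightarrow> P q \<Longrightarrow> P (p + q)"
  shows "P p"
proof -
  have "P (\<Sum>t\<in>S. Poly_Mapping.single t (Poly_Mapping.lookup p t))" if "finite S" for S
    using that
  proof (induction S)
    case empty
    show ?case using assms(1)[of 0 0] by simp
  qed (simp add: assms)
  moreover have "(\<Sum>t\<in>Poly_Mapping.keys p. Poly_Mapping.single t (Poly_Mapping.lookup p t)) = p"
    by (rule poly_mapping_eqI) (simp add: lookup_sum lookup_single when_def in_keys_iff)
  ultimately show ?thesis by (metis finite_keys)
qed

lemma monomial_degree_add: "monomial_degree (s + t) = monomial_degree s + monomial_degree t"
  by (simp add: monomial_degree_def lookup_add sum.distrib)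

lemma monomial_degree_zero [simp]: "monomial_degree 0 = 0"
  by (simp add: monomial_degree_def)

lemma monomial_degree_single [simp]: "monomial_degree (Poly_Mapping.single v k) = k"
  by (simp add: monomial_degree_def lookup_single when_def)

lemma homogeneous_lookup:
  "homogeneous r p \<longleftrightarrow> (\<forall>t. Poly_Mapping.lookup p t \<noteq> 0 \<longrightarrow> int (monomial_degree t) = r)"
  by (auto simp: homogeneous_def in_keys_iff)

lemma homogeneous_zero [simp]: "homogeneous r 0"
  by (simp add: homogeneous_lookup)

lemma homogeneous_add: "homogeneous r p \<Longrightarrow> homogeneous r q \<Longrightarrow> homogeneous r (p + q)"
  for p :: "('v::finite, 'k::comm_ring_1) mpoly"
  unfolding homogeneous_lookup lookup_add by (metis add_0)

lemma homogeneous_uminus: "homogeneous r p \<Longrightarrow> homogeneous r (- p)"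
  for p :: "('v::finite, 'k::comm_ring_1) mpoly"
  by (auto simp: homogeneous_lookup)

lemma homogeneous_diff: "homogeneous r p \<Longrightarrow> homogeneous r q \<Longrightarrow> homogeneous r (p - q)"
  for p :: "('v::finite, 'k::comm_ring_1) mpoly"
  using homogeneous_add[of r p "- q"] homogeneous_uminus[of r q] by simp

lemma homogeneous_mult:
  fixes p :: "('v::finite, 'k::comm_ring_1) mpoly"
  assumes "homogeneous r p" "homogeneous s q"
  shows "homogeneous (r + s) (p * q)"
  using assms keys_mult[of p q] by (fastforce simp: homogeneous_def monomial_degree_add)

lemma homogeneous_sum:
  fixes f :: "'i \<Rightarrow> ('v::finite, 'k::comm_ring_1) mpoly"
  shows "(\<And>i. i \<in> A \<Longrightarrow> homogeneous r (f i)) \<Longrightarrow> homogeneous r (sum f A)"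
  by (induction A rule: infinite_finite_induct) (auto intro: homogeneous_add)

lemma homogeneous_single: "int (monomial_degree t) = r \<Longrightarrow> homogeneous r (Poly_Mapping.single t c)"
  by (auto simp: homogeneous_lookup lookup_single when_def)

lemma homogeneous_one: "homogeneous 0 (1 :: ('v::finite, 'k::comm_ring_1) mpoly)"
  unfolding single_one[symmetric] by (rule homogeneous_single) simp

lemma homogeneous_prod:
  fixes f :: "'i \<Rightarrow> ('v::finite, 'k::comm_ring_1) mpoly"
  shows "(\<And>i. i \<in> A \<Longrightarrow> homogeneous (r i) (f i)) \<Longrightarrow> homogeneous (sum r A) (prod f A)"
  by (induction A rule: infinite_finite_induct) (auto intro: homogeneous_mult homogeneous_one)

lemma homogeneous_power:
  fixes p :: "('v::finite, 'k::comm_ring_1) mpoly"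
  assumes "homogeneous r p"
  shows "homogeneous (int n * r) (p ^ n)"
proof (induction n)
  case (Suc n)
  then show ?case using homogeneous_mult[OF assms Suc] by (simp add: algebra_simps)
qed (simp add: homogeneous_one)

text \<open>The degree is an integer so that the shifts by twists need no case distinction; a
  component of negative degree is zero.\<close>

definition hcomp :: "int \<Rightarrow> ('v::finite, 'k::comm_ring_1) mpoly \<Rightarrow> ('v, 'k) mpoly" where
  "hcomp r p = (\<Sum>t | t \<in> Poly_Mapping.keys p \<and> int (monomial_degree t) = r.
     Poly_Mapping.single t (Poly_Mapping.lookup p t))"

lemma lookup_hcomp:
  "Poly_Mapping.lookup (hcomp r p) t = (if int (monomial_degree t) = r then Poly_Mapping.lookup p t else 0)"
proof -
  have "Poly_Mapping.lookup (hcomp r p) t =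
    (\<Sum>s | s \<in> Poly_Mapping.keys p \<and> int (monomial_degree s) = r. if s = t then Poly_Mapping.lookup p s else 0)"
    unfolding hcomp_def lookup_sum by (rule sum.cong) (auto simp: lookup_single when_def)
  then show ?thesis by (auto simp: in_keys_iff)
qed

lemma homogeneous_hcomp: "homogeneous r (hcomp r p)"
  by (simp add: homogeneous_lookup lookup_hcomp)

lemma hcomp_add: "hcomp r (p + q) = hcomp r p + hcomp r q"
  by (rule poly_mapping_eqI) (simp add: lookup_hcomp lookup_add)

lemma hcomp_zero [simp]: "hcomp r 0 = 0"
  by (rule poly_mapping_eqI) (simp add: lookup_hcomp)

lemma hcomp_sum: "hcomp r (sum f A) = (\<Sum>i\<in>A. hcomp r (f i))"
  by (induction A rule: infinite_finite_induct) (auto simp: hcomp_add)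

lemma hcomp_homogeneous: "homogeneous s p \<Longrightarrow> hcomp r p = (if r = s then p else 0)"
  by (rule poly_mapping_eqI) (auto simp: lookup_hcomp homogeneous_lookup)

lemma hcomp_mult:
  fixes p q :: "('v::finite, 'k::comm_ring_1) mpoly"
  assumes "homogeneous s q"
  shows "hcomp r (p * q) = hcomp (r - s) p * q"
proof (induction p rule: mpoly_induct)
  case (single t c)
  have t: "homogeneous (int (monomial_degree t)) (Poly_Mapping.single t c)"
    by (rule homogeneous_single) simp
  show ?case
    unfolding hcomp_homogeneous[OF homogeneous_mult[OF t assms]] hcomp_homogeneous[OF t] by auto
qed (simp add: distrib_right hcomp_add)

lemma hcomp_mult_left:
  fixes p q :: "('v::finite, 'k::comm_ring_1) mpoly"
  assumes "homogeneous s q"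
  shows "hcomp r (q * p) = q * hcomp (r - s) p"
  using hcomp_mult[OF assms, of r p] by (simp add: mult.commute)

lemma sum_hcomp:
  fixes p :: "('v::finite, 'k::comm_ring_1) mpoly"
  assumes "finite S" "\<And>t. t \<in> Poly_Mapping.keys p \<Longrightarrow> int (monomial_degree t) \<in> S"
  shows "(\<Sum>r\<in>S. hcomp r p) = p"
proof (rule poly_mapping_eqI)
  fix t
  have "Poly_Mapping.lookup (\<Sum>r\<in>S. hcomp r p) t
      = (\<Sum>r\<in>S. if r = int (monomial_degree t) then Poly_Mapping.lookup p t else 0)"
    unfolding lookup_sum by (rule sum.cong) (auto simp: lookup_hcomp)
  also have "\<dots> = Poly_Mapping.lookup p t"
    using assms by (auto simp: in_keys_iff)
  finally show "Poly_Mapping.lookup (\<Sum>r\<in>S. hcomp r p) t = Poly_Mapping.lookup p t" .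
qed

section \<open>Variables, constants and evaluation homomorphisms\<close>

definition mvar :: "'v \<Rightarrow> ('v, 'k::comm_ring_1) mpoly" where
  "mvar v = Poly_Mapping.single (Poly_Mapping.single v 1) 1"

abbreviation mconst :: "'k::zero \<Rightarrow> ('v, 'k) mpoly" where
  "mconst c \<equiv> Poly_Mapping.single 0 c"

lemma homogeneous_mvar: "homogeneous 1 (mvar v)"
  unfolding mvar_def by (rule homogeneous_single) simp

lemma homogeneous_mconst: "homogeneous 0 (mconst c)"
  by (rule homogeneous_single) simp

definition mpeval :: "('k::comm_ring_1 \<Rightarrow> 'c::comm_ring_1) \<Rightarrow> ('v::finite \<Rightarrow> 'c) \<Rightarrow> ('v, 'k) mpoly \<Rightarrow> 'c" where
  "mpeval h f p = (\<Sum>t\<in>Poly_Mapping.keys p. h (Poly_Mapping.lookup p t) * (\<Prod>v\<in>UNIV. f v ^ Poly_Mapping.lookup t v))"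

context comm_ring_hom
begin

lemma mpeval_single: "mpeval hom f (Poly_Mapping.single t c) = hom c * (\<Prod>v\<in>UNIV. f v ^ Poly_Mapping.lookup t v)"
  by (cases "c = 0") (simp_all add: mpeval_def)

lemma mpeval_superset:
  assumes "finite S" "Poly_Mapping.keys p \<subseteq> S"
  shows "mpeval hom f p = (\<Sum>t\<in>S. hom (Poly_Mapping.lookup p t) * (\<Prod>v\<in>UNIV. f v ^ Poly_Mapping.lookup t v))"
  unfolding mpeval_def using assms by (intro sum.mono_neutral_left) (auto simp: in_keys_iff)

lemma mpeval_add: "mpeval hom f (p + q) = mpeval hom f p + mpeval hom f q"
proof -
  have 1: "finite (Poly_Mapping.keys p \<union> Poly_Mapping.keys q)" by simp
  show ?thesis
    unfolding mpeval_superset[OF 1 keys_add] mpeval_superset[OF 1 Un_upper1] mpeval_superset[OF 1 Un_upper2]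
    by (simp add: lookup_add hom_add distrib_right sum.distrib)
qed

lemma mpeval_mult: "mpeval hom f (p * q) = mpeval hom f p * mpeval hom f q"
proof (induction p rule: mpoly_induct)
  case (single s c)
  show ?case
  proof (induction q rule: mpoly_induct)
    case (single t d)
    show ?case
      by (simp add: mult_single mpeval_single hom_mult lookup_add power_add prod.distrib mult_ac)
  qed (simp add: distrib_left mpeval_add)
qed (simp add: distrib_right mpeval_add)

lemma comm_ring_hom_mpeval: "comm_ring_hom (mpeval hom f)"
proof
  show "mpeval hom f 1 = 1"
    unfolding single_one[symmetric] mpeval_single by simp
  show "mpeval hom f 0 = 0" by (simp add: mpeval_def)
qed (simp_all add: mpeval_add mpeval_mult)

lemma mpeval_mconst: "mpeval hom f (mconst c) = hom c"
  by (simp add: mpeval_single)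

lemma mpeval_mvar: "mpeval hom f (mvar v) = f v"
proof -
  have "(\<Prod>w\<in>UNIV. f w ^ Poly_Mapping.lookup (Poly_Mapping.single v (1::nat)) w) = (\<Prod>w\<in>UNIV. if w = v then f w else 1)"
    by (rule prod.cong) (auto simp: lookup_single when_def)
  then show ?thesis by (simp add: mvar_def mpeval_single)
qed

end

lemma single_eq_prod_mvar:
  "Poly_Mapping.single t c = mconst c * (\<Prod>v\<in>UNIV. mvar v ^ Poly_Mapping.lookup t v)"
  for t :: "'v::finite \<Rightarrow>\<^sub>0 nat" and c :: "'k::comm_ring_1"
proof -
  have pow: "mvar v ^ k = (Poly_Mapping.single (Poly_Mapping.single v k) 1 :: ('v, 'k) mpoly)" for v k
    by (induction k) (simp_all add: mvar_def mult_single single_add[symmetric])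
  have "(\<Prod>v\<in>S. mvar v ^ Poly_Mapping.lookup t v)
      = (Poly_Mapping.single (\<Sum>v\<in>S. Poly_Mapping.single v (Poly_Mapping.lookup t v)) 1 :: ('v, 'k) mpoly)"
    if "finite S" for S
    using that by (induction S) (simp_all add: pow mult_single)
  moreover have "(\<Sum>v\<in>UNIV. Poly_Mapping.single v (Poly_Mapping.lookup t v)) = t"
    by (rule poly_mapping_eqI) (simp add: lookup_sum lookup_single when_def)
  ultimately show ?thesis by (simp add: mult_single)
qed

lemma comm_ring_hom_prod:
  assumes "comm_ring_hom g"
  shows "g (prod f A) = (\<Prod>x\<in>A. g (f x))"
proof -
  interpret comm_ring_hom g by fact
  show ?thesis by (induction A rule: infinite_finite_induct) (simp_all add: hom_mult)
qed

lemma mpoly_hom_eq_mpeval: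
  fixes g :: "('v::finite, 'k::comm_ring_1) mpoly \<Rightarrow> 'c::comm_ring_1"
  assumes g: "comm_ring_hom g" and h: "comm_ring_hom h"
    and "\<And>c. g (mconst c) = h c" and "\<And>v. g (mvar v) = f v"
  shows "g p = mpeval h f p"
proof -
  interpret g: comm_ring_hom g by fact
  interpret h: comm_ring_hom h by fact
  show ?thesis
  proof (induction p rule: mpoly_induct)
    case (single t c)
    show ?case
      unfolding h.mpeval_single
      by (simp add: single_eq_prod_mvar[of t c] g.hom_mult comm_ring_hom_prod[OF g] g.hom_power assms)
  qed (simp add: g.hom_add h.mpeval_add)
qed


section \<open>Powers of the variables as a regular sequence\<close>

lemma mvar_power: "mvar v ^ k = (Poly_Mapping.single (Poly_Mapping.single v k) 1 :: ('v, 'k::comm_ring_1) mpoly)"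
  by (induction k) (simp_all add: mvar_def mult_single single_add[symmetric])

lemma lookup_mvar_power_mult:
  fixes p :: "('v::finite, 'k::comm_ring_1) mpoly"
  shows "Poly_Mapping.lookup (mvar v ^ k * p) t =
    (if k \<le> Poly_Mapping.lookup t v then Poly_Mapping.lookup p (t - Poly_Mapping.single v k) else 0)"
proof (induction p rule: mpoly_induct)
  case (single s c)
  have "Poly_Mapping.single v k + s = t \<longleftrightarrow> k \<le> Poly_Mapping.lookup t v \<and> s = t - Poly_Mapping.single v k"
  proof
    assume "Poly_Mapping.single v k + s = t"
    then show "k \<le> Poly_Mapping.lookup t v \<and> s = t - Poly_Mapping.single v k"
      by (auto simp: lookup_add lookup_single)
  next
    assume *: "k \<le> Poly_Mapping.lookup t v \<and> s = t - Poly_Mapping.single v k"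
    show "Poly_Mapping.single v k + s = t"
      by (rule poly_mapping_eqI) (use * in \<open>auto simp: lookup_add lookup_minus lookup_single when_def\<close>)
  qed
  then show ?case
    by (auto simp: mvar_power mult_single lookup_single when_def)
qed (simp add: distrib_left lookup_add)

lemma mvar_power_division:
  fixes p :: "('v::finite, 'k::comm_ring_1) mpoly"
  obtains q r where "p = mvar v ^ k * q + r"
    and "\<And>t. Poly_Mapping.lookup r t \<noteq> 0 \<Longrightarrow> Poly_Mapping.lookup t v < k"
    and "\<And>t. Poly_Mapping.lookup r t \<noteq> 0 \<Longrightarrow> Poly_Mapping.lookup p t \<noteq> 0"
proof -
  \<comment> \<open>The quotient has at \<open>t\<close> the coefficient of \<open>p\<close> at
    \<open>t\<close> shifted by \<open>k\<close> in the variable \<open>v\<close>. Induction on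
    \<open>p\<close> produces a polynomial with these coefficients, so finiteness of the support
    comes for free.\<close>
  define P where "P p \<longleftrightarrow> (\<exists>q. \<forall>t. Poly_Mapping.lookup q t = Poly_Mapping.lookup p (t + Poly_Mapping.single v k))"
    for p :: "('v, 'k) mpoly"
  have "P p"
  proof (induction p rule: mpoly_induct)
    case (single s c)
    show ?case
    proof (cases "k \<le> Poly_Mapping.lookup s v")
      case True
      have "s = t + Poly_Mapping.single v k \<longleftrightarrow> t = s - Poly_Mapping.single v k" for t
      proof
        assume t: "t = s - Poly_Mapping.single v k"
        show "s = t + Poly_Mapping.single v k"
          by (rule poly_mapping_eqI) (use t True in \<open>auto simp: lookup_add lookup_minus lookup_single when_def\<close>)
      qed simp
      then show ?thesis
        unfolding P_def
        by (intro exI[of _ "Poly_Mapping.single (s - Poly_Mapping.single v k) c"])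
          (auto simp: lookup_single when_def)
    next
      case False
      then have "s \<noteq> t + Poly_Mapping.single v k" for t
        by (auto simp: lookup_add lookup_single)
      then show ?thesis unfolding P_def by (intro exI[of _ 0]) (simp add: lookup_single when_def)
    qed
  next
    case (add p q)
    then obtain p' q' where "\<forall>t. Poly_Mapping.lookup p' t = Poly_Mapping.lookup p (t + Poly_Mapping.single v k)"
      "\<forall>t. Poly_Mapping.lookup q' t = Poly_Mapping.lookup q (t + Poly_Mapping.single v k)"
      unfolding P_def by blast
    then show ?case unfolding P_def by (intro exI[of _ "p' + q'"]) (simp add: lookup_add)
  qed
  then obtain q where q: "\<And>t. Poly_Mapping.lookup q t = Poly_Mapping.lookup p (t + Poly_Mapping.single v k)"
    unfolding P_def by blast
  have r: "Poly_Mapping.lookup (p - mvar v ^ k * q) t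
      = (if k \<le> Poly_Mapping.lookup t v then 0 else Poly_Mapping.lookup p t)" for t
  proof -
    have "t - Poly_Mapping.single v k + Poly_Mapping.single v k = t" if "k \<le> Poly_Mapping.lookup t v"
      by (rule poly_mapping_eqI) (use that in \<open>auto simp: lookup_add lookup_minus lookup_single when_def\<close>)
    then show ?thesis by (simp add: lookup_minus lookup_mvar_power_mult q)
  qed
  show ?thesis
    by (rule that[of q "p - mvar v ^ k * q"]) (auto simp: r split: if_splits)
qed

lemma mvar_power_dvd_iff:
  fixes p :: "('v::finite, 'k::comm_ring_1) mpoly"
  shows "mvar v ^ k dvd p \<longleftrightarrow> (\<forall>t. Poly_Mapping.lookup p t \<noteq> 0 \<longrightarrow> k \<le> Poly_Mapping.lookup t v)"
proof
  assume "mvar v ^ k dvd p"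
  then obtain q where "p = mvar v ^ k * q" by (elim dvdE)
  then show "\<forall>t. Poly_Mapping.lookup p t \<noteq> 0 \<longrightarrow> k \<le> Poly_Mapping.lookup t v"
    by (auto simp: lookup_mvar_power_mult)
next
  assume *: "\<forall>t. Poly_Mapping.lookup p t \<noteq> 0 \<longrightarrow> k \<le> Poly_Mapping.lookup t v"
  obtain q r where qr: "p = mvar v ^ k * q + r"
    "\<And>t. Poly_Mapping.lookup r t \<noteq> 0 \<Longrightarrow> Poly_Mapping.lookup t v < k"
    "\<And>t. Poly_Mapping.lookup r t \<noteq> 0 \<Longrightarrow> Poly_Mapping.lookup p t \<noteq> 0"
    by (rule mvar_power_division[of p v k]) blast
  have "r = 0" by (rule poly_mapping_eqI) (use qr * in force)
  then show "mvar v ^ k dvd p" using qr by simp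
qed

text \<open>Multiplication by a power of \<open>mvar w\<close> moves only the exponent of
  \<open>w\<close>, hence does not affect divisibility by powers of \<open>mvar v\<close>.\<close>

lemma mvar_power_regular1:
  fixes p :: "('v::finite, 'k::comm_ring_1) mpoly"
  assumes "v \<noteq> w" "mvar v ^ k dvd mvar w ^ l * p"
  shows "mvar v ^ k dvd p"
  unfolding mvar_power_dvd_iff
proof (intro allI impI)
  fix t assume t: "Poly_Mapping.lookup p t \<noteq> 0"
  have "Poly_Mapping.lookup (mvar w ^ l * p) (t + Poly_Mapping.single w l) \<noteq> 0"
    using t by (simp add: lookup_mvar_power_mult lookup_add lookup_single)
  with assms(2) have "k \<le> Poly_Mapping.lookup (t + Poly_Mapping.single w l) v"
    unfolding mvar_power_dvd_iff by blast
  then show "k \<le> Poly_Mapping.lookup t v" using assms(1) by (simp add: lookup_add lookup_single)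
qed

text \<open>Reduce \<open>p\<close> modulo \<open>mvar u ^ k\<close>. The remainder has exponents
  below \<open>k\<close> in \<open>u\<close>, and so has its multiple by \<open>mvar w ^ l\<close>;
  its monomials can only come from the term with \<open>mvar v ^ m\<close>, which therefore divides
  the remainder.\<close>

lemma mvar_power_regular2:
  fixes p :: "('v::finite, 'k::comm_ring_1) mpoly"
  assumes "u \<noteq> v" "u \<noteq> w" "v \<noteq> w" "mvar w ^ l * p = mvar u ^ k * a + mvar v ^ m * b"
  obtains a' b' where "p = mvar u ^ k * a' + mvar v ^ m * b'"
proof -
  obtain q r where qr: "p = mvar u ^ k * q + r"
    "\<And>t. Poly_Mapping.lookup r t \<noteq> 0 \<Longrightarrow> Poly_Mapping.lookup t u < k"
    by (rule mvar_power_division[of p u k]) blast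
  have "mvar v ^ m dvd r"
    unfolding mvar_power_dvd_iff
  proof (intro allI impI)
    fix t assume t: "Poly_Mapping.lookup r t \<noteq> 0"
    let ?t = "t + Poly_Mapping.single w l"
    have "Poly_Mapping.lookup (mvar w ^ l * r) ?t \<noteq> 0"
      using t by (simp add: lookup_mvar_power_mult lookup_add lookup_single)
    moreover have "mvar w ^ l * r = mvar u ^ k * (a - mvar w ^ l * q) + mvar v ^ m * b"
      using assms(4) unfolding qr(1) by (simp add: algebra_simps)
    moreover have "Poly_Mapping.lookup (mvar u ^ k * (a - mvar w ^ l * q)) ?t = 0"
      using qr(2)[OF t] assms(1,2) by (simp add: lookup_mvar_power_mult lookup_add lookup_single)
    ultimately have "Poly_Mapping.lookup (mvar v ^ m * b) ?t \<noteq> 0" by (simp add: lookup_add)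
    then have "m \<le> Poly_Mapping.lookup ?t v" by (auto simp: lookup_mvar_power_mult split: if_splits)
    then show "m \<le> Poly_Mapping.lookup t v" using assms(3) by (simp add: lookup_add lookup_single)
  qed
  then obtain b' where "r = mvar v ^ m * b'" by (elim dvdE)
  then show ?thesis using that qr(1) by blast
qed


section \<open>Exactness of the Buchsbaum-Rim complex\<close>

text \<open>Cramer's rule extended linearly from one minor to the ideal: the ideal of minors
  annihilates the homology of the Buchsbaum-Rim complex at the source of \<open>M\<close>.\<close>

lemma cominor_span_kernel:
  fixes M :: "nat \<Rightarrow> nat \<Rightarrow> 'a::comm_ring_1"
  assumes W: "W \<in> cominor_span n M" and u: "\<And>r. r < n \<Longrightarrow> (\<Sum>c<n+2. M r c * u c) = 0"
  obtains \<alpha> where "\<And>c. c < n + 2 \<Longrightarrow> W * u c = (\<Sum>j<n+2. cominor n M c j * \<alpha> j)"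
proof -
  obtain e where e: "W = (\<Sum>i<n+2. \<Sum>k<n+2. e i k * cominor n M i k)"
    using W unfolding cominor_span_def by blast
  \<comment> \<open>Each minor contributes the vector with entry \<open>u i\<close> at
    \<open>k\<close> and entry \<open>- u k\<close> at \<open>i\<close>.\<close>
  define \<alpha> where "\<alpha> j = (\<Sum>i<n+2. \<Sum>k<n+2. e i k * (u i * std_row k j - u k * std_row i j))" for j
  have "W * u c = (\<Sum>j<n+2. cominor n M c j * \<alpha> j)" if c: "c < n + 2" for c
  proof -
    have 1: "cominor n M i k * u c = (\<Sum>j<n+2. cominor n M c j * (u i * std_row k j - u k * std_row i j))"
      if ik: "i < n + 2" "k < n + 2" for i k
    proof -
      have "(\<Sum>j<n+2. cominor n M c j * (u i * std_row k j - u k * std_row i j))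
          = u i * (\<Sum>j<n+2. cominor n M c j * std_row k j) - u k * (\<Sum>j<n+2. cominor n M c j * std_row i j)"
        by (simp add: sum_subtractf sum_distrib_left algebra_simps)
      also have "\<dots> = u i * cominor n M c k - u k * cominor n M c i"
        using ik by (simp add: sum_std_row)
      also have "\<dots> = cominor n M i k * u c"
        using cominor_kernel[of n M u i k c, OF u ik c] cominor_swap[of n M c i] by simp
      finally show ?thesis ..
    qed
    have "W * u c = (\<Sum>i<n+2. \<Sum>k<n+2. e i k * (cominor n M i k * u c))"
      by (simp add: e sum_distrib_right mult.assoc)
    also have "\<dots> = (\<Sum>i<n+2. \<Sum>k<n+2. \<Sum>j<n+2. cominor n M c j * (e i k * (u i * std_row k j - u k * std_row i j)))"
      by (intro sum.cong refl) (simp add: 1 sum_distrib_left mult.left_commute)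
    also have "\<dots> = (\<Sum>i<n+2. \<Sum>j<n+2. \<Sum>k<n+2. cominor n M c j * (e i k * (u i * std_row k j - u k * std_row i j)))"
      by (intro sum.cong refl sum.swap)
    also have "\<dots> = (\<Sum>j<n+2. \<Sum>i<n+2. \<Sum>k<n+2. cominor n M c j * (e i k * (u i * std_row k j - u k * std_row i j)))"
      by (rule sum.swap)
    also have "\<dots> = (\<Sum>j<n+2. cominor n M c j * \<alpha> j)"
      by (simp add: \<alpha>_def sum_distrib_left)
    finally show ?thesis .
  qed
  then show ?thesis by (rule that)
qed

lemma cominor_span_cokernel:
  fixes M :: "nat \<Rightarrow> nat \<Rightarrow> 'a::comm_ring_1"
  assumes W: "W \<in> cominor_span n M" and p: "\<And>c. c < n + 2 \<Longrightarrow> (\<Sum>r<n. p r * M r c) = 0" and r: "r < n"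
  shows "W * p r = 0"
proof -
  obtain e where e: "W = (\<Sum>i<n+2. \<Sum>k<n+2. e i k * cominor n M i k)"
    using W unfolding cominor_span_def by blast
  show ?thesis
    unfolding e sum_distrib_right mult.assoc
    by (intro sum.neutral ballI) (simp add: cominor_cokernel[of n p M r, OF p r])
qed

lemma cominor_span_corow:
  fixes M :: "nat \<Rightarrow> nat \<Rightarrow> 'a::comm_ring_1"
  assumes W: "W \<in> cominor_span n M" and w: "\<And>c. c < n + 2 \<Longrightarrow> (\<Sum>j<n+2. cominor n M c j * w j) = 0"
  obtains p where "\<And>c. c < n + 2 \<Longrightarrow> W * w c = (\<Sum>r<n. p r * M r c)"
proof -
  obtain e where e: "W = (\<Sum>i<n+2. \<Sum>k<n+2. e i k * cominor n M i k)"
    using W unfolding cominor_span_def by blast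
  have "\<exists>p. \<forall>c<n+2. cominor n M i k * w c = (\<Sum>r<n. p r * M r c)" if ik: "i < n + 2" "k < n + 2" for i k
  proof -
    obtain p where p: "\<And>c. c < n + 2 \<Longrightarrow> cominor n M i k * w c = (\<Sum>r<n. p r * M r c)
      + (\<Sum>j<n+2. w j * cominor n M j k) * std_row i c + (\<Sum>j<n+2. w j * cominor n M i j) * std_row k c"
      using cominor_corow[OF ik, of M w] by blast
    have "(\<Sum>j<n+2. w j * cominor n M i j) = 0"
      using w[OF ik(1)] by (simp add: mult.commute)
    moreover have "(\<Sum>j<n+2. w j * cominor n M j k) = - (\<Sum>j<n+2. cominor n M k j * w j)"
      by (subst cominor_swap) (simp add: sum_negf mult.commute)
    ultimately show ?thesis using p w[OF ik(2)] by auto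
  qed
  then obtain P where P: "\<And>i k c. i < n + 2 \<Longrightarrow> k < n + 2 \<Longrightarrow> c < n + 2 \<Longrightarrow>
      cominor n M i k * w c = (\<Sum>r<n. P i k r * M r c)" by metis
  have "W * w c = (\<Sum>r<n. (\<Sum>i<n+2. \<Sum>k<n+2. e i k * P i k r) * M r c)" if c: "c < n + 2" for c
  proof -
    have "W * w c = (\<Sum>i<n+2. \<Sum>k<n+2. e i k * (cominor n M i k * w c))"
      by (simp add: e sum_distrib_right mult.assoc)
    also have "\<dots> = (\<Sum>i<n+2. \<Sum>k<n+2. \<Sum>r<n. e i k * P i k r * M r c)"
      by (intro sum.cong refl) (simp add: P c sum_distrib_left mult.assoc)
    also have "\<dots> = (\<Sum>i<n+2. \<Sum>r<n. \<Sum>k<n+2. e i k * P i k r * M r c)"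
      by (intro sum.cong refl sum.swap)
    also have "\<dots> = (\<Sum>r<n. \<Sum>i<n+2. \<Sum>k<n+2. e i k * P i k r * M r c)"
      by (rule sum.swap)
    finally show ?thesis by (simp add: sum_distrib_right)
  qed
  then show ?thesis by (rule that)
qed

text \<open>Acyclicity by a diagram chase. Each of the three elements annihilates the homology, and
  together they form a regular sequence: one of them gives injectivity of the leftmost map, two give
  exactness at the next place, and all three are spent on the place in question.\<close>

lemma buchsbaum_rim_exact:
  fixes M :: "nat \<Rightarrow> nat \<Rightarrow> 'a::idom"
  assumes span: "W\<^sub>1 \<in> cominor_span n M" "W\<^sub>2 \<in> cominor_span n M" "W\<^sub>3 \<in> cominor_span n M"
    and nz: "W\<^sub>1 \<noteq> 0" and reg1: "\<And>p. W\<^sub>1 dvd W\<^sub>2 * p \<Longrightarrow> W\<^sub>1 dvd p"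
    and reg2: "\<And>p a b. W\<^sub>3 * p = W\<^sub>1 * a + W\<^sub>2 * b \<Longrightarrow> \<exists>a b. p = W\<^sub>1 * a + W\<^sub>2 * b"
    and u: "\<And>r. r < n \<Longrightarrow> (\<Sum>c<n+2. M r c * u c) = 0"
  obtains \<psi> where "\<And>c. c < n + 2 \<Longrightarrow> u c = (\<Sum>j<n+2. cominor n M c j * \<psi> j)"
proof -
  have inj: "p r = 0" if "\<And>c. c < n + 2 \<Longrightarrow> (\<Sum>r<n. p r * M r c) = 0" "r < n" for p r
    using cominor_span_cokernel[OF span(1) that] nz by simp
  \<comment> \<open>Both \<open>W\<^sub>1 * w\<close> and \<open>W\<^sub>2 * w\<close> are
    combinations of rows, with coefficients \<open>p\<close> and \<open>q\<close>. Injectivity gives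
    \<open>W\<^sub>2 * p = W\<^sub>1 * q\<close>, regularity makes \<open>p\<close> divisible by
    \<open>W\<^sub>1\<close>, and \<open>W\<^sub>1\<close> cancels.\<close>
  have exact: "\<exists>p. \<forall>c<n+2. w c = (\<Sum>r<n. p r * M r c)"
    if w: "\<And>c. c < n + 2 \<Longrightarrow> (\<Sum>j<n+2. cominor n M c j * w j) = 0" for w
  proof -
    obtain p where p: "\<And>c. c < n + 2 \<Longrightarrow> W\<^sub>1 * w c = (\<Sum>r<n. p r * M r c)"
      using cominor_span_corow[OF span(1) w] by blast
    obtain q where q: "\<And>c. c < n + 2 \<Longrightarrow> W\<^sub>2 * w c = (\<Sum>r<n. q r * M r c)"
      using cominor_span_corow[OF span(2) w] by blast
    have "(\<Sum>r<n. (W\<^sub>2 * p r - W\<^sub>1 * q r) * M r c) = 0" if c: "c < n + 2" for c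
    proof -
      have "(\<Sum>r<n. (W\<^sub>2 * p r - W\<^sub>1 * q r) * M r c) = W\<^sub>2 * (\<Sum>r<n. p r * M r c) - W\<^sub>1 * (\<Sum>r<n. q r * M r c)"
        by (simp add: left_diff_distrib sum_subtractf sum_distrib_left mult.assoc)
      also have "\<dots> = 0"
        unfolding p[OF c, symmetric] q[OF c, symmetric] by (simp add: algebra_simps)
      finally show ?thesis .
    qed
    then have "W\<^sub>2 * p r = W\<^sub>1 * q r" if "r < n" for r
      using inj[of "\<lambda>r. W\<^sub>2 * p r - W\<^sub>1 * q r" r] that by simp
    then have "\<forall>r. r < n \<longrightarrow> W\<^sub>1 dvd p r"
      using reg1 by (metis dvd_triv_left)
    then have "\<forall>r. r < n \<longrightarrow> (\<exists>p'. p r = W\<^sub>1 * p')"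
      by (auto elim: dvdE)
    then obtain p' where p': "\<And>r. r < n \<Longrightarrow> p r = W\<^sub>1 * p' r" by metis
    have "w c = (\<Sum>r<n. p' r * M r c)" if c: "c < n + 2" for c
    proof -
      have "W\<^sub>1 * w c = W\<^sub>1 * (\<Sum>r<n. p' r * M r c)"
        unfolding p[OF c] sum_distrib_left by (intro sum.cong refl) (simp add: p' mult.assoc)
      then show ?thesis using nz by simp
    qed
    then show ?thesis by blast
  qed
  obtain \<alpha> where \<alpha>: "\<And>c. c < n + 2 \<Longrightarrow> W\<^sub>1 * u c = (\<Sum>j<n+2. cominor n M c j * \<alpha> j)"
    using cominor_span_kernel[OF span(1) u] by blast
  obtain \<beta> where \<beta>: "\<And>c. c < n + 2 \<Longrightarrow> W\<^sub>2 * u c = (\<Sum>j<n+2. cominor n M c j * \<beta> j)"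
    using cominor_span_kernel[OF span(2) u] by blast
  obtain \<gamma> where \<gamma>: "\<And>c. c < n + 2 \<Longrightarrow> W\<^sub>3 * u c = (\<Sum>j<n+2. cominor n M c j * \<gamma> j)"
    using cominor_span_kernel[OF span(3) u] by blast
  \<comment> \<open>Both \<open>B * f\<close> and \<open>A * g\<close> are sent by the cominors to
    \<open>A * B * u\<close>, so the difference is a combination of rows.\<close>
  have cross: "\<exists>p. \<forall>c<n+2. B * f c - A * g c = (\<Sum>r<n. p r * M r c)"
    if f: "\<And>c. c < n + 2 \<Longrightarrow> A * u c = (\<Sum>j<n+2. cominor n M c j * f j)"
      and g: "\<And>c. c < n + 2 \<Longrightarrow> B * u c = (\<Sum>j<n+2. cominor n M c j * g j)" for A B f g
  proof (rule exact)
    fix c assume c: "c < n + 2"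
    have "(\<Sum>j<n+2. cominor n M c j * (B * f j - A * g j))
        = B * (\<Sum>j<n+2. cominor n M c j * f j) - A * (\<Sum>j<n+2. cominor n M c j * g j)"
      by (simp add: right_diff_distrib sum_subtractf sum_distrib_left mult.left_commute)
    also have "\<dots> = 0"
      unfolding f[OF c, symmetric] g[OF c, symmetric] by (simp add: algebra_simps)
    finally show "(\<Sum>j<n+2. cominor n M c j * (B * f j - A * g j)) = 0" .
  qed
  obtain p1 where p1: "\<And>c. c < n + 2 \<Longrightarrow> W\<^sub>2 * \<alpha> c - W\<^sub>1 * \<beta> c = (\<Sum>r<n. p1 r * M r c)"
    using cross[OF \<alpha> \<beta>] by blast
  obtain p2 where p2: "\<And>c. c < n + 2 \<Longrightarrow> W\<^sub>3 * \<alpha> c - W\<^sub>1 * \<gamma> c = (\<Sum>r<n. p2 r * M r c)"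
    using cross[OF \<alpha> \<gamma>] by blast
  obtain p3 where p3: "\<And>c. c < n + 2 \<Longrightarrow> W\<^sub>3 * \<beta> c - W\<^sub>2 * \<gamma> c = (\<Sum>r<n. p3 r * M r c)"
    using cross[OF \<beta> \<gamma>] by blast
  \<comment> \<open>The Koszul relation between the three differences lifts to their coefficients by
    injectivity.\<close>
  have rel: "W\<^sub>3 * p1 r - W\<^sub>2 * p2 r + W\<^sub>1 * p3 r = 0" if "r < n" for r
  proof (rule inj[OF _ that])
    fix c assume c: "c < n + 2"
    have "(\<Sum>r<n. (W\<^sub>3 * p1 r - W\<^sub>2 * p2 r + W\<^sub>1 * p3 r) * M r c)
      = W\<^sub>3 * (\<Sum>r<n. p1 r * M r c) - W\<^sub>2 * (\<Sum>r<n. p2 r * M r c) + W\<^sub>1 * (\<Sum>r<n. p3 r * M r c)"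
      by (simp add: left_diff_distrib distrib_right sum.distrib sum_subtractf sum_distrib_left mult.assoc)
    also have "\<dots> = 0"
      unfolding p1[OF c, symmetric] p2[OF c, symmetric] p3[OF c, symmetric] by (simp add: algebra_simps)
    finally show "(\<Sum>r<n. (W\<^sub>3 * p1 r - W\<^sub>2 * p2 r + W\<^sub>1 * p3 r) * M r c) = 0" .
  qed
  have "W\<^sub>3 * p1 r = W\<^sub>1 * (- p3 r) + W\<^sub>2 * p2 r" if "r < n" for r
    using rel[OF that] by (simp add: algebra_simps)
  then have "\<forall>r. r < n \<longrightarrow> (\<exists>a b. p1 r = W\<^sub>1 * a + W\<^sub>2 * b)" using reg2 by blast
  then obtain a b where ab: "\<And>r. r < n \<Longrightarrow> p1 r = W\<^sub>1 * a r + W\<^sub>2 * b r" by metis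
  \<comment> \<open>Subtracting rows of \<open>M\<close> from \<open>\<alpha>\<close> does not
    change its image under the cominors. With the coefficients \<open>b\<close> the result is
    divisible by \<open>W\<^sub>1\<close>, and the quotient is the preimage of
    \<open>u\<close>.\<close>
  have "\<exists>\<psi>. \<alpha> c - (\<Sum>r<n. b r * M r c) = W\<^sub>1 * \<psi>" if c: "c < n + 2" for c
  proof -
    have "(\<Sum>r<n. p1 r * M r c) = W\<^sub>1 * (\<Sum>r<n. a r * M r c) + W\<^sub>2 * (\<Sum>r<n. b r * M r c)"
    proof -
      have "(\<Sum>r<n. p1 r * M r c) = (\<Sum>r<n. (W\<^sub>1 * a r + W\<^sub>2 * b r) * M r c)"
        by (intro sum.cong refl) (simp add: ab)
      then show ?thesis by (simp add: distrib_right sum.distrib sum_distrib_left mult.assoc)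
    qed
    then have "W\<^sub>2 * (\<alpha> c - (\<Sum>r<n. b r * M r c)) = W\<^sub>1 * (\<beta> c + (\<Sum>r<n. a r * M r c))"
      using p1[OF c] by (simp add: algebra_simps)
    then have "W\<^sub>1 dvd W\<^sub>2 * (\<alpha> c - (\<Sum>r<n. b r * M r c))" by simp
    from reg1[OF this] show ?thesis by (elim dvdE) blast
  qed
  then obtain \<psi> where \<psi>: "\<And>c. c < n + 2 \<Longrightarrow> \<alpha> c - (\<Sum>r<n. b r * M r c) = W\<^sub>1 * \<psi> c" by metis
  have "u c = (\<Sum>j<n+2. cominor n M c j * \<psi> j)" if c: "c < n + 2" for c
  proof -
    have z: "(\<Sum>j<n+2. cominor n M c j * (\<Sum>r<n. b r * M r j)) = 0"
    proof -
      have "(\<Sum>j<n+2. cominor n M c j * (\<Sum>r<n. b r * M r j))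
          = (\<Sum>j<n+2. \<Sum>r<n. b r * (cominor n M c j * M r j))"
        by (simp add: sum_distrib_left mult.left_commute)
      also have "\<dots> = (\<Sum>r<n. b r * (\<Sum>j<n+2. cominor n M c j * M r j))"
        unfolding sum_distrib_left by (rule sum.swap)
      finally show ?thesis by (simp add: cominor_row)
    qed
    have "W\<^sub>1 * (\<Sum>j<n+2. cominor n M c j * \<psi> j) = (\<Sum>j<n+2. cominor n M c j * (W\<^sub>1 * \<psi> j))"
      by (simp add: sum_distrib_left mult.left_commute)
    also have "\<dots> = (\<Sum>j<n+2. cominor n M c j * (\<alpha> j - (\<Sum>r<n. b r * M r j)))"
      by (intro sum.cong refl) (simp add: \<psi>)
    also have "\<dots> = W\<^sub>1 * u c"
      using \<alpha>[OF c] z by (simp add: right_diff_distrib sum_subtractf)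
    finally show ?thesis using nz by simp
  qed
  then show ?thesis by (rule that)
qed


section \<open>Homogeneous linear systems over an integral domain\<close>

lemma pivot_solution:
  fixes T :: "'i \<Rightarrow> 'j \<Rightarrow> 'a::comm_ring_1" and i0 :: 'i and x' :: "'j \<Rightarrow> 'a"
  assumes J: "finite J" "j0 \<notin> J"
  defines "x \<equiv> \<lambda>j. if j = j0 then - (\<Sum>j\<in>J. T i0 j * x' j) else T i0 j0 * x' j"
  shows "(\<Sum>j\<in>insert j0 J. T i j * x j) = (\<Sum>j\<in>J. (T i0 j0 * T i j - T i j0 * T i0 j) * x' j)"
proof -
  have "(\<Sum>j\<in>J. T i j * x j) = (\<Sum>j\<in>J. T i j * (T i0 j0 * x' j))"
    by (rule sum.cong) (use J in \<open>auto simp: x_def\<close>)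
  then show ?thesis
    using J by (simp add: x_def sum_distrib_left sum_subtractf[symmetric] algebra_simps)
qed

lemma underdetermined_system:
  fixes T :: "'i \<Rightarrow> 'j \<Rightarrow> 'a::idom"
  assumes "finite J" "finite I" "card I < card J"
  shows "\<exists>x. (\<exists>j\<in>J. x j \<noteq> 0) \<and> (\<forall>i\<in>I. (\<Sum>j\<in>J. T i j * x j) = 0)"
  using assms
proof (induction J arbitrary: I T)
  case (insert j0 J)
  show ?case
  proof (cases "\<forall>i\<in>I. T i j0 = 0")
    case True
    have "(\<Sum>j\<in>insert j0 J. T i j * (if j = j0 then 1 else 0)) = 0" if "i \<in> I" for i
      using True that by (intro sum.neutral) auto
    then show ?thesis by (intro exI[of _ "\<lambda>j. if j = j0 then 1 else 0"]) auto
  next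
    case False
    then obtain i0 where i0: "i0 \<in> I" "T i0 j0 \<noteq> 0" by blast
    have "card (I - {i0}) < card J"
      using insert.prems insert.hyps i0 card_gt_0_iff[of I] by (auto simp: card_Diff_singleton)
    then obtain x' where x': "\<exists>j\<in>J. x' j \<noteq> 0"
      "\<And>i. i \<in> I - {i0} \<Longrightarrow> (\<Sum>j\<in>J. (T i0 j0 * T i j - T i j0 * T i0 j) * x' j) = 0"
      using insert.IH[of "I - {i0}" "\<lambda>i j. T i0 j0 * T i j - T i j0 * T i0 j"] insert.prems by blast
    \<comment> \<open>The unknown \<open>j0\<close> is solved from the pivot row after the others
      have been scaled by the pivot, so nothing is divided; the pivot row itself becomes
      trivial.\<close>
    define x where "x j = (if j = j0 then - (\<Sum>j\<in>J. T i0 j * x' j) else T i0 j0 * x' j)" for j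
    have "(\<Sum>j\<in>insert j0 J. T i j * x j) = 0" if "i \<in> I" for i
      unfolding x_def pivot_solution[OF insert.hyps(1,2), of T i i0]
      using x'(2)[of i] that by (cases "i = i0") auto
    moreover have "\<exists>j\<in>insert j0 J. x j \<noteq> 0"
      using x'(1) i0(2) insert.hyps(2) by (auto simp: x_def)
    ultimately show ?thesis by blast
  qed
qed simp

text \<open>The polynomial \<open>h\<close> is the product of the pivots of a fraction-free elimination.\<close>

lemma generic_kernel:
  fixes T :: "'i \<Rightarrow> 'j \<Rightarrow> 'a::idom"
  assumes "finite J"
  shows "(\<exists>x. (\<exists>j\<in>J. x j \<noteq> 0) \<and> (\<forall>i. (\<Sum>j\<in>J. T i j * x j) = 0)) \<or>
    (\<exists>h. h \<noteq> 0 \<and> (\<forall>(ev :: 'a \<Rightarrow> 'b::idom) y. comm_ring_hom ev \<longrightarrow> ev h \<noteq> 0 \<longrightarrow>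
       (\<forall>i. (\<Sum>j\<in>J. ev (T i j) * y j) = 0) \<longrightarrow> (\<forall>j\<in>J. y j = 0)))"
  using assms
proof (induction J arbitrary: T)
  case empty
  show ?case by (intro disjI2 exI[of _ 1]) simp
next
  case (insert j0 J)
  show ?case
  proof (cases "\<forall>i. T i j0 = 0")
    case True
    have "(\<Sum>j\<in>insert j0 J. T i j * (if j = j0 then 1 else 0)) = 0" for i
      using True by (intro sum.neutral) auto
    then show ?thesis by (intro disjI1 exI[of _ "\<lambda>j. if j = j0 then 1 else 0"]) auto
  next
    case False
    then obtain i0 where i0: "T i0 j0 \<noteq> 0" by blast
    from insert.IH[of "\<lambda>i j. T i0 j0 * T i j - T i j0 * T i0 j"] show ?thesis
    proof (elim disjE exE conjE)
      fix x' assume x': "\<exists>j\<in>J. x' j \<noteq> 0"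
        "\<forall>i. (\<Sum>j\<in>J. (T i0 j0 * T i j - T i j0 * T i0 j) * x' j) = 0"
      define x where "x j = (if j = j0 then - (\<Sum>j\<in>J. T i0 j * x' j) else T i0 j0 * x' j)" for j
      have "(\<Sum>j\<in>insert j0 J. T i j * x j) = 0" for i
        unfolding x_def pivot_solution[OF insert.hyps(1,2), of T i i0] using x'(2) by auto
      moreover have "\<exists>j\<in>insert j0 J. x j \<noteq> 0"
        using x'(1) i0 insert.hyps(2) by (auto simp: x_def)
      ultimately show ?thesis by blast
    next
      fix h :: 'a
      assume h: "h \<noteq> 0" "\<forall>(ev :: 'a \<Rightarrow> 'b) y. comm_ring_hom ev \<longrightarrow> ev h \<noteq> 0 \<longrightarrow>
        (\<forall>i. (\<Sum>j\<in>J. ev (T i0 j0 * T i j - T i j0 * T i0 j) * y j) = 0) \<longrightarrow> (\<forall>j\<in>J. y j = 0)"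
      have "\<forall>j\<in>insert j0 J. y j = 0"
        if ev: "comm_ring_hom ev" and nz: "ev (h * T i0 j0) \<noteq> 0"
          and y: "\<forall>i. (\<Sum>j\<in>insert j0 J. ev (T i j) * y j) = 0" for ev :: "'a \<Rightarrow> 'b" and y
      proof -
        interpret comm_ring_hom ev by fact
        have nz': "ev h \<noteq> 0" "ev (T i0 j0) \<noteq> 0" using nz by (auto simp: hom_mult)
        have row: "(\<Sum>j\<in>J. ev (T i j) * y j) = - ev (T i j0) * y j0" for i
          using y[rule_format, of i] insert.hyps by (simp add: eq_neg_iff_add_eq_0 add.commute)
        have "(\<Sum>j\<in>J. ev (T i0 j0 * T i j - T i j0 * T i0 j) * y j) = 0" for i
        proof -
          have "(\<Sum>j\<in>J. ev (T i0 j0 * T i j - T i j0 * T i0 j) * y j)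
              = ev (T i0 j0) * (\<Sum>j\<in>J. ev (T i j) * y j) - ev (T i j0) * (\<Sum>j\<in>J. ev (T i0 j) * y j)"
            by (simp add: hom_minus hom_mult left_diff_distrib sum_subtractf sum_distrib_left mult.assoc)
          then show ?thesis unfolding row by (simp add: mult_ac)
        qed
        then have yJ: "\<forall>j\<in>J. y j = 0" using h(2) ev nz'(1) by blast
        then have "ev (T i0 j0) * y j0 = 0"
          using y[rule_format, of i0] insert.hyps by simp
        then show ?thesis using yJ nz'(2) by simp
      qed
      then show ?thesis using h(1) i0 by (intro disjI2 exI[of _ "h * T i0 j0"]) auto
    qed
  qed
qed

section \<open>Matrices on a line\<close>

text \<open>The bound \<open>r\<close> may be negative, and then only the zero polynomial satisfies it.\<close>

definition degree_bound :: "int \<Rightarrow> 'a::zero poly \<Rightarrow> bool" where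
  "degree_bound r p \<longleftrightarrow> (\<forall>i. int i > r \<longrightarrow> poly.coeff p i = 0)"

lemma degree_bound_zero [simp]: "degree_bound r 0"
  by (simp add: degree_bound_def)

lemma degree_bound_mono: "degree_bound r p \<Longrightarrow> r \<le> s \<Longrightarrow> degree_bound s p"
  by (auto simp: degree_bound_def)

lemma degree_bound_add: "degree_bound r p \<Longrightarrow> degree_bound r q \<Longrightarrow> degree_bound r (p + q)"
  by (simp add: degree_bound_def)

lemma degree_bound_diff: "degree_bound r p \<Longrightarrow> degree_bound r q \<Longrightarrow> degree_bound r (p - q)"
  for p :: "'a::ab_group_add poly"
  by (simp add: degree_bound_def)

lemma degree_bound_smult: "degree_bound r p \<Longrightarrow> degree_bound r (Polynomial.smult c p)"
  for p :: "'a::comm_semiring_0 poly"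
  by (simp add: degree_bound_def)

lemma degree_bound_sum:
  fixes f :: "'i \<Rightarrow> 'a::comm_monoid_add poly"
  shows "(\<And>i. i \<in> A \<Longrightarrow> degree_bound r (f i)) \<Longrightarrow> degree_bound r (sum f A)"
  by (induction A rule: infinite_finite_induct) (auto intro: degree_bound_add)

lemma degree_bound_mult:
  fixes p q :: "'a::comm_semiring_0 poly"
  assumes "degree_bound r p" "degree_bound s q"
  shows "degree_bound (r + s) (p * q)"
  unfolding degree_bound_def
proof (intro allI impI)
  fix i assume i: "r + s < int i"
  have "poly.coeff p j * poly.coeff q (i - j) = 0" if "j \<le> i" for j
  proof (cases "int j > r")
    case False
    then have "int (i - j) > s" using i that by linarith
    then show ?thesis using assms(2) by (simp add: degree_bound_def)
  qed (use assms(1) in \<open>simp add: degree_bound_def\<close>)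
  then show "poly.coeff (p * q) i = 0" unfolding coeff_mult by (intro sum.neutral) simp
qed

lemma degree_bound_degree: "p \<noteq> 0 \<Longrightarrow> degree_bound r p \<Longrightarrow> int (degree p) \<le> r"
  by (meson degree_bound_def leading_coeff_neq_0 not_le)

text \<open>By the Pluecker relations the exterior product of two kernel vectors is a polynomial multiple of
  the vector of maximal minors; the degrees force that multiple to vanish.\<close>

lemma kernel_wedge_eq_zero:
  fixes M :: "nat \<Rightarrow> nat \<Rightarrow> 'a::idom poly"
  assumes one: "1 \<in> cominor_span n M"
    and top: "i0 < n + 2" "k0 < n + 2" "int s = d - b i0 - b k0" "poly.coeff (cominor n M i0 k0) s \<noteq> 0"
    and u: "\<And>r. r < n \<Longrightarrow> (\<Sum>c<n+2. M r c * u c) = 0" "\<And>c. c < n + 2 \<Longrightarrow> degree_bound (e - b c) (u c)"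
    and v: "\<And>r. r < n \<Longrightarrow> (\<Sum>c<n+2. M r c * v c) = 0" "\<And>c. c < n + 2 \<Longrightarrow> degree_bound (e' - b c) (v c)"
    and less: "e + e' < d" and cf: "c < n + 2" "f < n + 2"
  shows "u c * v f = u f * v c"
proof -
  obtain w where w: "1 = (\<Sum>i<n+2. \<Sum>k<n+2. w i k * cominor n M i k)"
    using one unfolding cominor_span_def by blast
  \<comment> \<open>The minors generate the unit ideal on the line. Weighting the Pluecker relations
    by the coefficients of 1 gives the multiplier as a polynomial, where a single minor would give
    only a fraction.\<close>
  define q where "q = (\<Sum>i<n+2. \<Sum>k<n+2. w i k * (u i * v k - u k * v i))"
  have q: "q * cominor n M c f = u c * v f - u f * v c" if cf: "c < n + 2" "f < n + 2" for c f
  proof -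
    have "q * cominor n M c f
        = (\<Sum>i<n+2. \<Sum>k<n+2. w i k * ((u i * v k - u k * v i) * cominor n M c f))"
      by (simp add: q_def sum_distrib_right mult.assoc)
    also have "\<dots> = (\<Sum>i<n+2. \<Sum>k<n+2. w i k * cominor n M i k * (u c * v f - u f * v c))"
    proof (intro sum.cong refl)
      fix i k assume "i \<in> {..<n+2}" "k \<in> {..<n+2}"
      then have "(u i * v k - u k * v i) * cominor n M c f = cominor n M i k * (u c * v f - u f * v c)"
        using cominor_wedge[of n M u v i k c f] u(1) v(1) cf by simp
      then show "w i k * ((u i * v k - u k * v i) * cominor n M c f)
          = w i k * cominor n M i k * (u c * v f - u f * v c)" by (simp add: mult.assoc)
    qed
    also have "\<dots> = (\<Sum>i<n+2. \<Sum>k<n+2. w i k * cominor n M i k) * (u c * v f - u f * v c)"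
      by (simp add: sum_distrib_right)
    finally show ?thesis unfolding w[symmetric] by simp
  qed
  \<comment> \<open>A nonzero multiple of the minor at \<open>i0\<close>, \<open>k0\<close> has
    degree at least \<open>d - b i0 - b k0\<close>, but the exterior product there has degree at
    most \<open>e + e' - b i0 - b k0\<close>.\<close>
  have "q = 0"
  proof (rule ccontr)
    assume "q \<noteq> 0"
    have nz: "cominor n M i0 k0 \<noteq> 0" using top(4) by auto
    have "degree_bound ((e - b i0) + (e' - b k0)) (u i0 * v k0)"
      by (intro degree_bound_mult u v top)
    moreover have "degree_bound ((e - b k0) + (e' - b i0)) (u k0 * v i0)"
      by (intro degree_bound_mult u v top)
    moreover have "(e - b k0) + (e' - b i0) = (e - b i0) + (e' - b k0)" by simp
    ultimately have "degree_bound ((e - b i0) + (e' - b k0)) (q * cominor n M i0 k0)"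
      unfolding q[OF top(1,2)] by (metis degree_bound_diff)
    then have "int (degree (q * cominor n M i0 k0)) \<le> (e - b i0) + (e' - b k0)"
      using \<open>q \<noteq> 0\<close> nz by (intro degree_bound_degree) auto
    moreover have "degree (q * cominor n M i0 k0) \<ge> s"
      using \<open>q \<noteq> 0\<close> nz le_degree[OF top(4)] by (simp add: degree_mult_eq)
    ultimately show False using less top(3) by linarith
  qed
  then show ?thesis using q[OF cf] by simp
qed


section \<open>Graded pieces of the kernel and dimension counts on a line\<close>

lemma coeff_matrix_times_monoms:
  fixes M :: "nat \<Rightarrow> nat \<Rightarrow> 'a::comm_semiring_1 poly"
  assumes "\<And>c. c < N \<Longrightarrow> finite (S c)"
  shows "poly.coeff (\<Sum>c<N. M r c * (\<Sum>s\<in>S c. Polynomial.monom (x (c, s)) s)) t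
    = (\<Sum>(c, s)\<in>Sigma {..<N} S. poly.coeff (Polynomial.monom 1 s * M r c) t * x (c, s))"
proof -
  have m: "poly.coeff (M r c * Polynomial.monom y s) t = poly.coeff (Polynomial.monom 1 s * M r c) t * y" for c y s
  proof -
    have "M r c * Polynomial.monom y s = Polynomial.smult y (Polynomial.monom 1 s * M r c)"
      by (simp add: smult_monom flip: mult_smult_left) (simp add: mult.commute)
    then show ?thesis by (simp add: mult.commute)
  qed
  have "poly.coeff (\<Sum>c<N. M r c * (\<Sum>s\<in>S c. Polynomial.monom (x (c, s)) s)) t
    = (\<Sum>c<N. \<Sum>s\<in>S c. poly.coeff (Polynomial.monom 1 s * M r c) t * x (c, s))"
    by (simp add: coeff_sum sum_distrib_left m)
  also have "\<dots> = (\<Sum>(c, s)\<in>Sigma {..<N} S. poly.coeff (Polynomial.monom 1 s * M r c) t * x (c, s))"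
    using assms by (subst sum.Sigma) auto
  finally show ?thesis .
qed

lemma coeff_sum_monoms:
  assumes "finite S"
  shows "poly.coeff (\<Sum>s\<in>S. Polynomial.monom (x s) s) t = (if t \<in> S then x t else 0)"
  using assms by (simp add: coeff_sum if_distrib cong: if_cong)

lemma degree_bound_sum_monoms: "degree_bound r (\<Sum>s<nat (r + 1). Polynomial.monom (x s) s)"
  unfolding degree_bound_def by (auto simp: coeff_sum_monoms)

text \<open>With y = 1 a form of degree \<open>e - b c\<close> becomes a polynomial of at most that
  degree, so this is the degree \<open>e\<close> part of the kernel of a graded matrix on the line.
  Entries with index beyond \<open>N\<close> are unconstrained.\<close>

definition graded_kernel :: "nat \<Rightarrow> nat \<Rightarrow> (nat \<Rightarrow> nat \<Rightarrow> 'a::comm_ring_1 poly) \<Rightarrow> (nat \<Rightarrow> int) \<Rightarrow> int \<Rightarrow> (nat \<Rightarrow> 'a poly) set"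
  where "graded_kernel n N M b e = {u. (\<forall>r<n. (\<Sum>c<N. M r c * u c) = 0) \<and> (\<forall>c<N. degree_bound (e - b c) (u c))}"

lemma graded_kernelI:
  assumes "\<And>r. r < n \<Longrightarrow> (\<Sum>c<N. M r c * u c) = 0" "\<And>c. c < N \<Longrightarrow> degree_bound (e - b c) (u c)"
  shows "u \<in> graded_kernel n N M b e"
  using assms by (simp add: graded_kernel_def)

lemma graded_kernelD:
  assumes "u \<in> graded_kernel n N M b e"
  shows "r < n \<Longrightarrow> (\<Sum>c<N. M r c * u c) = 0" "c < N \<Longrightarrow> degree_bound (e - b c) (u c)"
  using assms by (simp_all add: graded_kernel_def)

text \<open>Rank and nullity as a count of unknowns and equations. The factor of the right-hand side
  is one more unknown, indexed by \<open>None\<close>, and the coefficients listed in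
  \<open>E\<close> are required to vanish, which excludes kernel vectors. A nontrivial solution then
  has a nonzero entry at \<open>None\<close>, and division by it solves the system.\<close>

lemma solvable_by_dimension:
  fixes M :: "nat \<Rightarrow> nat \<Rightarrow> 'k::field poly" and a b :: "nat \<Rightarrow> int"
  assumes entries: "\<And>r c. r < n \<Longrightarrow> c < N \<Longrightarrow> degree_bound (b c - a r) (M r c)"
    and E: "finite E" "(\<Sum>r<n. nat (j - a r + 1)) + card E \<le> (\<Sum>c<N. nat (j - b c + 1))"
    and ker: "\<forall>u\<in>graded_kernel n N M b j.
       (\<forall>(c, s)\<in>E. c < N \<longrightarrow> poly.coeff (u c) s = 0) \<longrightarrow> (\<forall>c<N. u c = 0)"
    and g: "\<And>r. r < n \<Longrightarrow> degree_bound (j - a r) (g r)"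
  obtains f where "\<And>c. c < N \<Longrightarrow> degree_bound (j - b c) (f c)"
    and "\<And>r. r < n \<Longrightarrow> (\<Sum>c<N. M r c * f c) = g r"
proof -
  define S where "S c = {..<nat (j - b c + 1)}" for c
  define J where "J = Sigma {..<N} S"
  define I where "I = Sigma {..<n} (\<lambda>r. {..<nat (j - a r + 1)})"
  \<comment> \<open>\<open>Inl\<close> rows compare coefficients with those of \<open>g\<close>;
    \<open>Inr\<close> rows select the coefficients in \<open>E\<close>, and a pair of
    \<open>E\<close> outside the degree range yields the trivial equation.\<close>
  define T where "T i p = (case i of
      Inl (r, t) \<Rightarrow> (case p of None \<Rightarrow> - poly.coeff (g r) t | Some (c, s) \<Rightarrow> poly.coeff (Polynomial.monom 1 s * M r c) t)
    | Inr q \<Rightarrow> (if p = Some q then 1 else 0))"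
    for i :: "nat \<times> nat + nat \<times> nat" and p :: "(nat \<times> nat) option"
  have fin: "finite J" "finite I" by (auto simp: J_def I_def S_def)
  have cJ: "card J = (\<Sum>c<N. nat (j - b c + 1))" by (simp add: J_def S_def)
  have cI: "card I = (\<Sum>r<n. nat (j - a r + 1))" by (simp add: I_def)
  have "card (Inl ` I \<union> Inr ` E) \<le> card I + card E"
    by (rule order_trans[OF card_Un_le]) (simp add: add_mono card_image_le fin E(1))
  moreover have "card (insert None (Some ` J)) = card J + 1"
    using fin by (subst card_insert_disjoint) (auto simp: card_image)
  ultimately obtain x where x: "\<exists>p\<in>insert None (Some ` J). x p \<noteq> 0"
    and eq: "\<And>i. i \<in> Inl ` I \<union> Inr ` E \<Longrightarrow> (\<Sum>p\<in>insert None (Some ` J). T i p * x p) = 0"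
    using underdetermined_system[of "insert None (Some ` J)" "Inl ` I \<union> Inr ` E" T] fin E cI cJ by auto
  have split: "(\<Sum>p\<in>insert None (Some ` J). T i p * x p) = T i None * x None + (\<Sum>p\<in>J. T i (Some p) * x (Some p))" for i
    using fin by (subst sum.insert) (auto simp: sum.reindex)
  define f where "f c = (\<Sum>s\<in>S c. Polynomial.monom (x (Some (c, s))) s)" for c
  have fb: "degree_bound (j - b c) (f c)" for c
    unfolding f_def S_def by (rule degree_bound_sum_monoms)
  have f0: "poly.coeff (f c) s = (if s \<in> S c then x (Some (c, s)) else 0)" for c s
    unfolding f_def by (subst coeff_sum_monoms) (auto simp: S_def)
  have Mf: "(\<Sum>c<N. M r c * f c) = Polynomial.smult (x None) (g r)" if r: "r < n" for r
  proof (rule poly_eqI)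
    fix t
    show "poly.coeff (\<Sum>c<N. M r c * f c) t = poly.coeff (Polynomial.smult (x None) (g r)) t"
    proof (cases "(r, t) \<in> I")
      case True
      have "(\<Sum>p\<in>J. T (Inl (r, t)) (Some p) * x (Some p)) = poly.coeff (\<Sum>c<N. M r c * f c) t"
        unfolding f_def J_def T_def
        by (subst coeff_matrix_times_monoms[where x = "\<lambda>p. x (Some p)"]) (auto simp: S_def intro!: sum.cong)
      moreover have "T (Inl (r, t)) None = - poly.coeff (g r) t" by (simp add: T_def)
      ultimately show ?thesis using eq[of "Inl (r, t)"] True unfolding split by (simp add: mult.commute)
    next
      case False
      then have t: "int t > j - a r" using r by (auto simp: I_def)
      have "degree_bound (j - a r) (M r c * f c)" if "c < N" for c
        using degree_bound_mult[OF entries[OF r that] fb[of c]] by simp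
      then have "degree_bound (j - a r) (\<Sum>c<N. M r c * f c)" by (auto intro: degree_bound_sum)
      then show ?thesis using g[OF r] t by (simp add: degree_bound_def)
    qed
  qed
  have nz: "x None \<noteq> 0"
  proof
    assume 0: "x None = 0"
    have fz: "f c = 0" if "c < N" for c
    proof -
      have "f \<in> graded_kernel n N M b j"
        using Mf 0 by (intro graded_kernelI fb) simp
      moreover have "poly.coeff (f c) s = 0" if cs: "(c, s) \<in> E" "c < N" for c s
      proof -
        have "(\<Sum>p\<in>J. T (Inr (c, s)) (Some p) * x (Some p)) = (\<Sum>p\<in>J. if p = (c, s) then x (Some p) else 0)"
          by (rule sum.cong) (auto simp: T_def)
        then have "(c, s) \<in> J \<longrightarrow> x (Some (c, s)) = 0"
          using eq[of "Inr (c, s)"] cs(1) fin unfolding split by (auto simp: T_def 0)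
        then show ?thesis using cs(2) by (auto simp: f0 J_def)
      qed
      ultimately show ?thesis using ker that by fast
    qed
    have "x (Some p) = 0" if "p \<in> J" for p
      using that fz f0[of "fst p" "snd p"] by (auto simp: J_def split: prod.splits)
    then show False using x 0 by auto
  qed
  show ?thesis
  proof (rule that[of "\<lambda>c. Polynomial.smult (inverse (x None)) (f c)"])
    show "degree_bound (j - b c) (Polynomial.smult (inverse (x None)) (f c))" for c
      by (intro degree_bound_smult fb)
    show "(\<Sum>c<N. M r c * Polynomial.smult (inverse (x None)) (f c)) = g r" if "r < n" for r
    proof -
      have "(\<Sum>c<N. M r c * Polynomial.smult (inverse (x None)) (f c)) = Polynomial.smult (inverse (x None)) (\<Sum>c<N. M r c * f c)"
        by (simp add: smult_sum2)
      then show ?thesis using Mf[OF that] nz by simp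
    qed
  qed
qed

text \<open>A kernel vector vanishing at X = 0 is X times a kernel vector of degree one
  less.\<close>

lemma kernel_divide_X:
  fixes M :: "nat \<Rightarrow> nat \<Rightarrow> 'k::idom poly"
  assumes inj: "\<forall>u\<in>graded_kernel n N M b (m - 1). \<forall>c<N. u c = 0"
    and u: "u \<in> graded_kernel n N M b m"
    and zero: "\<And>c. c < N \<Longrightarrow> poly.coeff (u c) 0 = 0" and c: "c < N"
  shows "u c = 0"
proof -
  have "\<exists>w. u c = pCons 0 w" if "c < N" for c
    using zero[OF that] by (cases "u c") auto
  then obtain w where w: "\<And>c. c < N \<Longrightarrow> u c = pCons 0 (w c)" by metis
  have "w \<in> graded_kernel n N M b (m - 1)"
  proof (rule graded_kernelI)
    fix r assume r: "r < n"
    have "pCons 0 (\<Sum>c<N. M r c * w c) = [:0, 1:] * (\<Sum>c<N. M r c * w c)" by simp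
    also have "\<dots> = (\<Sum>c<N. M r c * u c)"
      unfolding sum_distrib_left by (rule sum.cong) (auto simp: w)
    finally show "(\<Sum>c<N. M r c * w c) = 0" using graded_kernelD(1)[OF u r] by simp
  next
    fix c assume c: "c < N"
    show "degree_bound (m - 1 - b c) (w c)"
      unfolding degree_bound_def
    proof (intro allI impI)
      fix i assume i: "m - 1 - b c < int i"
      then have "poly.coeff (u c) (Suc i) = 0" using graded_kernelD(2)[OF u c] by (simp add: degree_bound_def)
      then show "poly.coeff (w c) i = 0" using w[OF c] by simp
    qed
  qed
  then show ?thesis using inj c w[OF c] by simp
qed

text \<open>With no kernel in degree \<open>m - 1\<close>, a kernel vector of degree
  \<open>m\<close> is determined by its value at X = 0. Dependence over the polynomial ring makes
  the values of \<open>u\<close> and \<open>v\<close> there proportional by a scalar.\<close>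

lemma kernel_proportional:
  fixes M :: "nat \<Rightarrow> nat \<Rightarrow> 'k::field poly"
  assumes inj: "\<forall>u\<in>graded_kernel n N M b (m - 1). \<forall>c<N. u c = 0"
    and u: "u \<in> graded_kernel n N M b m" and v: "v \<in> graded_kernel n N M b m"
    and uv: "\<And>c f. c < N \<Longrightarrow> f < N \<Longrightarrow> u c * v f = u f * v c"
    and c0: "c0 < N" "u c0 \<noteq> 0"
  obtains \<kappa> where "\<And>c. c < N \<Longrightarrow> v c = Polynomial.smult \<kappa> (u c)"
proof -
  obtain c1 where c1: "c1 < N" "poly.coeff (u c1) 0 \<noteq> 0"
    using kernel_divide_X[of n N M b m u, OF inj u _ c0(1)] c0(2) by blast
  define \<kappa> where "\<kappa> = poly.coeff (v c1) 0 / poly.coeff (u c1) 0"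
  define w where "w c = v c - Polynomial.smult \<kappa> (u c)" for c
  have "w \<in> graded_kernel n N M b m"
  proof (rule graded_kernelI)
    show "(\<Sum>c<N. M r c * w c) = 0" if "r < n" for r
    proof -
      have "(\<Sum>c<N. M r c * w c) = (\<Sum>c<N. M r c * v c) - Polynomial.smult \<kappa> (\<Sum>c<N. M r c * u c)"
        by (simp add: w_def right_diff_distrib sum_subtractf smult_sum2)
      then show ?thesis using graded_kernelD(1)[OF u that] graded_kernelD(1)[OF v that] by simp
    qed
    show "degree_bound (m - b c) (w c)" if "c < N" for c
      unfolding w_def using graded_kernelD(2)[OF u that] graded_kernelD(2)[OF v that]
      by (intro degree_bound_diff degree_bound_smult)
  qed
  moreover have "poly.coeff (w c) 0 = 0" if c: "c < N" for c
  proof -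
    have "u c1 * w c = u c * w c1"
      using uv[OF c1(1) c] by (simp add: w_def right_diff_distrib mult.commute)
    then have "poly.coeff (u c1 * w c) 0 = poly.coeff (u c * w c1) 0" by simp
    moreover have "poly.coeff (w c1) 0 = 0" using c1(2) by (simp add: w_def \<kappa>_def)
    ultimately show ?thesis using c1(2) by (simp add: coeff_mult)
  qed
  ultimately have "w c = 0" if "c < N" for c
    using kernel_divide_X[of n N M b m w, OF inj _ _ that] by blast
  then show ?thesis using that[of \<kappa>] by (simp add: w_def)
qed

text \<open>Split \<open>g\<close> into a constant and X times a polynomial, that is, a form of
  degree \<open>j + 1\<close> into a multiple of y and a multiple of x. The constant counts as an
  element of degree \<open>j\<close> because \<open>a r\<close> is at most \<open>j\<close>.\<close>

lemma image_step_up: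
  fixes M :: "nat \<Rightarrow> nat \<Rightarrow> 'k::comm_ring_1 poly"
  assumes surj: "\<forall>g. (\<forall>r<n. degree_bound (j - a r) (g r)) \<longrightarrow>
      (\<exists>f. (\<forall>c<N. degree_bound (j - b c) (f c)) \<and> (\<forall>r<n. (\<Sum>c<N. M r c * f c) = g r))"
    and a: "\<And>r. r < n \<Longrightarrow> a r \<le> j"
    and g: "\<And>r. r < n \<Longrightarrow> degree_bound (j + 1 - a r) (g r)"
  shows "\<exists>f. (\<forall>c<N. degree_bound (j + 1 - b c) (f c)) \<and> (\<forall>r<n. (\<Sum>c<N. M r c * f c) = g r)"
proof -
  have "\<exists>h k. g r = pCons k h" for r by (cases "g r") auto
  then obtain h k where hk: "\<And>r. g r = pCons (k r) (h r)" by metis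
  have "degree_bound (j - a r) (h r)" if "r < n" for r
    unfolding degree_bound_def
  proof (intro allI impI)
    fix i assume "j - a r < int i"
    then have "poly.coeff (g r) (Suc i) = 0" using g[OF that] by (simp add: degree_bound_def)
    then show "poly.coeff (h r) i = 0" by (simp add: hk)
  qed
  then obtain f1 where f1: "\<forall>c<N. degree_bound (j - b c) (f1 c)" "\<forall>r<n. (\<Sum>c<N. M r c * f1 c) = h r"
    using surj by blast
  have "degree_bound (j - a r) [:k r:]" if "r < n" for r
    using a[OF that] by (auto simp: degree_bound_def coeff_pCons split: nat.splits)
  then obtain f2 where f2: "\<forall>c<N. degree_bound (j - b c) (f2 c)" "\<forall>r<n. (\<Sum>c<N. M r c * f2 c) = [:k r:]"
    using surj[rule_format, of "\<lambda>r. [:k r:]"] by blast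
  have X: "degree_bound 1 ([:0, 1:] :: 'k poly)"
    by (auto simp: degree_bound_def coeff_pCons split: nat.splits)
  have "degree_bound (j + 1 - b c) ([:0, 1:] * f1 c + f2 c)" if "c < N" for c
  proof (rule degree_bound_add)
    show "degree_bound (j + 1 - b c) ([:0, 1:] * f1 c)"
      using degree_bound_mult[OF X] f1(1) that by (metis add.commute add_diff_eq)
    show "degree_bound (j + 1 - b c) (f2 c)"
      using f2(1) that by (auto intro: degree_bound_mono)
  qed
  moreover have "(\<Sum>c<N. M r c * ([:0, 1:] * f1 c + f2 c)) = g r" if "r < n" for r
  proof -
    have "(\<Sum>c<N. M r c * ([:0, 1:] * f1 c + f2 c)) = [:0, 1:] * (\<Sum>c<N. M r c * f1 c) + (\<Sum>c<N. M r c * f2 c)"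
      by (simp only: distrib_left sum.distrib sum_distrib_left mult.left_commute)
    then show ?thesis using f1(2) f2(2) that by (simp add: hk)
  qed
  ultimately show ?thesis by (intro exI[of _ "\<lambda>c. [:0, 1:] * f1 c + f2 c"]) auto
qed

text \<open>A dimension count gives surjectivity in one degree, and it propagates upwards. For even
  \<open>d\<close>, source and target have equal dimension in degree \<open>m - 1\<close>, where the
  map is injective. For odd \<open>d\<close>, the source in degree \<open>m\<close> is larger by one
  and the kernel is at most one-dimensional.\<close>

lemma line_surjective:
  fixes M :: "nat \<Rightarrow> nat \<Rightarrow> 'k::field poly" and a b :: "nat \<Rightarrow> int"
  assumes entries: "\<And>r c. r < n \<Longrightarrow> c < n + 2 \<Longrightarrow> degree_bound (b c - a r) (M r c)"
    and one: "1 \<in> cominor_span n M"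
    and top: "i0 < n + 2" "k0 < n + 2" "int s = d - b i0 - b k0" "poly.coeff (cominor n M i0 k0) s \<noteq> 0"
    and d: "d = (\<Sum>c<n+2. b c) - (\<Sum>r<n. a r)" and m: "m = d div 2"
    and b: "\<And>c. c < n + 2 \<Longrightarrow> b c \<le> m" and a: "\<And>r. r < n \<Longrightarrow> a r \<le> m - 1"
    and inj: "\<forall>u\<in>graded_kernel n (n + 2) M b (m - 1). \<forall>c<n+2. u c = 0"
    and j: "j \<ge> m" and g: "\<And>r. r < n \<Longrightarrow> degree_bound (j - a r) (g r)"
  shows "\<exists>f. (\<forall>c<n+2. degree_bound (j - b c) (f c)) \<and> (\<forall>r<n. (\<Sum>c<n+2. M r c * f c) = g r)"
proof -
  define surj where "surj j \<longleftrightarrow> (\<forall>g. (\<forall>r<n. degree_bound (j - a r) (g r)) \<longrightarrow>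
    (\<exists>f. (\<forall>c<n+2. degree_bound (j - b c) (f c)) \<and> (\<forall>r<n. (\<Sum>c<n+2. M r c * f c) = g r)))" for j
  have up: "surj (j + 1)" if "surj j" "m - 1 \<le> j" for j
    unfolding surj_def
  proof (intro allI impI)
    fix g :: "nat \<Rightarrow> 'k poly" assume g: "\<forall>r<n. degree_bound (j + 1 - a r) (g r)"
    have "a r \<le> j" if "r < n" for r using a[OF that] \<open>m - 1 \<le> j\<close> by linarith
    then show "\<exists>f. (\<forall>c<n+2. degree_bound (j + 1 - b c) (f c)) \<and> (\<forall>r<n. (\<Sum>c<n+2. M r c * f c) = g r)"
      using g by (intro image_step_up[OF that(1)[unfolded surj_def]]) auto
  qed
  \<comment> \<open>The bounds on \<open>a\<close> and \<open>b\<close> keep the truncated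
    differences nonnegative from \<open>m - 1\<close> on, so the dimensions are linear in
    \<open>j\<close>.\<close>
  have dims: "int (\<Sum>c<n+2. nat (j - b c + 1)) - int (\<Sum>r<n. nat (j - a r + 1)) = 2 * (j + 1) - d"
    if "j \<ge> m - 1" for j
  proof -
    have "int (\<Sum>c<n+2. nat (j - b c + 1)) = (\<Sum>c<n+2. j + 1 - b c)"
      unfolding of_nat_sum by (rule sum.cong) (use b that in force)+
    moreover have "int (\<Sum>r<n. nat (j - a r + 1)) = (\<Sum>r<n. j + 1 - a r)"
      unfolding of_nat_sum by (rule sum.cong) (use a that in force)+
    ultimately show ?thesis by (simp add: sum_subtractf d algebra_simps)
  qed
  have base: "surj m"
  proof (cases "even d")
    case True
    have "surj (m - 1)"
      unfolding surj_def
    proof (intro allI impI)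
      fix g :: "nat \<Rightarrow> 'k poly" assume g: "\<forall>r<n. degree_bound (m - 1 - a r) (g r)"
      have le: "(\<Sum>r<n. nat (m - 1 - a r + 1)) + card ({} :: (nat \<times> nat) set) \<le> (\<Sum>c<n+2. nat (m - 1 - b c + 1))"
      proof -
        have "2 * (m - 1 + 1) - d = 0" using True m by presburger
        then have "int (\<Sum>c<n+2. nat (m - 1 - b c + 1)) - int (\<Sum>r<n. nat (m - 1 - a r + 1)) = 0"
          using dims[of "m - 1"] by simp
        then show ?thesis by (simp only: card.empty add_0_right)
      qed
      obtain f where "\<And>c. c < n + 2 \<Longrightarrow> degree_bound (m - 1 - b c) (f c)"
        "\<And>r. r < n \<Longrightarrow> (\<Sum>c<n+2. M r c * f c) = g r"
      proof (rule solvable_by_dimension[of n "n + 2" b a M, OF entries finite.emptyI le, of g])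
        show "\<forall>u\<in>graded_kernel n (n + 2) M b (m - 1). (\<forall>(c, s)\<in>{}. c < n + 2 \<longrightarrow> poly.coeff (u c) s = 0)
            \<longrightarrow> (\<forall>c<n+2. u c = 0)" using inj by simp
      qed (use g in auto)
      then show "\<exists>f. (\<forall>c<n+2. degree_bound (m - 1 - b c) (f c)) \<and> (\<forall>r<n. (\<Sum>c<n+2. M r c * f c) = g r)"
        by blast
    qed
    from up[OF this] show ?thesis by simp
  next
    case odd: False
    show ?thesis
      unfolding surj_def
    proof (intro allI impI)
      fix g :: "nat \<Rightarrow> 'k poly" assume g: "\<forall>r<n. degree_bound (m - a r) (g r)"
      obtain E where E: "finite E" "card E \<le> 1"
        and ker: "\<forall>v\<in>graded_kernel n (n + 2) M b m.
          (\<forall>(c, s)\<in>E. c < n + 2 \<longrightarrow> poly.coeff (v c) s = 0) \<longrightarrow> (\<forall>c<n+2. v c = 0)"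
      proof (cases "\<exists>u\<in>graded_kernel n (n + 2) M b m. \<exists>c<n+2. u c \<noteq> 0")
        case True
        then obtain u c0 where u: "u \<in> graded_kernel n (n + 2) M b m" and c0: "c0 < n + 2" "u c0 \<noteq> 0" by blast
        show ?thesis
        \<comment> \<open>Since m + m < d, any two kernel vectors of degree \<open>m\<close> are
          dependent. The kernel consists of scalar multiples of \<open>u\<close>, and one leading
          coefficient of \<open>u\<close> detects the scalar.\<close>
        proof (rule that[of "{(c0, degree (u c0))}"]; (intro ballI allI impI)?)
          fix v c
          assume v: "v \<in> graded_kernel n (n + 2) M b m"
            and 0: "\<forall>(c, s)\<in>{(c0, degree (u c0))}. c < n + 2 \<longrightarrow> poly.coeff (v c) s = 0" and c: "c < n + 2"
          have "m + m < d" using odd m by presburger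
          then have "u c * v f = u f * v c" if "c < n + 2" "f < n + 2" for c f
            using kernel_wedge_eq_zero[OF one top graded_kernelD[OF u] graded_kernelD[OF v] _ that] by blast
          then obtain \<kappa> where \<kappa>: "\<And>c. c < n + 2 \<Longrightarrow> v c = Polynomial.smult \<kappa> (u c)"
            using kernel_proportional[of n "n + 2" M b m u v, OF inj u v _ c0] by blast
          have "\<kappa> = 0" using 0 c0 \<kappa>[OF c0(1)] by simp
          then show "v c = 0" using \<kappa>[OF c] by simp
        qed simp_all
      next
        case False
        then show ?thesis by (intro that[of "{}"]) auto
      qed
      have "2 * (m + 1) - d = 1" using odd m by presburger
      then have le: "(\<Sum>r<n. nat (m - a r + 1)) + card E \<le> (\<Sum>c<n+2. nat (m - b c + 1))"
        using dims[of m] E(2) by linarith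
      obtain f where "\<And>c. c < n + 2 \<Longrightarrow> degree_bound (m - b c) (f c)"
        "\<And>r. r < n \<Longrightarrow> (\<Sum>c<n+2. M r c * f c) = g r"
        by (rule solvable_by_dimension[of n "n + 2" b a M, OF entries E(1) le ker, of g]) (use g in auto)
      then show "\<exists>f. (\<forall>c<n+2. degree_bound (m - b c) (f c)) \<and> (\<forall>r<n. (\<Sum>c<n+2. M r c * f c) = g r)"
        by blast
    qed
  qed
  have "surj j" using j
  proof (induction j rule: int_ge_induct)
    case base
    show ?case by (rule \<open>surj m\<close>)
  qed (auto intro: up)
  then show ?thesis using g unfolding surj_def by blast
qed


section \<open>Restriction of ternary forms to lines\<close>

lemma UNIV_three: "(UNIV :: 3 set) = {0, 1, 2}"
  by (rule card_subset_eq[symmetric]) simp_all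

lemma prod_UNIV_three: "(\<Prod>v\<in>UNIV. f v) = f (0::3) * f 1 * f 2"
  for f :: "3 \<Rightarrow> 'a::comm_monoid_mult"
  unfolding UNIV_three by (simp add: mult.assoc)

lemma sum_UNIV_three: "(\<Sum>v\<in>UNIV. f v) = f (0::3) + f 1 + f 2"
  for f :: "3 \<Rightarrow> 'a::comm_monoid_add"
  unfolding UNIV_three by (simp add: add.assoc)

lemma monomial_degree_three:
  "monomial_degree t = Poly_Mapping.lookup t 0 + Poly_Mapping.lookup t 1 + Poly_Mapping.lookup t (2::3)"
  by (simp add: monomial_degree_def sum_UNIV_three)

lemma monomial_three_eqI:
  fixes s t :: "3 \<Rightarrow>\<^sub>0 nat"
  assumes "Poly_Mapping.lookup s 0 = Poly_Mapping.lookup t 0" "Poly_Mapping.lookup s 1 = Poly_Mapping.lookup t 1"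
    "Poly_Mapping.lookup s 2 = Poly_Mapping.lookup t 2"
  shows "s = t"
proof (rule poly_mapping_eqI)
  fix v :: 3
  have "v \<in> {0, 1, 2}" unfolding UNIV_three[symmetric] by simp
  then show "Poly_Mapping.lookup s v = Poly_Mapping.lookup t v" using assms by auto
qed

lemma comm_ring_hom_const_poly: "comm_ring_hom h \<Longrightarrow> comm_ring_hom (\<lambda>c. [:h c:])"
proof -
  assume "comm_ring_hom h"
  then interpret comm_ring_hom h .
  show ?thesis by standard (simp_all add: hom_add hom_mult)
qed

lemma comm_ring_hom_id: "comm_ring_hom (\<lambda>c. c)"
  by standard simp_all

definition line_vars :: "'a::comm_ring_1 \<Rightarrow> 'a \<Rightarrow> 3 \<Rightarrow> 'a poly" where
  "line_vars \<alpha> \<beta> v = (if v = 0 then [:0, 1:] else if v = 1 then 1 else [:\<beta>, \<alpha>:])"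

text \<open>The point of the line with y = 0, which the chart y = 1 misses. The value of a form
  there is the coefficient of its restriction in the full degree.\<close>

definition infinity_vars :: "'a::comm_ring_1 \<Rightarrow> 3 \<Rightarrow> 'a" where
  "infinity_vars \<alpha> v = (if v = 0 then 1 else if v = 1 then 0 else \<alpha>)"

text \<open>Restriction to the line \<open>z = \<alpha> x + \<beta> y\<close>, dehomogenised by \<open>y = 1\<close>.\<close>

definition restrict_line :: "('k::comm_ring_1 \<Rightarrow> 'a::comm_ring_1) \<Rightarrow> 'a \<Rightarrow> 'a \<Rightarrow> (3, 'k) mpoly \<Rightarrow> 'a poly" where
  "restrict_line h \<alpha> \<beta> = mpeval (\<lambda>c. [:h c:]) (line_vars \<alpha> \<beta>)"

lemma comm_ring_hom_restrict_line: "comm_ring_hom h \<Longrightarrow> comm_ring_hom (restrict_line h \<alpha> \<beta>)"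
  unfolding restrict_line_def by (intro comm_ring_hom.comm_ring_hom_mpeval comm_ring_hom_const_poly)

lemma degree_bound_power:
  fixes p :: "'a::comm_ring_1 poly"
  shows "degree_bound r p \<Longrightarrow> degree_bound (int k * r) (p ^ k)"
proof (induction k)
  case (Suc k)
  then show ?case using degree_bound_mult[of r p "int k * r" "p ^ k"] by (simp add: algebra_simps)
qed (simp add: degree_bound_def)

text \<open>Stated with degree bounds and not exact degrees, since the coefficients in the full
  degree may vanish.\<close>

lemma coeff_mult_top:
  fixes p q :: "'a::comm_semiring_0 poly"
  assumes "degree_bound (int r) p" "degree_bound (int s) q"
  shows "poly.coeff (p * q) (r + s) = poly.coeff p r * poly.coeff q s"
proof -
  have "poly.coeff p i * poly.coeff q (r + s - i) = (if i = r then poly.coeff p r * poly.coeff q s else 0)"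
    if "i \<le> r + s" for i
  proof (cases i r rule: linorder_cases)
    case less
    then show ?thesis using assms(2) that by (simp add: degree_bound_def)
  next
    case greater
    then show ?thesis using assms(1) by (simp add: degree_bound_def)
  qed simp
  then have "poly.coeff (p * q) (r + s) = (\<Sum>i\<le>r + s. if i = r then poly.coeff p r * poly.coeff q s else 0)"
    unfolding coeff_mult by (intro sum.cong) auto
  then show ?thesis by simp
qed

lemma coeff_power_top:
  fixes p :: "'a::comm_ring_1 poly"
  assumes "degree_bound 1 p"
  shows "poly.coeff (p ^ k) k = poly.coeff p 1 ^ k"
proof (induction k)
  case (Suc k)
  have "degree_bound (int k) (p ^ k)" using degree_bound_power[OF assms, of k] by simp
  from coeff_mult_top[of 1 p k, OF _ this] assms Suc show ?case by simp
qed simp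

lemma restrict_line_single:
  assumes "comm_ring_hom h"
  shows "degree_bound (int (monomial_degree t)) (restrict_line h \<alpha> \<beta> (Poly_Mapping.single t c))"
    and "poly.coeff (restrict_line h \<alpha> \<beta> (Poly_Mapping.single t c)) (monomial_degree t)
      = mpeval h (infinity_vars \<alpha>) (Poly_Mapping.single t c)"
proof -
  interpret h: comm_ring_hom h by fact
  interpret hp: comm_ring_hom "\<lambda>c. [:h c:]" by (rule comm_ring_hom_const_poly) fact
  define i j k where "i = Poly_Mapping.lookup t 0" and "j = Poly_Mapping.lookup t 1" and "k = Poly_Mapping.lookup t 2"
  have eq: "restrict_line h \<alpha> \<beta> (Poly_Mapping.single t c) = Polynomial.smult (h c) (Polynomial.monom 1 i * [:\<beta>, \<alpha>:] ^ k)"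
    by (simp add: restrict_line_def hp.mpeval_single prod_UNIV_three line_vars_def i_def k_def
        monom_altdef)
  have deg: "monomial_degree t = i + k + j" by (simp add: monomial_degree_three i_def j_def k_def)
  have b1: "degree_bound (int i) (Polynomial.monom (1::'b) i)" by (auto simp: degree_bound_def)
  have b2: "degree_bound 1 [:\<beta>, \<alpha>:]" by (auto simp: degree_bound_def coeff_pCons split: nat.splits)
  have b3: "degree_bound (int k) ([:\<beta>, \<alpha>:] ^ k)" using degree_bound_power[OF b2, of k] by simp
  have b: "degree_bound (int (i + k)) (Polynomial.monom 1 i * [:\<beta>, \<alpha>:] ^ k)"
    using degree_bound_mult[OF b1 b3] by simp
  show "degree_bound (int (monomial_degree t)) (restrict_line h \<alpha> \<beta> (Poly_Mapping.single t c))"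
    unfolding eq deg using b by (intro degree_bound_smult) (auto intro: degree_bound_mono)
  have "poly.coeff (Polynomial.monom 1 i * [:\<beta>, \<alpha>:] ^ k) (i + k + j) = (if j = 0 then \<alpha> ^ k else 0)"
  proof (cases "j = 0")
    case True
    then show ?thesis using coeff_mult_top[OF b1 b3] coeff_power_top[OF b2, of k] by simp
  next
    case False
    then show ?thesis using b by (simp add: degree_bound_def)
  qed
  then show "poly.coeff (restrict_line h \<alpha> \<beta> (Poly_Mapping.single t c)) (monomial_degree t)
      = mpeval h (infinity_vars \<alpha>) (Poly_Mapping.single t c)"
    unfolding eq deg h.mpeval_single prod_UNIV_three
    by (simp add: infinity_vars_def i_def[symmetric] j_def[symmetric] k_def[symmetric] power_0_left)
qed

lemma homogeneous_induct [consumes 1, case_names single zero add]: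
  fixes p :: "('v::finite, 'k::comm_ring_1) mpoly"
  assumes "homogeneous r p"
    and "\<And>t c. int (monomial_degree t) = r \<Longrightarrow> P (Poly_Mapping.single t c)"
    and "P 0"
    and "\<And>p q. homogeneous r p \<Longrightarrow> homogeneous r q \<Longrightarrow> P p \<Longrightarrow> P q \<Longrightarrow> P (p + q)"
  shows "P p"
proof -
  \<comment> \<open>Inducting over all polynomials and passing to the component of degree
    \<open>r\<close> keeps the summands homogeneous.\<close>
  have "P (hcomp r p)" for p :: "('v, 'k) mpoly"
  proof (induction p rule: mpoly_induct)
    case (single t c)
    show ?case using assms(2,3)
      by (cases "int (monomial_degree t) = r")
        (auto simp: hcomp_homogeneous[OF homogeneous_single[OF refl]])
  qed (simp add: hcomp_add assms(4) homogeneous_hcomp)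
  from this[of p] show ?thesis using hcomp_homogeneous[OF assms(1), of r] by simp
qed

lemma degree_bound_restrict_line:
  assumes h: "comm_ring_hom h" and "homogeneous r p"
  shows "degree_bound r (restrict_line h \<alpha> \<beta> p)"
proof -
  interpret R: comm_ring_hom "restrict_line h \<alpha> \<beta>" by (rule comm_ring_hom_restrict_line[OF h])
  show ?thesis
    using assms(2)
    by (induction rule: homogeneous_induct)
      (use restrict_line_single(1)[OF h] in \<open>auto simp: R.hom_add intro: degree_bound_add\<close>)
qed

lemma coeff_restrict_line_top:
  assumes h: "comm_ring_hom h" and "homogeneous (int s) p"
  shows "poly.coeff (restrict_line h \<alpha> \<beta> p) s = mpeval h (infinity_vars \<alpha>) p"
proof -
  interpret h: comm_ring_hom h by fact
  interpret R: comm_ring_hom "restrict_line h \<alpha> \<beta>" by (rule comm_ring_hom_restrict_line[OF h])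
  interpret E: comm_ring_hom "mpeval h (infinity_vars \<alpha>)" by (rule h.comm_ring_hom_mpeval)
  show ?thesis
    using assms(2)
    by (induction rule: homogeneous_induct)
      (use restrict_line_single(2)[OF h] in \<open>auto simp: R.hom_add E.hom_add\<close>)
qed

lemma restrict_line_mvar:
  assumes h: "comm_ring_hom h"
  shows "restrict_line h \<alpha> \<beta> (mvar 0) = [:0, 1:]" "restrict_line h \<alpha> \<beta> (mvar 1) = 1"
    "restrict_line h \<alpha> \<beta> (mvar 2) = [:\<beta>, \<alpha>:]" "restrict_line h \<alpha> \<beta> (mconst c) = [:h c:]"
proof -
  interpret hp: comm_ring_hom "\<lambda>c. [:h c:]" by (rule comm_ring_hom_const_poly) fact
  show "restrict_line h \<alpha> \<beta> (mvar 0) = [:0, 1:]" "restrict_line h \<alpha> \<beta> (mvar 1) = 1"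
    "restrict_line h \<alpha> \<beta> (mvar 2) = [:\<beta>, \<alpha>:]" "restrict_line h \<alpha> \<beta> (mconst c) = [:h c:]"
    by (simp_all add: restrict_line_def hp.mpeval_mvar hp.mpeval_mconst line_vars_def)
qed

text \<open>Homogenising with x and y alone gives a lift, because y restricts to 1.\<close>

lemma restrict_line_lift:
  fixes f :: "'k::comm_ring_1 poly"
  assumes "degree_bound r f"
  obtains p :: "(3, 'k) mpoly" where "homogeneous r p" "restrict_line (\<lambda>c. c) \<alpha> \<beta> p = f"
proof (cases "f = 0")
  case True
  interpret R: comm_ring_hom "restrict_line (\<lambda>c. c) \<alpha> \<beta>" by (rule comm_ring_hom_restrict_line[OF comm_ring_hom_id])
  show ?thesis using that[of 0] True by simp
next
  case False
  interpret R: comm_ring_hom "restrict_line (\<lambda>c. c) \<alpha> \<beta>" by (rule comm_ring_hom_restrict_line[OF comm_ring_hom_id])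
  have deg: "int (degree f) \<le> r" using degree_bound_degree[OF False assms] .
  define p :: "(3, 'k) mpoly" where
    "p = (\<Sum>i\<le>degree f. mconst (poly.coeff f i) * (mvar 0 ^ i * mvar 1 ^ (nat r - i)))"
  have "homogeneous r p"
    unfolding p_def
  proof (rule homogeneous_sum)
    fix i assume "i \<in> {..degree f}"
    then have r: "0 + (int i * 1 + int (nat r - i) * 1) = r" using deg by auto
    have "homogeneous (0 + (int i * 1 + int (nat r - i) * 1)) (mconst (poly.coeff f i) * (mvar (0::3) ^ i * mvar 1 ^ (nat r - i)))"
      by (intro homogeneous_mult homogeneous_mconst homogeneous_power homogeneous_mvar)
    then show "homogeneous r (mconst (poly.coeff f i) * (mvar (0::3) ^ i * mvar 1 ^ (nat r - i)))"
      unfolding r .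
  qed
  moreover have "restrict_line (\<lambda>c. c) \<alpha> \<beta> p = f"
    unfolding p_def R.hom_sum R.hom_mult R.hom_power restrict_line_mvar[OF comm_ring_hom_id]
    using poly_as_sum_of_monoms[of f] by (simp add: monom_altdef)
  ultimately show ?thesis by (rule that)
qed

text \<open>The linear form is monic in z, so division by it leaves a remainder in x and y. On such
  forms of a fixed degree the restriction is injective, because the exponent of x determines the
  monomial.\<close>

lemma restrict_line_kernel:
  fixes p :: "(3, 'k::comm_ring_1) mpoly"
  assumes p: "homogeneous r p" and zero: "restrict_line (\<lambda>c. c) \<alpha> \<beta> p = 0"
  obtains q where "homogeneous (r - 1) q" "p = (mvar 2 - mconst \<alpha> * mvar 0 - mconst \<beta> * mvar 1) * q"
proof -
  interpret R: comm_ring_hom "restrict_line (\<lambda>c. c :: 'k) \<alpha> \<beta>" by (rule comm_ring_hom_restrict_line[OF comm_ring_hom_id])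
  define l :: "(3, 'k) mpoly" where "l = mvar 2 - mconst \<alpha> * mvar 0 - mconst \<beta> * mvar 1"
  define P where "P r p \<longleftrightarrow> (\<exists>q p0. homogeneous (r - 1) q \<and> homogeneous r p0 \<and>
      (\<forall>t. Poly_Mapping.lookup p0 t \<noteq> 0 \<longrightarrow> Poly_Mapping.lookup t 2 = 0) \<and> p = l * q + p0)"
    for r and p :: "(3, 'k) mpoly"
  have P_add: "P r (p + q)" if "P r p" "P r q" for r p q
  proof -
    obtain q1 p1 where 1: "homogeneous (r - 1) q1" "homogeneous r p1"
      "\<forall>t. Poly_Mapping.lookup p1 t \<noteq> 0 \<longrightarrow> Poly_Mapping.lookup t 2 = 0" "p = l * q1 + p1"
      using \<open>P r p\<close> unfolding P_def by blast
    obtain q2 p2 where 2: "homogeneous (r - 1) q2" "homogeneous r p2"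
      "\<forall>t. Poly_Mapping.lookup p2 t \<noteq> 0 \<longrightarrow> Poly_Mapping.lookup t 2 = 0" "q = l * q2 + p2"
      using \<open>P r q\<close> unfolding P_def by blast
    have "\<forall>t. Poly_Mapping.lookup (p1 + p2) t \<noteq> 0 \<longrightarrow> Poly_Mapping.lookup t 2 = 0"
      using 1(3) 2(3) by (metis lookup_add add_0)
    moreover have "p + q = l * (q1 + q2) + (p1 + p2)" using 1 2 by (simp add: algebra_simps)
    ultimately show ?thesis unfolding P_def using 1(1,2) 2(1,2)
      by (intro exI[of _ "q1 + q2"] exI[of _ "p1 + p2"]) (simp add: homogeneous_add)
  qed
  have mono: "P (int (i + j + k)) (mconst c * (mvar 0 ^ i * mvar 1 ^ j * mvar 2 ^ k))" for i j k c
  proof (induction k arbitrary: i j c)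
    case 0
    have eq: "mconst c * (mvar 0 ^ i * mvar 1 ^ j * mvar 2 ^ 0)
        = Poly_Mapping.single (Poly_Mapping.single (0::3) i + Poly_Mapping.single 1 j) c"
      by (simp add: mvar_power mult_single)
    have "homogeneous (int (i + j + 0)) (Poly_Mapping.single (Poly_Mapping.single (0::3) i + Poly_Mapping.single 1 j) c)"
      by (rule homogeneous_single) (simp add: monomial_degree_add)
    then show ?case
      unfolding P_def eq
      by (intro exI[of _ 0] exI[of _ "Poly_Mapping.single (Poly_Mapping.single (0::3) i + Poly_Mapping.single 1 j) c"])
        (auto simp: lookup_single when_def lookup_add)
  next
    case (Suc k)
    have hom: "homogeneous (int (i + j + k)) (mconst c * (mvar (0::3) ^ i * mvar 1 ^ j * mvar 2 ^ k))"
    proof -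
      have "homogeneous (0 + (int i * 1 + int j * 1 + int k * 1)) (mconst c * (mvar (0::3) ^ i * mvar 1 ^ j * mvar 2 ^ k))"
        by (intro homogeneous_mult homogeneous_mconst homogeneous_power homogeneous_mvar)
      then show ?thesis by simp
    qed
    have "P (int (i + j + Suc k)) (l * (mconst c * (mvar 0 ^ i * mvar 1 ^ j * mvar 2 ^ k)))"
      unfolding P_def
      by (intro exI[of _ "mconst c * (mvar 0 ^ i * mvar 1 ^ j * mvar 2 ^ k)"] exI[of _ 0]) (use hom in simp)
    moreover have "P (int (i + j + Suc k)) (mconst (\<alpha> * c) * (mvar 0 ^ Suc i * mvar 1 ^ j * mvar 2 ^ k))"
      using Suc[of "Suc i" j "\<alpha> * c"] by (simp add: algebra_simps)
    moreover have "P (int (i + j + Suc k)) (mconst (\<beta> * c) * (mvar 0 ^ i * mvar 1 ^ Suc j * mvar 2 ^ k))"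
      using Suc[of i "Suc j" "\<beta> * c"] by (simp add: algebra_simps)
    \<comment> \<open>One factor z is replaced by the linear form plus \<alpha> x + \<beta> y, which
      lowers the exponent of z in the other terms.\<close>
    moreover have "mconst c * (mvar 0 ^ i * mvar 1 ^ j * mvar 2 ^ Suc k)
      = l * (mconst c * (mvar 0 ^ i * mvar 1 ^ j * mvar 2 ^ k))
        + mconst (\<alpha> * c) * (mvar 0 ^ Suc i * mvar 1 ^ j * mvar 2 ^ k)
        + mconst (\<beta> * c) * (mvar 0 ^ i * mvar 1 ^ Suc j * mvar 2 ^ k)"
    proof -
      have m: "mconst (x * c) = mconst x * (mconst c :: (3, 'k) mpoly)" for x by (simp add: mult_single)
      show ?thesis unfolding m l_def power_Suc by (simp add: algebra_simps)
    qed
    ultimately show ?case by (simp only: P_add)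
  qed
  have "P r p"
    using p
  proof (induction rule: homogeneous_induct)
    case (single t c)
    have "int (Poly_Mapping.lookup t 0 + Poly_Mapping.lookup t 1 + Poly_Mapping.lookup t 2) = r"
      using single by (simp add: monomial_degree_three)
    then show ?case
      using mono[of "Poly_Mapping.lookup t 0" "Poly_Mapping.lookup t 1" "Poly_Mapping.lookup t 2" c]
      by (simp add: single_eq_prod_mvar[of t c] prod_UNIV_three)
  next
    case zero
    show ?case unfolding P_def by (intro exI[of _ 0]) simp
  qed (rule P_add)
  then obtain q p0 where q: "homogeneous (r - 1) q" "homogeneous r p0"
      "\<And>t. Poly_Mapping.lookup p0 t \<noteq> 0 \<Longrightarrow> Poly_Mapping.lookup t 2 = 0" "p = l * q + p0"
    unfolding P_def by blast
  have "restrict_line (\<lambda>c. c) \<alpha> \<beta> l = 0"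
    by (simp add: l_def R.hom_minus R.hom_mult restrict_line_mvar[OF comm_ring_hom_id])
  then have r0: "restrict_line (\<lambda>c. c) \<alpha> \<beta> p0 = 0"
    using zero unfolding q(4) by (simp add: R.hom_add R.hom_mult)
  have "p0 = 0"
  proof (rule poly_mapping_eqI, rule ccontr)
    fix t assume t: "Poly_Mapping.lookup p0 t \<noteq> Poly_Mapping.lookup 0 t"
    have "restrict_line (\<lambda>c. c) \<alpha> \<beta> p0
      = (\<Sum>s\<in>Poly_Mapping.keys p0. Polynomial.monom (Poly_Mapping.lookup p0 s) (Poly_Mapping.lookup s 0))"
      unfolding restrict_line_def mpeval_def
      by (rule sum.cong) (use q(3) in \<open>auto simp: prod_UNIV_three line_vars_def monom_altdef in_keys_iff\<close>)
    then have "poly.coeff (restrict_line (\<lambda>c. c) \<alpha> \<beta> p0) (Poly_Mapping.lookup t 0)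
      = (\<Sum>s\<in>Poly_Mapping.keys p0. if Poly_Mapping.lookup s 0 = Poly_Mapping.lookup t 0 then Poly_Mapping.lookup p0 s else 0)"
      by (simp add: coeff_sum)
    also have "\<dots> = (\<Sum>s\<in>Poly_Mapping.keys p0. if s = t then Poly_Mapping.lookup p0 s else 0)"
    proof (rule sum.cong)
      fix s assume s: "s \<in> Poly_Mapping.keys p0"
      have "s = t" if "Poly_Mapping.lookup s 0 = Poly_Mapping.lookup t 0"
      proof (rule monomial_three_eqI[OF that])
        have "monomial_degree s = monomial_degree t"
          using q(2) s t unfolding homogeneous_lookup by (metis in_keys_iff lookup_zero of_nat_eq_iff)
        moreover show "Poly_Mapping.lookup s 2 = Poly_Mapping.lookup t 2"
          using q(3)[of s] q(3)[of t] s t by (simp add: in_keys_iff)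
        ultimately show "Poly_Mapping.lookup s 1 = Poly_Mapping.lookup t 1"
          using that by (simp add: monomial_degree_three)
      qed
      then show "(if Poly_Mapping.lookup s 0 = Poly_Mapping.lookup t 0 then Poly_Mapping.lookup p0 s else 0)
          = (if s = t then Poly_Mapping.lookup p0 s else 0)" by auto
    qed simp
    also have "\<dots> = Poly_Mapping.lookup p0 t" using t by (simp add: in_keys_iff)
    finally show False using r0 t by simp
  qed
  then show ?thesis using that[OF q(1)] q(4) unfolding l_def by simp
qed


section \<open>Descent of kernel vectors from the generic line\<close>

declare ufd_class.prime_elem_iff_irreducible [iff del]

lemma ufd_prime_factorization:
  fixes x :: "'a::ufd"
  assumes "x \<noteq> 0"
  obtains w ps where "w dvd 1" "\<And>p. p \<in> set ps \<Longrightarrow> prime_elem p" "x = w * prod_list ps"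
proof (cases "x dvd 1")
  case True
  then show ?thesis using that[of x "[]"] by simp
next
  case False
  then obtain F where F: "mset_factors F x" using mset_factors_exist assms by blast
  obtain ps where ps: "mset ps = F" using ex_mset by blast
  show ?thesis
  proof (rule that[of 1 ps])
    fix p assume "p \<in> set ps"
    then have "p \<in># F" unfolding ps[symmetric] by (simp only: set_mset_mset)
    then have "irreducible p" by (rule mset_factorsD(1)[OF F])
    then show "prime_elem p" by (simp only: ufd_class.prime_elem_iff_irreducible)
  next
    have "prod_mset F = prod_list ps" unfolding ps[symmetric] by (rule prod_mset_prod_list)
    then show "x = 1 * prod_list ps" using mset_factorsD(3)[OF F] by simp
  qed simp
qed

lemma prime_elem_dvd_prod_list:
  fixes p :: "'a::idom"
  assumes p: "prime_elem p"
  shows "p dvd prod_list xs \<Longrightarrow> \<exists>x\<in>set xs. p dvd x"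
proof (induction xs)
  case Nil
  then show ?case using prime_elem_not_unit[OF p] by simp
next
  case (Cons x xs)
  then have "p dvd x \<or> p dvd prod_list xs" using prime_elem_dvd_mult_iff[OF p] by simp
  then show ?case
  proof
    assume "p dvd x"
    then show ?thesis by (rule bexI) (rule list.set_intros(1))
  next
    assume "p dvd prod_list xs"
    then obtain y where "y \<in> set xs" "p dvd y" using Cons.IH by blast
    then show ?thesis by (intro bexI[of _ y] list.set_intros(2))
  qed
qed

text \<open>Primes common to all entries are divided out one at a time; each removal shortens the
  factorization of the fixed nonzero entry \<open>r j\<close>.\<close>

lemma ufd_primitive_vector:
  fixes r :: "nat \<Rightarrow> 'a::ufd"
  assumes "j < N" "r j \<noteq> 0"
  obtains g v where "g \<noteq> 0" "\<And>c. c < N \<Longrightarrow> r c = g * v c" "\<And>p. prime_elem p \<Longrightarrow> \<exists>c<N. \<not> p dvd v c"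
proof -
  have "\<exists>g v. g \<noteq> 0 \<and> (\<forall>c<N. r c = g * v c) \<and> (\<forall>p. prime_elem p \<longrightarrow> (\<exists>c<N. \<not> p dvd v c))"
    if "w dvd 1" "\<forall>p\<in>set ps. prime_elem p" "r j = w * prod_list ps" for w ps and r :: "nat \<Rightarrow> 'a"
    using that
  proof (induction "length ps" arbitrary: ps r w rule: less_induct)
    case less
    show ?case
    proof (cases "\<forall>p. prime_elem p \<longrightarrow> (\<exists>c<N. \<not> p dvd r c)")
      case True
      show ?thesis
      proof (rule exI[of _ 1], rule exI[of _ r], intro conjI)
        show "\<forall>p. prime_elem p \<longrightarrow> (\<exists>c<N. \<not> p dvd r c)" by (rule True)
      qed simp_all
    next
      case False
      then obtain p where p: "prime_elem p" "\<And>c. c < N \<Longrightarrow> p dvd r c" by metis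
      then have "\<forall>c. c < N \<longrightarrow> (\<exists>y. r c = p * y)" unfolding dvd_def by simp
      then obtain r' where r': "\<And>c. c < N \<Longrightarrow> r c = p * r' c" by metis
      have pnz: "p \<noteq> 0" "\<not> p dvd 1" using prime_elem_not_zeroI[OF p(1)] prime_elem_not_unit[OF p(1)] by simp_all
      have "p dvd w * prod_list ps" using p(2)[OF assms(1)] less.prems(3) by simp
      moreover have "\<not> p dvd w" using pnz(2) less.prems(1) by (metis dvd_trans)
      ultimately have "p dvd prod_list ps" using prime_elem_dvd_mult_iff[OF p(1)] by metis
      then obtain q where q: "q \<in> set ps" "p dvd q" using prime_elem_dvd_prod_list[OF p(1)] by metis
      then obtain e where e: "q = p * e" by (elim dvdE)
      have "prime_elem q" using q(1) less.prems(2) by metis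
      then have qi: "irreducible q" by (simp only: ufd_class.prime_elem_iff_irreducible)
      then have "e dvd 1" using irreducibleD[OF qi e] pnz(2) by metis
      have "p * r' j = w * (q * prod_list (remove1 q ps))"
        using r'[OF assms(1)] less.prems(3) prod_list_remove1[OF q(1)] by (simp add: mult.commute)
      then have "r' j = w * e * prod_list (remove1 q ps)" using pnz e by (simp add: mult_ac)
      moreover have "w * e dvd 1" using less.prems(1) \<open>e dvd 1\<close> by (metis mult_dvd_mono mult_1)
      moreover have "length (remove1 q ps) < length ps"
        using q(1) length_pos_if_in_set[OF q(1)] by (simp add: length_remove1)
      moreover have "\<forall>p\<in>set (remove1 q ps). prime_elem p"
        using less.prems(2) notin_set_remove1 by metis
      ultimately obtain g v where gv: "g \<noteq> 0" "\<forall>c<N. r' c = g * v c"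
        "\<forall>p. prime_elem p \<longrightarrow> (\<exists>c<N. \<not> p dvd v c)"
        using less.hyps[of "remove1 q ps" "w * e" r'] by metis
      then show ?thesis
        using pnz(1) r' by (intro exI[of _ "p * g"] exI[of _ v] conjI) (simp_all add: mult.assoc)
    qed
  qed
  moreover obtain w ps where "w dvd 1" "\<And>p. p \<in> set ps \<Longrightarrow> prime_elem p" "r j = w * prod_list ps"
    using ufd_prime_factorization[OF assms(2)] by metis
  ultimately show ?thesis using that by metis
qed

text \<open>The prime factors of \<open>s\<close> cancel one by one: each misses some entry of
  \<open>v\<close> and hence divides \<open>x\<close>.\<close>

lemma primitive_vector_dvd:
  fixes v :: "nat \<Rightarrow> 'a::ufd"
  assumes prim: "\<And>p. prime_elem p \<Longrightarrow> \<exists>c<N. \<not> p dvd v c"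
    and j: "j < N" "v j \<noteq> 0" and dvd: "\<And>c. c < N \<Longrightarrow> s dvd v c * x"
  shows "s dvd x"
proof (cases "s = 0")
  case True
  then show ?thesis using dvd[OF j(1)] j(2) by simp
next
  case False
  obtain w ps where w: "w dvd 1" "\<And>p. p \<in> set ps \<Longrightarrow> prime_elem p" "s = w * prod_list ps"
    using ufd_prime_factorization[OF False] by metis
  have "prod_list ps dvd x" if "\<forall>p\<in>set ps. prime_elem p" "\<forall>c<N. prod_list ps dvd v c * x" for x
    using that
  proof (induction ps arbitrary: x)
    case (Cons p ps)
    obtain c where c: "c < N" "\<not> p dvd v c" using prim[of p] Cons.prems(1) by (metis list.set_intros(1))
    have "p dvd v c * x" using Cons.prems(2) c(1) by (metis dvd_mult_left prod_list.Cons)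
    then have "p dvd x" using c(2) Cons.prems(1) prime_elem_dvd_mult_iff by (metis list.set_intros(1))
    then obtain y where y: "x = p * y" by (elim dvdE)
    have "p \<noteq> 0" using Cons.prems(1) prime_elem_not_zeroI by (metis list.set_intros(1))
    then have "\<forall>c<N. prod_list ps dvd v c * y"
      using Cons.prems(2) unfolding y by (simp add: mult.left_commute)
    then show ?case using Cons.IH[of y] Cons.prems(1) y by (simp add: mult_dvd_mono)
  qed simp
  moreover have "prod_list ps dvd v c * x" if "c < N" for c
    using dvd[OF that] unfolding w(3) by (rule dvd_mult_right)
  ultimately have "prod_list ps dvd x" using w(2) by metis
  then show ?thesis unfolding w(3) using w(1)
    by (metis dvd_def dvd_trans mult.commute mult.left_neutral mult_dvd_mono)
qed

text \<open>In characteristic zero the hypothesis says that all quotients \<open>u c / u f\<close> have zero derivative.\<close>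

lemma proportional_derivative:
  fixes u :: "nat \<Rightarrow> 'a::{ufd, ring_char_0} poly"
  assumes eq: "\<And>c f. c < N \<Longrightarrow> f < N \<Longrightarrow> u c * pderiv (u f) = u f * pderiv (u c)"
    and j: "j < N" "u j \<noteq> 0"
  obtains h v where "h \<noteq> 0" "\<And>c. c < N \<Longrightarrow> u c = h * [:v c:]"
proof -
  define D where "D = degree (u j)"
  define r where "r c = poly.coeff (u c) D" for c
  have rj: "r j \<noteq> 0" using j(2) by (simp add: r_def D_def)
  have collinear: "Polynomial.smult (r j) (u c) = Polynomial.smult (r c) (u j)" if c: "c < N" for c
  proof (rule ccontr)
    \<comment> \<open>This combination has coefficient zero at \<open>D\<close> and satisfies the
      same derivative relation against \<open>u j\<close>. Comparing leading coefficients forces its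
      degree to be \<open>D\<close> in characteristic zero, which is a contradiction.\<close>
    define w where "w = Polynomial.smult (r j) (u c) - Polynomial.smult (r c) (u j)"
    assume "\<not> ?thesis"
    then have w: "w \<noteq> 0" by (simp add: w_def)
    define E where "E = degree w"
    have wD: "poly.coeff w D = 0" by (simp add: w_def r_def)
    have weq: "w * pderiv (u j) = u j * pderiv w"
      using eq[OF c j(1)] by (simp add: w_def pderiv_diff pderiv_smult algebra_simps)
    have b1: "degree_bound (int E) w" "degree_bound (int D) (u j)"
      by (auto simp: degree_bound_def E_def D_def coeff_eq_0)
    show False
    \<comment> \<open>The derivative of a constant has no leading term to compare, so degree zero is
      treated apart.\<close>
    proof (cases "E = 0 \<or> D = 0")
      case True
      have pw: "poly.coeff w E \<noteq> 0" using w by (simp add: E_def)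
      show False
      proof (cases "D = 0")
        case True
        then have "pderiv (u j) = 0" by (simp add: pderiv_eq_0_iff D_def)
        then have "pderiv w = 0" using weq j(2) by simp
        then have "E = 0" by (simp add: pderiv_eq_0_iff E_def)
        then show False using pw wD True by simp
      next
        case False
        then have E: "E = 0" using \<open>E = 0 \<or> D = 0\<close> by simp
        then have "pderiv w = 0" by (simp add: pderiv_eq_0_iff E_def)
        then have "pderiv (u j) = 0" using weq w by simp
        then show False using False by (simp add: pderiv_eq_0_iff D_def)
      qed
    next
      case False
      then obtain E' D' where ED: "E = Suc E'" "D = Suc D'" by (auto simp: gr0_conv_Suc)
      have b2: "degree_bound (int E') (pderiv w)" "degree_bound (int D') (pderiv (u j))"
        using b1 by (auto simp: degree_bound_def coeff_pderiv ED)
      have "poly.coeff (w * pderiv (u j)) (E + D') = poly.coeff w E * (of_nat D * poly.coeff (u j) D)"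
        using coeff_mult_top[OF b1(1) b2(2)] by (simp add: coeff_pderiv ED)
      moreover have "poly.coeff (u j * pderiv w) (D + E') = poly.coeff (u j) D * (of_nat E * poly.coeff w E)"
        using coeff_mult_top[OF b1(2) b2(1)] by (simp add: coeff_pderiv ED)
      moreover have "E + D' = D + E'" using ED by simp
      moreover have "poly.coeff w E \<noteq> 0" "poly.coeff (u j) D \<noteq> 0" using w j(2) by (simp_all add: E_def D_def)
      ultimately have "(of_nat D :: 'a) = of_nat E" using weq by (simp add: mult_ac)
      then have "D = E" by simp
      then show False using wD \<open>poly.coeff w E \<noteq> 0\<close> by simp
    qed
  qed
  \<comment> \<open>All \<open>u c\<close> are proportional to the coefficient vector
    \<open>r\<close>. Once the content of \<open>r\<close> is removed, \<open>v j\<close> divides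
    every coefficient of \<open>u j\<close>, so the common factor is a polynomial and not just a
    fraction.\<close>
  obtain g v where g: "g \<noteq> 0" and gv: "\<And>c. c < N \<Longrightarrow> r c = g * v c"
    and prim: "\<And>p. prime_elem p \<Longrightarrow> \<exists>c<N. \<not> p dvd v c"
    using ufd_primitive_vector[of j N r, OF j(1) rj] by metis
  have vj: "v j \<noteq> 0" using gv[OF j(1)] rj by auto
  have cross: "Polynomial.smult (v j) (u c) = Polynomial.smult (v c) (u j)" if "c < N" for c
  proof -
    have "Polynomial.smult g (Polynomial.smult (v j) (u c)) = Polynomial.smult g (Polynomial.smult (v c) (u j))"
      using collinear[OF that] gv[OF that] gv[OF j(1)] by simp
    then show ?thesis using g by (metis smult_cancel)
  qed
  have "v j dvd poly.coeff (u j) s" for s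
  proof (rule primitive_vector_dvd[where v = v and j = j and N = N, OF prim j(1) vj])
    fix c assume "c < N"
    then have "v c * poly.coeff (u j) s = v j * poly.coeff (u c) s"
      using cross by (metis coeff_smult)
    then show "v j dvd v c * poly.coeff (u j) s" by simp
  qed
  then have "[:v j:] dvd u j" by (simp add: const_poly_dvd_iff)
  then obtain h where h: "u j = [:v j:] * h" by (elim dvdE)
  have "u c = h * [:v c:]" if "c < N" for c
  proof -
    have "Polynomial.smult (v j) (u c) = Polynomial.smult (v j) (h * [:v c:])"
      unfolding cross[OF that] h by (simp add: mult.commute)
    then show ?thesis using vj by (metis smult_cancel)
  qed
  moreover have "h \<noteq> 0" using h j(2) by auto
  ultimately show ?thesis using that by metis
qed


section \<open>Homomorphisms from iterated polynomial rings and the change to line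
  coordinates\<close>

definition hom_ext :: "('a::comm_ring_1 \<Rightarrow> 'b::comm_ring_1) \<Rightarrow> 'b \<Rightarrow> 'a poly \<Rightarrow> 'b" where
  "hom_ext g s p = poly (map_poly g p) s"

lemma hom_ext_pCons:
  assumes "comm_ring_hom g"
  shows "hom_ext g s (pCons a p) = g a + s * hom_ext g s p"
proof -
  interpret comm_ring_hom g by fact
  show ?thesis by (cases "a = 0 \<and> p = 0") (auto simp: hom_ext_def map_poly_pCons)
qed

lemma hom_ext_const: "comm_ring_hom g \<Longrightarrow> hom_ext g s [:a:] = g a"
  by (simp add: hom_ext_pCons) (simp add: hom_ext_def)

lemma hom_ext_X: "comm_ring_hom g \<Longrightarrow> hom_ext g s [:0, 1:] = s"
proof -
  assume g: "comm_ring_hom g"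
  then interpret comm_ring_hom g .
  show ?thesis by (simp add: hom_ext_pCons[OF g]) (simp add: hom_ext_def)
qed

lemma comm_ring_hom_hom_ext:
  assumes "comm_ring_hom g"
  shows "comm_ring_hom (hom_ext g s)"
proof -
  interpret g: comm_ring_hom g by fact
  interpret map_poly_comm_ring_hom g ..
  show ?thesis by standard (simp_all add: hom_ext_def hom_add hom_mult)
qed

lemma comm_ring_hom_comp:
  assumes "comm_ring_hom f" "comm_ring_hom g"
  shows "comm_ring_hom (\<lambda>x. f (g x))"
proof -
  interpret f: comm_ring_hom f by fact
  interpret g: comm_ring_hom g by fact
  show ?thesis by standard (simp_all add: f.hom_add g.hom_add f.hom_mult g.hom_mult)
qed

lemma poly_hom_eqI:
  assumes f: "comm_ring_hom f" and g: "comm_ring_hom g"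
    and const: "\<And>c. f [:c:] = g [:c:]" and X: "f [:0, 1:] = g [:0, 1:]"
  shows "f p = g p"
proof -
  interpret f: comm_ring_hom f by fact
  interpret g: comm_ring_hom g by fact
  show ?thesis
  proof (induction p)
    case (pCons a p)
    have "pCons a p = [:a:] + [:0, 1:] * p" by simp
    then show ?case using pCons.IH const X by (simp only: f.hom_add g.hom_add f.hom_mult g.hom_mult)
  qed simp
qed

lemma comm_ring_hom_pconst: "comm_ring_hom (\<lambda>c. [:c:])"
  using comm_ring_hom_const_poly[OF comm_ring_hom_id] .

lemma comm_ring_hom_pconst2: "comm_ring_hom (\<lambda>c. [:[:c:]:])"
  using comm_ring_hom_const_poly[OF comm_ring_hom_pconst] .

lemma comm_ring_hom_pconst3: "comm_ring_hom (\<lambda>c. [:[:[:c:]:]:])"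
  using comm_ring_hom_const_poly[OF comm_ring_hom_pconst2] .

text \<open>Lines \<open>Z = \<alpha> X + \<beta>\<close> through a point of the chart \<open>y = 1\<close> with coordinates \<open>X\<close>, \<open>Z\<close>: a pair
  consisting of a point and a line through it is given by \<open>(X, Z, \<alpha>)\<close> or by \<open>(\<alpha>, \<beta>, X)\<close>. The two
  maps below are the mutually inverse changes of coordinates
  from \<open>K[X][Z][\<alpha>]\<close> to \<open>K[\<alpha>][\<beta>][X]\<close> and back.\<close>

definition to_line :: "'k::comm_ring_1 poly poly poly \<Rightarrow> 'k poly poly poly" where
  "to_line = hom_ext (hom_ext (hom_ext (\<lambda>c. [:[:[:c:]:]:]) [:0, 1:]) [:[:0, 1:], [:[:0, 1:]:]:]) [:[:[:0, 1:]:]:]"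

definition from_line :: "'k::comm_ring_1 poly poly poly \<Rightarrow> 'k poly poly poly" where
  "from_line = hom_ext (hom_ext (hom_ext (\<lambda>c. [:[:[:c:]:]:]) [:0, 1:])
     ([:[:0, 1:]:] - [:0, 1:] * [:[:[:0, 1:]:]:])) [:[:[:0, 1:]:]:]"

lemma comm_ring_hom_to_line: "comm_ring_hom to_line"
  unfolding to_line_def by (intro comm_ring_hom_hom_ext comm_ring_hom_pconst3)

lemma comm_ring_hom_from_line: "comm_ring_hom from_line"
  unfolding from_line_def by (intro comm_ring_hom_hom_ext comm_ring_hom_pconst3)

lemma to_line_gens:
  "to_line [:0, 1:] = [:[:[:0, 1:]:]:]" "to_line [:[:0, 1:]:] = [:[:0, 1:], [:[:0, 1:]:]:]"
  "to_line [:[:[:0, 1:]:]:] = [:0, 1:]" "to_line [:[:[:c:]:]:] = [:[:[:c:]:]:]"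
  unfolding to_line_def
  by (simp_all only: hom_ext_const hom_ext_X comm_ring_hom_hom_ext comm_ring_hom_pconst3)

lemma from_line_gens:
  "from_line [:0, 1:] = [:[:[:0, 1:]:]:]"
  "from_line [:[:0, 1:]:] = [:[:0, 1:]:] - [:0, 1:] * [:[:[:0, 1:]:]:]"
  "from_line [:[:[:0, 1:]:]:] = [:0, 1:]" "from_line [:[:[:c:]:]:] = [:[:[:c:]:]:]"
  unfolding from_line_def
  by (simp_all only: hom_ext_const hom_ext_X comm_ring_hom_hom_ext comm_ring_hom_pconst3)

lemma poly3_hom_eqI:
  fixes f g :: "'a::comm_ring_1 poly poly poly \<Rightarrow> 'b::comm_ring_1"
  assumes f: "comm_ring_hom f" and g: "comm_ring_hom g"
    and "\<And>c. f [:[:[:c:]:]:] = g [:[:[:c:]:]:]" and "f [:0, 1:] = g [:0, 1:]"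
    and "f [:[:0, 1:]:] = g [:[:0, 1:]:]" and "f [:[:[:0, 1:]:]:] = g [:[:[:0, 1:]:]:]"
  shows "f p = g p"
proof (rule poly_hom_eqI[OF f g _ assms(4)])
  fix c
  have f2: "comm_ring_hom (\<lambda>c. f [:c:])" and g2: "comm_ring_hom (\<lambda>c. g [:c:])"
    by (intro comm_ring_hom_comp[OF f] comm_ring_hom_comp[OF g] comm_ring_hom_pconst)+
  show "f [:c:] = g [:c:]"
  proof (rule poly_hom_eqI[OF f2 g2 _ assms(5)])
    fix c
    have f3: "comm_ring_hom (\<lambda>c. f [:[:c:]:])" and g3: "comm_ring_hom (\<lambda>c. g [:[:c:]:])"
      by (intro comm_ring_hom_comp[OF f] comm_ring_hom_comp[OF g] comm_ring_hom_pconst2)+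
    show "f [:[:c:]:] = g [:[:c:]:]"
      by (rule poly_hom_eqI[OF f3 g3 assms(3) assms(6)])
  qed
qed

lemma to_line_from_line: "to_line (from_line p) = p"
proof -
  interpret T: comm_ring_hom to_line by (rule comm_ring_hom_to_line)
  show ?thesis
    by (rule poly3_hom_eqI[OF comm_ring_hom_comp[OF comm_ring_hom_to_line comm_ring_hom_from_line] comm_ring_hom_id])
      (simp_all only: from_line_gens to_line_gens T.hom_minus T.hom_mult, simp)
qed

lemma from_line_to_line: "from_line (to_line p) = p"
proof -
  interpret F: comm_ring_hom from_line by (rule comm_ring_hom_from_line)
  \<comment> \<open>Z = \<beta> + X \<alpha>, written as a combination of generators so that the
    homomorphism can be applied.\<close>
  have Z: "to_line [:[:0, 1:]:] = [:[:0, 1:]:] + [:0, 1:] * [:[:[:0, 1:]:]:]"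
    unfolding to_line_gens by simp
  show ?thesis
    by (rule poly3_hom_eqI[OF comm_ring_hom_comp[OF comm_ring_hom_from_line comm_ring_hom_to_line] comm_ring_hom_id])
      (simp_all only: Z from_line_gens to_line_gens F.hom_add F.hom_mult, simp)
qed

text \<open>The derivation \<open>\<partial>\<^sub>\<alpha> - X \<partial>\<^sub>\<beta>\<close> of \<open>K[\<alpha>][\<beta>][X]\<close>, which moves the line and fixes the point on it, is
  \<open>\<partial>\<^sub>\<alpha>\<close> in the other coordinates. It raises the degree in \<open>X\<close> by at most one.\<close>

lemma degree_bound_line_derivation:
  fixes q :: "'k::idom poly poly poly"
  assumes "degree_bound r q"
  shows "degree_bound (r + 1) (to_line (pderiv (from_line q)))"
proof -
  interpret T: comm_ring_hom to_line by (rule comm_ring_hom_to_line)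
  interpret F: comm_ring_hom from_line by (rule comm_ring_hom_from_line)
  define D where "D q = to_line (pderiv (from_line q))" for q :: "'k poly poly poly"
  have D_add: "D (p + q) = D p + D q" for p q by (simp add: D_def F.hom_add pderiv_add T.hom_add)
  have D_mult: "D (p * q) = p * D q + q * D p" for p q
    by (simp add: D_def F.hom_mult pderiv_mult T.hom_add T.hom_mult to_line_from_line)
  have D_const: "D [:[:[:c:]:]:] = 0" for c
    by (simp add: D_def from_line_gens pderiv_pCons)
  have D_X: "D [:0, 1:] = 0"
    unfolding D_def from_line_gens by (simp add: pderiv_pCons)
  have D_alpha: "D [:[:[:0, 1:]:]:] = 1"
    unfolding D_def from_line_gens by (simp add: pderiv_pCons)
  \<comment> \<open>In the other coordinates \<beta> = Z - \<alpha> X, and X and Z are fixed while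
    \<alpha> varies.\<close>
  have D_beta: "D [:[:0, 1:]:] = - [:0, 1:]"
  proof -
    have eq: "pderiv (from_line [:[:0, 1:]:]) = - [:[:[:0, 1:]:]:]"
      unfolding from_line_gens by (simp add: pderiv_pCons)
    show ?thesis unfolding D_def eq by (simp only: T.hom_uminus to_line_gens)
  qed
  have c0: "degree_bound 0 [:a:]" for a :: "'k poly poly" by (simp add: degree_bound_def coeff_pCons split: nat.splits)
  have X1: "degree_bound 1 [:0, 1 :: 'k poly poly:]" by (auto simp: degree_bound_def coeff_pCons split: nat.splits)
  \<comment> \<open>Polynomials in \<alpha> alone keep degree 0 in X. Only the derivative of \<beta>
    brings in a factor X, and by the product rule at most one such factor occurs in each
    term.\<close>
  have D0: "degree_bound 0 (D [:[:a:]:])" for a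
  proof (induction a)
    case 0
    show ?case by (simp add: D_def)
  next
    case (pCons c a)
    have "[:[:pCons c a:]:] = [:[:[:c:]:]:] + [:[:[:0, 1:]:]:] * [:[:a:]:]" by simp
    then have "D [:[:pCons c a:]:] = [:[:[:0, 1:]:]:] * D [:[:a:]:] + [:[:a:]:]"
      by (simp only: D_add D_mult D_const D_alpha add_0 mult_1_right)
    moreover have "degree_bound (0 + 0) ([:[:[:0, 1:]:]:] * D [:[:a:]:])"
      by (intro degree_bound_mult c0 pCons.IH)
    ultimately show ?case by (simp only: degree_bound_add c0 add_0)
  qed
  have D1: "degree_bound 1 (D [:a:])" for a
  proof (induction a)
    case 0
    show ?case by (simp add: D_def)
  next
    case (pCons a0 a)
    have "[:pCons a0 a:] = [:[:a0:]:] + [:[:0, 1:]:] * [:a:]" by simp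
    then have eq: "D [:pCons a0 a:] = D [:[:a0:]:] + ([:[:0, 1:]:] * D [:a:] + [:a:] * - [:0, 1:])"
      by (simp only: D_add D_mult D_beta)
    have "degree_bound (0 + 1) ([:[:0, 1:]:] * D [:a:])"
      by (intro degree_bound_mult c0 pCons.IH)
    moreover have "degree_bound (0 + 1) ([:a:] * - [:0, 1:])"
      using degree_bound_diff[OF degree_bound_zero X1] by (intro degree_bound_mult c0) (simp only: diff_0)
    moreover have "degree_bound 1 (D [:[:a0:]:])" using D0 by (rule degree_bound_mono) simp
    ultimately show ?case unfolding eq by (intro degree_bound_add) (simp_all only: add_0)
  qed
  have "degree_bound (r + 1) (D q)"
    using assms
  proof (induction q arbitrary: r)
    case 0
    show ?case by (simp add: D_def)
  next
    case (pCons a q)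
    have "degree_bound (r - 1) q"
      unfolding degree_bound_def
    proof (intro allI impI)
      fix i assume "r - 1 < int i"
      then have "r < int (Suc i)" by simp
      then have "poly.coeff (pCons a q) (Suc i) = 0" using pCons.prems unfolding degree_bound_def by blast
      then show "poly.coeff q i = 0" by simp
    qed
    then have "degree_bound (r - 1 + 1) (D q)" by (rule pCons.IH)
    then have q: "degree_bound (1 + r) ([:0, 1:] * D q)" by (intro degree_bound_mult X1) simp
    have "pCons a q = [:a:] + [:0, 1:] * q" by simp
    then have eq: "D (pCons a q) = D [:a:] + [:0, 1:] * D q"
      by (simp only: D_add D_mult D_X mult_zero_right add_0_right)
    have "degree_bound (r + 1) (D [:a:])"
    \<comment> \<open>For negative \<open>r\<close> the constant coefficient \<open>a\<close> is
      zero; otherwise the bound 1 for its derivative is at most \<open>r + 1\<close>.\<close>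
    proof (cases "r < 0")
      case True
      then have "poly.coeff (pCons a q) 0 = 0" using pCons.prems unfolding degree_bound_def by (metis of_nat_0)
      then show ?thesis by (simp add: D_def)
    next
      case False
      then have "1 \<le> r + 1" by simp
      then show ?thesis by (rule degree_bound_mono[OF D1])
    qed
    then show ?case unfolding eq using q by (intro degree_bound_add) (simp_all add: add.commute)
  qed
  then show ?thesis by (simp add: D_def)
qed

text \<open>The affine chart \<open>y = 1\<close> of the plane.\<close>

definition plane_chart :: "(3, 'k::comm_ring_1) mpoly \<Rightarrow> 'k poly poly" where
  "plane_chart = mpeval (\<lambda>c. [:[:c:]:]) (\<lambda>v. if v = 0 then [:[:0, 1:]:] else if v = 1 then 1 else [:0, 1:])"

lemma comm_ring_hom_plane_chart: "comm_ring_hom plane_chart"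
  unfolding plane_chart_def by (intro comm_ring_hom.comm_ring_hom_mpeval comm_ring_hom_pconst2)

lemma plane_chart_gens:
  "plane_chart (mvar 0) = [:[:0, 1:]:]" "plane_chart (mvar 1) = 1" "plane_chart (mvar 2) = [:0, 1:]"
  "plane_chart (mconst c) = [:[:c:]:]"
  by (simp_all add: plane_chart_def comm_ring_hom.mpeval_mvar[OF comm_ring_hom_pconst2]
      comm_ring_hom.mpeval_mconst[OF comm_ring_hom_pconst2])

text \<open>In the coefficient ring K[\<alpha>][\<beta>] the slope \<alpha> is the inner and \<beta>
  the outer variable, as in the target of \<open>to_line\<close>.\<close>

abbreviation generic_restriction :: "(3, 'k::comm_ring_1) mpoly \<Rightarrow> 'k poly poly poly" where
  "generic_restriction \<equiv> restrict_line (\<lambda>c. [:[:c:]:]) [:[:0, 1:]:] [:0, 1:]"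

text \<open>A function of the point alone is constant in the slope; rewritten in line coordinates it
  becomes the restriction to the generic line. Both sides are homomorphisms that agree on variables
  and constants.\<close>

lemma to_line_plane_chart: "to_line [:plane_chart p:] = generic_restriction p"
proof -
  have 3: "v = 0 \<or> v = 1 \<or> v = 2" for v :: 3
    using UNIV_I[of v] unfolding UNIV_three by simp
  have "to_line [:plane_chart p:] = mpeval (\<lambda>c. [:[:[:c:]:]:]) (line_vars [:[:0, 1:]:] [:0, 1:]) p"
  proof (rule mpoly_hom_eq_mpeval[OF _ comm_ring_hom_pconst3])
    show "comm_ring_hom (\<lambda>p. to_line [:plane_chart p:])"
      by (rule comm_ring_hom_comp[OF comm_ring_hom_to_line
            comm_ring_hom_comp[OF comm_ring_hom_pconst comm_ring_hom_plane_chart]])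
    show "to_line [:plane_chart (mconst c):] = [:[:[:c:]:]:]" for c
      by (simp only: plane_chart_gens to_line_gens)
    fix v :: 3
    show "to_line [:plane_chart (mvar v):] = line_vars [:[:0, 1:]:] [:0, 1:] v"
    proof -
      interpret T: comm_ring_hom to_line by (rule comm_ring_hom_to_line)
      have "to_line [:1:] = 1" by (metis T.hom_one one_pCons)
      then show ?thesis
        using 3[of v] by (elim disjE) (simp_all only: plane_chart_gens to_line_gens line_vars_def, simp_all)
    qed
  qed
  then show ?thesis by (simp add: restrict_line_def)
qed


lemma plane_chart_single:
  "plane_chart (Poly_Mapping.single t c)
    = Polynomial.monom (Polynomial.monom c (Poly_Mapping.lookup t 0)) (Poly_Mapping.lookup t 2)"
proof -
  interpret h: comm_ring_hom "\<lambda>c. [:[:c:]:]" by (rule comm_ring_hom_pconst2)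
  show ?thesis
    by (simp add: poly_const_pow plane_chart_def h.mpeval_single prod_UNIV_three monom_altdef mult.assoc)
qed

lemma homogeneous_three_eqI:
  assumes "homogeneous r p" "Poly_Mapping.lookup p s \<noteq> 0" "Poly_Mapping.lookup p t \<noteq> 0"
    and "Poly_Mapping.lookup s u = Poly_Mapping.lookup t u" "Poly_Mapping.lookup s 2 = Poly_Mapping.lookup t (2 :: 3)"
    and "u = 0 \<or> u = 1"
  shows "s = t"
proof -
  have "monomial_degree s = monomial_degree t"
    using assms(1-3) unfolding homogeneous_lookup by (metis of_nat_eq_iff)
  then show ?thesis
    using assms(4-6) by (intro monomial_three_eqI) (auto simp: monomial_degree_three)
qed

text \<open>In a fixed degree the exponents of x and z determine that of y, so nothing cancels at y
  = 1.\<close>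

lemma plane_chart_injective:
  assumes "homogeneous r p" "plane_chart p = 0"
  shows "p = 0"
proof (rule poly_mapping_eqI, rule ccontr)
  fix t assume "Poly_Mapping.lookup p t \<noteq> Poly_Mapping.lookup 0 t"
  then have t: "Poly_Mapping.lookup p t \<noteq> 0" by simp
  interpret C: comm_ring_hom plane_chart by (rule comm_ring_hom_plane_chart)
  have "p = (\<Sum>s\<in>Poly_Mapping.keys p. Poly_Mapping.single s (Poly_Mapping.lookup p s))"
    by (rule poly_mapping_eqI) (simp add: lookup_sum lookup_single when_def in_keys_iff)
  then have "plane_chart p = (\<Sum>s\<in>Poly_Mapping.keys p. plane_chart (Poly_Mapping.single s (Poly_Mapping.lookup p s)))"
    by (metis C.hom_sum)
  then have "poly.coeff (poly.coeff (plane_chart p) (Poly_Mapping.lookup t 2)) (Poly_Mapping.lookup t 0)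
    = (\<Sum>s\<in>Poly_Mapping.keys p. poly.coeff (poly.coeff (Polynomial.monom
        (Polynomial.monom (Poly_Mapping.lookup p s) (Poly_Mapping.lookup s 0)) (Poly_Mapping.lookup s 2))
        (Poly_Mapping.lookup t 2)) (Poly_Mapping.lookup t 0))"
    by (simp add: coeff_sum plane_chart_single)
  also have "\<dots> = (\<Sum>s\<in>Poly_Mapping.keys p. if s = t then Poly_Mapping.lookup p s else 0)"
  proof (rule sum.cong)
    fix s assume "s \<in> Poly_Mapping.keys p"
    then have "Poly_Mapping.lookup p s \<noteq> 0" by (simp add: in_keys_iff)
    then have "s = t" if "Poly_Mapping.lookup s 0 = Poly_Mapping.lookup t 0" "Poly_Mapping.lookup s 2 = Poly_Mapping.lookup t 2"
      using homogeneous_three_eqI[OF assms(1) _ t that] by simp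
    then show "poly.coeff (poly.coeff (Polynomial.monom
        (Polynomial.monom (Poly_Mapping.lookup p s) (Poly_Mapping.lookup s 0)) (Poly_Mapping.lookup s 2))
        (Poly_Mapping.lookup t 2)) (Poly_Mapping.lookup t 0) = (if s = t then Poly_Mapping.lookup p s else 0)"
      by auto
  qed simp
  also have "\<dots> = Poly_Mapping.lookup p t" using t by (simp add: in_keys_iff)
  finally show False using t assms(2) by simp
qed

text \<open>Powers of y are invisible on the chart and serve to bring forms to a common
  degree.\<close>

lemma plane_chart_pad:
  assumes "homogeneous s p" "s \<le> r"
  obtains q where "homogeneous r q" "plane_chart q = plane_chart p"
proof
  interpret C: comm_ring_hom plane_chart by (rule comm_ring_hom_plane_chart)
  show "plane_chart (mvar 1 ^ nat (r - s) * p) = plane_chart p"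
    by (simp add: C.hom_mult C.hom_power plane_chart_gens)
  have "homogeneous (int (nat (r - s)) * 1 + s) (mvar 1 ^ nat (r - s) * p)"
    by (intro homogeneous_mult homogeneous_power homogeneous_mvar assms)
  then show "homogeneous r (mvar 1 ^ nat (r - s) * p)" using assms(2) by simp
qed

lemma plane_chart_surjective:
  fixes v :: "'k::comm_ring_1 poly poly"
  obtains s p where "homogeneous (int s) p" "plane_chart p = v"
proof -
  interpret C: comm_ring_hom "plane_chart :: (3, 'k) mpoly \<Rightarrow> _" by (rule comm_ring_hom_plane_chart)
  define Q where "Q v \<longleftrightarrow> (\<exists>s p. homogeneous (int s) p \<and> plane_chart p = v)" for v :: "'k poly poly"
  have add: "Q (v + w)" if "Q v" "Q w" for v w
  proof -
    obtain s p t q where 1: "homogeneous (int s) p" "plane_chart p = v" "homogeneous (int t) q" "plane_chart q = w"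
      using \<open>Q v\<close> \<open>Q w\<close> unfolding Q_def by metis
    obtain p' where p': "homogeneous (int (max s t)) p'" "plane_chart p' = v"
      using plane_chart_pad[OF 1(1), of "int (max s t)"] 1(2) by auto
    obtain q' where q': "homogeneous (int (max s t)) q'" "plane_chart q' = w"
      using plane_chart_pad[OF 1(3), of "int (max s t)"] 1(4) by auto
    show ?thesis
      unfolding Q_def
      by (intro exI[of _ "max s t"] exI[of _ "p' + q'"]) (simp only: homogeneous_add p' q' C.hom_add simp_thms)
  qed
  have mult: "Q (plane_chart (mvar u) * v)" if "Q v" for u v
  proof -
    obtain s p where 1: "homogeneous (int s) p" "plane_chart p = v" using \<open>Q v\<close> unfolding Q_def by metis
    have "homogeneous (int (Suc s)) (mvar u * p)"
      using homogeneous_mult[OF homogeneous_mvar 1(1)] by simp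
    then show ?thesis unfolding Q_def using 1(2) C.hom_mult by blast
  qed
  have zero: "Q 0" unfolding Q_def by (intro exI[of _ 0]) simp
  have const: "Q [:[:c:]:]" for c
    unfolding Q_def by (intro exI[of _ 0] exI[of _ "mconst c"]) (simp add: homogeneous_mconst plane_chart_gens)
  have inner: "Q [:a:]" for a
  proof (induction a)
    case (pCons c a)
    have "[:pCons c a:] = [:[:c:]:] + plane_chart (mvar 0) * [:a:]" by (simp add: plane_chart_gens)
    then show ?case using add[OF const mult[OF pCons.IH, of 0]] by (simp only:)
  qed (use zero in simp)
  have "Q v"
  proof (induction v)
    case (pCons a v)
    have "pCons a v = [:a:] + plane_chart (mvar 2) * v" by (simp add: plane_chart_gens)
    then show ?case using add[OF inner mult[OF pCons.IH, of 2]] by (simp only:)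
  qed (rule zero)
  then show ?thesis using that unfolding Q_def by metis
qed

text \<open>With an indeterminate slope the monomials of degree \<open>r\<close> without y take
  distinct powers of \<alpha> as values, so vanishing at infinity removes all of them.\<close>

lemma mvar_1_dvd_if_zero_at_infinity:
  fixes p :: "(3, 'k::comm_ring_1) mpoly"
  assumes p: "homogeneous r p" and zero: "mpeval (\<lambda>c. [:[:c:]:]) (infinity_vars [:[:0, 1:]:]) p = 0"
  obtains q where "homogeneous (r - 1) q" "p = mvar 1 * q"
proof -
  have "mvar 1 ^ 1 dvd p"
    unfolding mvar_power_dvd_iff
  proof (intro allI impI, rule ccontr)
    fix t assume t: "Poly_Mapping.lookup p t \<noteq> 0" and "\<not> 1 \<le> Poly_Mapping.lookup t 1"
    then have t1: "Poly_Mapping.lookup t 1 = 0" by simp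
    have "mpeval (\<lambda>c. [:[:c:]:]) (infinity_vars [:[:0, 1:]:]) p
      = (\<Sum>s\<in>Poly_Mapping.keys p. if Poly_Mapping.lookup s 1 = 0
           then [:Polynomial.monom (Poly_Mapping.lookup p s) (Poly_Mapping.lookup s 2):] else 0)"
      unfolding mpeval_def
      by (rule sum.cong) (simp_all add: prod_UNIV_three infinity_vars_def power_0_left poly_const_pow monom_altdef)
    then have "poly.coeff (poly.coeff (mpeval (\<lambda>c. [:[:c:]:]) (infinity_vars [:[:0, 1:]:]) p) 0) (Poly_Mapping.lookup t 2)
      = (\<Sum>s\<in>Poly_Mapping.keys p. if Poly_Mapping.lookup s 1 = 0 \<and> Poly_Mapping.lookup s 2 = Poly_Mapping.lookup t 2
           then Poly_Mapping.lookup p s else 0)"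
      by (simp add: coeff_sum if_distrib cong: if_cong) (auto intro!: sum.cong)
    also have "\<dots> = (\<Sum>s\<in>Poly_Mapping.keys p. if s = t then Poly_Mapping.lookup p s else 0)"
    proof (rule sum.cong)
      fix s assume "s \<in> Poly_Mapping.keys p"
      then have "Poly_Mapping.lookup p s \<noteq> 0" by (simp add: in_keys_iff)
      then have "s = t" if "Poly_Mapping.lookup s 1 = 0" "Poly_Mapping.lookup s 2 = Poly_Mapping.lookup t 2"
        using homogeneous_three_eqI[OF p _ t, of s 1] that t1 by simp
      then show "(if Poly_Mapping.lookup s 1 = 0 \<and> Poly_Mapping.lookup s 2 = Poly_Mapping.lookup t 2
          then Poly_Mapping.lookup p s else 0) = (if s = t then Poly_Mapping.lookup p s else 0)"
        using t1 by auto
    qed simp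
    also have "\<dots> = Poly_Mapping.lookup p t" using t by (simp add: in_keys_iff)
    finally show False using zero t by simp
  qed
  then obtain q where q: "p = mvar 1 * q" by (auto elim: dvdE)
  have "p = mvar 1 * hcomp (r - 1) q"
    using hcomp_homogeneous[OF p, of r] hcomp_mult_left[OF homogeneous_mvar, of r 1 q] q by simp
  then show ?thesis using that[OF homogeneous_hcomp] by blast
qed

text \<open>The degree in \<open>X\<close> on the generic line is the total degree.\<close>

lemma homogenization_of_bounded:
  fixes v :: "'k::comm_ring_1 poly poly"
  assumes "degree_bound r (to_line [:v:])"
  obtains p where "homogeneous r p" "plane_chart p = v"
proof -
  interpret R: comm_ring_hom "generic_restriction :: (3, 'k) mpoly \<Rightarrow> _"
    by (rule comm_ring_hom_restrict_line[OF comm_ring_hom_pconst2])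
  interpret C: comm_ring_hom "plane_chart :: (3, 'k) mpoly \<Rightarrow> _" by (rule comm_ring_hom_plane_chart)
  \<comment> \<open>Induction on the degree of some homogenisation. While that degree exceeds
    \<open>r\<close>, the coefficient of the restriction in this degree, which is the value at
    infinity, vanishes; a factor y splits off, and the image in the chart stays the same.\<close>
  have main: "\<exists>q. homogeneous r q \<and> plane_chart q = plane_chart p"
    if "homogeneous (int s) p" "degree_bound r (generic_restriction p)" for s and p :: "(3, 'k) mpoly"
    using that
  proof (induction s arbitrary: p)
    case (0 p)
    show ?case
    proof (cases "0 \<le> r")
      case True
      then show ?thesis using plane_chart_pad[OF 0(1), of r] by auto
    next
      case False
      then have "poly.coeff (generic_restriction p) 0 = 0" using 0(2) by (simp add: degree_bound_def)
      then have z: "mpeval (\<lambda>c. [:[:c:]:]) (infinity_vars [:[:0, 1:]:]) p = 0"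
        using coeff_restrict_line_top[OF comm_ring_hom_pconst2 0(1), of "[:[:0, 1:]:]" "[:0, 1:]"] by simp
      obtain q where q: "homogeneous (int 0 - 1) q" "p = mvar 1 * q"
        using mvar_1_dvd_if_zero_at_infinity[OF 0(1) z] by blast
      have "q = 0" by (rule poly_mapping_eqI) (use q(1) in \<open>auto simp: homogeneous_lookup\<close>)
      then show ?thesis using q(2) by (intro exI[of _ 0]) simp
    qed
  next
    case (Suc s p)
    show ?case
    proof (cases "int (Suc s) \<le> r")
      case True
      then show ?thesis using plane_chart_pad[OF Suc.prems(1), of r] by auto
    next
      case False
      then have "poly.coeff (generic_restriction p) (Suc s) = 0" using Suc.prems(2) by (simp add: degree_bound_def)
      then have z: "mpeval (\<lambda>c. [:[:c:]:]) (infinity_vars [:[:0, 1:]:]) p = 0"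
        using coeff_restrict_line_top[OF comm_ring_hom_pconst2 Suc.prems(1), of "[:[:0, 1:]:]" "[:0, 1:]"] by simp
      obtain q where q: "homogeneous (int (Suc s) - 1) q" "p = mvar 1 * q"
        using mvar_1_dvd_if_zero_at_infinity[OF Suc.prems(1) z] by blast
      have "degree_bound r (generic_restriction q)"
        using Suc.prems(2) unfolding q(2) R.hom_mult restrict_line_mvar[OF comm_ring_hom_pconst2] by simp
      moreover have "homogeneous (int s) q" using q(1) by simp
      ultimately show ?thesis using Suc.IH[of q] unfolding q(2) C.hom_mult plane_chart_gens by simp
    qed
  qed
  obtain s p where "homogeneous (int s) p" "plane_chart p = v" using plane_chart_surjective by metis
  then show ?thesis using main[of s p] assms that unfolding to_line_plane_chart[symmetric] by auto
qed

section \<open>Minors under homomorphisms, and syzygies on the plane\<close>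

lemma cominor_hom:
  assumes "comm_ring_hom g"
  shows "g (cominor n M i k) = cominor n (\<lambda>r c. g (M r c)) i k"
proof -
  interpret g: comm_ring_hom g by fact
  have "map_mat g (bordered n M (std_row i) (std_row k)) = bordered n (\<lambda>r c. g (M r c)) (std_row i) (std_row k)"
    by (rule eq_matI) (auto simp: bordered_def std_row_def)
  then show ?thesis unfolding cominor_def by (metis g.hom_det)
qed

lemma cominor_span_hom:
  assumes "comm_ring_hom g" "W \<in> cominor_span n M"
  shows "g W \<in> cominor_span n (\<lambda>r c. g (M r c))"
proof -
  interpret g: comm_ring_hom g by fact
  obtain e where e: "W = (\<Sum>i<n+2. \<Sum>k<n+2. e i k * cominor n M i k)"
    using assms(2) unfolding cominor_span_def by blast
  show ?thesis
    unfolding cominor_span_def e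
    by (rule CollectI, rule exI[of _ "\<lambda>i k. g (e i k)"])
      (simp add: g.hom_sum g.hom_mult cominor_hom[OF assms(1)])
qed

text \<open>With weights \<open>b i\<close> and \<open>b k\<close> for the border rows, their unit
  entries are homogeneous of degree 0, and the Leibniz formula applies to the whole square
  matrix.\<close>

lemma homogeneous_cominor:
  fixes M :: "nat \<Rightarrow> nat \<Rightarrow> ('v::finite, 'k::comm_ring_1) mpoly" and a b :: "nat \<Rightarrow> int"
  assumes M: "\<And>r c. r < n \<Longrightarrow> c < n + 2 \<Longrightarrow> homogeneous (b c - a r) (M r c)"
  shows "homogeneous ((\<Sum>c<n+2. b c) - (\<Sum>r<n. a r) - b i - b k) (cominor n M i k)"
proof -
  define B where "B = bordered n M (std_row i) (std_row k)"
  define w where "w r = (if r < n then a r else if r = n then b i else b k)" for r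
  have entry: "homogeneous (b c - w r) (B $$ (r, c))" if "r < n + 2" "c < n + 2" for r c
    using that M by (auto simp: B_def bordered_index w_def std_row_def homogeneous_one)
  have sign: "homogeneous 0 (signof \<sigma> :: ('v, 'k) mpoly)" for \<sigma> :: "nat \<Rightarrow> nat"
    by (cases "evenperm \<sigma>") (auto simp: sign_def homogeneous_one homogeneous_uminus)
  have "homogeneous ((\<Sum>c<n+2. b c) - (\<Sum>r<n. a r) - b i - b k) (\<Sum>\<sigma> | \<sigma> permutes {0..<n+2}. signof \<sigma> * (\<Prod>r = 0..<n+2. B $$ (r, \<sigma> r)))"
  proof (rule homogeneous_sum)
    fix \<sigma> assume "\<sigma> \<in> {\<sigma>. \<sigma> permutes {0..<n+2}}"
    then have \<sigma>: "\<sigma> permutes {0..<n+2}" by simp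
    have "(\<Sum>r = 0..<n+2. b (\<sigma> r) - w r) = (\<Sum>c<n+2. b c) - (\<Sum>r<n+2. w r)"
      using sum.permute[OF \<sigma>, of b] by (simp add: sum_subtractf lessThan_atLeast0 o_def)
    also have "(\<Sum>r<n+2. w r) = (\<Sum>r<n. a r) + b i + b k"
      unfolding sum_bordered_rows by (simp add: w_def)
    finally have "0 + (\<Sum>r = 0..<n+2. b (\<sigma> r) - w r) = (\<Sum>c<n+2. b c) - (\<Sum>r<n. a r) - b i - b k" by simp
    moreover have "homogeneous (0 + (\<Sum>r = 0..<n+2. b (\<sigma> r) - w r)) (signof \<sigma> * (\<Prod>r = 0..<n+2. B $$ (r, \<sigma> r)))"
    proof (intro homogeneous_mult sign homogeneous_prod entry)
      fix r assume "r \<in> {0..<n+2}"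
      then show "r < n + 2" "\<sigma> r < n + 2" using permutes_in_image[OF \<sigma>, of r] by auto
    qed
    ultimately show "homogeneous ((\<Sum>c<n+2. b c) - (\<Sum>r<n. a r) - b i - b k) (signof \<sigma> * (\<Prod>r = 0..<n+2. B $$ (r, \<sigma> r)))"
      by simp
  qed
  then show ?thesis
    unfolding cominor_def B_def[symmetric] by (subst det_def'[of _ "n + 2"]) (auto simp: B_def)
qed


text \<open>A power of y restricts to 1, so the minors generate the unit ideal on the chart. A power
  of x has the value 1 at infinity, so some minor is nonzero there, that is, attains its full
  degree.\<close>

lemma line_minors:
  fixes M :: "nat \<Rightarrow> nat \<Rightarrow> (3, 'k::comm_ring_1) mpoly" and h :: "'k \<Rightarrow> 'a::idom" and a b :: "nat \<Rightarrow> int"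
  assumes h: "comm_ring_hom h"
    and M: "\<And>r c. r < n \<Longrightarrow> c < n + 2 \<Longrightarrow> homogeneous (b c - a r) (M r c)"
    and span: "\<And>v. mvar v ^ N \<in> cominor_span n M"
  shows "1 \<in> cominor_span n (\<lambda>r c. restrict_line h \<alpha> \<beta> (M r c))"
    and "\<exists>i0 k0 s. i0 < n + 2 \<and> k0 < n + 2 \<and> int s = ((\<Sum>c<n+2. b c) - (\<Sum>r<n. a r)) - b i0 - b k0 \<and>
      poly.coeff (cominor n (\<lambda>r c. restrict_line h \<alpha> \<beta> (M r c)) i0 k0) s \<noteq> 0"
proof -
  interpret R: comm_ring_hom "restrict_line h \<alpha> \<beta>" by (rule comm_ring_hom_restrict_line[OF h])
  interpret E: comm_ring_hom "mpeval h (infinity_vars \<alpha>)" by (rule comm_ring_hom.comm_ring_hom_mpeval[OF h])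
  have "restrict_line h \<alpha> \<beta> (mvar 1 ^ N) = 1"
    by (simp add: R.hom_power restrict_line_mvar[OF h])
  then show "1 \<in> cominor_span n (\<lambda>r c. restrict_line h \<alpha> \<beta> (M r c))"
    using cominor_span_hom[OF comm_ring_hom_restrict_line[OF h] span[of 1]] by metis
  define d where "d = (\<Sum>c<n+2. b c) - (\<Sum>r<n. a r)"
  have "mpeval h (infinity_vars \<alpha>) (mvar 0 ^ N) = 1"
    by (simp add: E.hom_power comm_ring_hom.mpeval_mvar[OF h] infinity_vars_def)
  moreover obtain e where e: "mvar 0 ^ N = (\<Sum>i<n+2. \<Sum>k<n+2. e i k * cominor n M i k)"
    using span[of 0] unfolding cominor_span_def by blast
  ultimately have "(\<Sum>i<n+2. \<Sum>k<n+2. mpeval h (infinity_vars \<alpha>) (e i k) * mpeval h (infinity_vars \<alpha>) (cominor n M i k)) = 1"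
    by (simp add: E.hom_sum E.hom_mult)
  then obtain i k where ik: "i < n + 2" "k < n + 2" "mpeval h (infinity_vars \<alpha>) (cominor n M i k) \<noteq> 0"
    by (metis (no_types, lifting) lessThan_iff mult_zero_right sum.neutral zero_neq_one)
  have hom: "homogeneous (d - b i - b k) (cominor n M i k)"
    unfolding d_def by (rule homogeneous_cominor[OF M])
  have "cominor n M i k \<noteq> 0" using ik(3) E.hom_zero by metis
  then have "d - b i - b k \<ge> 0"
    using hom unfolding homogeneous_lookup by (metis lookup_zero of_nat_0_le_iff poly_mapping_eqI)
  then obtain s where s: "int s = d - b i - b k" using zero_le_imp_eq_int by metis
  have "poly.coeff (restrict_line h \<alpha> \<beta> (cominor n M i k)) s = mpeval h (infinity_vars \<alpha>) (cominor n M i k)"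
    by (rule coeff_restrict_line_top[OF h]) (use hom s in simp)
  then show "\<exists>i0 k0 s. i0 < n + 2 \<and> k0 < n + 2 \<and> int s = ((\<Sum>c<n+2. b c) - (\<Sum>r<n. a r)) - b i0 - b k0 \<and>
      poly.coeff (cominor n (\<lambda>r c. restrict_line h \<alpha> \<beta> (M r c)) i0 k0) s \<noteq> 0"
    using ik s unfolding d_def cominor_hom[OF comm_ring_hom_restrict_line[OF h]] by metis
qed

text \<open>Such a syzygy is a combination of Buchsbaum-Rim relations, whose coefficients would have
  degree \<open>e + b j - d\<close>, and this is negative.\<close>

lemma no_low_degree_syzygy:
  fixes M :: "nat \<Rightarrow> nat \<Rightarrow> (3, 'k::idom) mpoly" and a b :: "nat \<Rightarrow> int"
  assumes M: "\<And>r c. r < n \<Longrightarrow> c < n + 2 \<Longrightarrow> homogeneous (b c - a r) (M r c)"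
    and span: "\<And>v. mvar v ^ N \<in> cominor_span n M"
    and d: "d = (\<Sum>c<n+2. b c) - (\<Sum>r<n. a r)"
    and low: "\<And>k. k < n + 2 \<Longrightarrow> e + b k < d"
    and U: "\<And>r. r < n \<Longrightarrow> (\<Sum>c<n+2. M r c * U c) = 0" "\<And>c. c < n + 2 \<Longrightarrow> homogeneous (e - b c) (U c)"
    and c: "c < n + 2"
  shows "U c = 0"
proof -
  have nz: "mvar 0 ^ N \<noteq> (0 :: (3, 'k) mpoly)"
    unfolding mvar_power by (metis lookup_single_eq lookup_zero zero_neq_one)
  have reg1: "mvar 0 ^ N dvd p" if "mvar 0 ^ N dvd mvar 1 ^ N * p" for p :: "(3, 'k) mpoly"
    using mvar_power_regular1[OF _ that] by simp
  have reg2: "\<exists>a b. p = mvar 0 ^ N * a + mvar 1 ^ N * b"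
    if "mvar 2 ^ N * p = mvar 0 ^ N * a + mvar 1 ^ N * b" for p a b :: "(3, 'k) mpoly"
    by (rule mvar_power_regular2[OF _ _ _ that]) auto
  obtain \<psi> where \<psi>: "\<And>c. c < n + 2 \<Longrightarrow> U c = (\<Sum>j<n+2. cominor n M c j * \<psi> j)"
  proof (rule buchsbaum_rim_exact[of _ n M _ _ U, OF span[of 0] span[of 1] span[of 2] nz reg1 reg2 U(1)])
    fix \<psi> assume "\<And>c. c < n + 2 \<Longrightarrow> U c = (\<Sum>j<n+2. cominor n M c j * \<psi> j)"
    then show thesis by (rule that)
  qed
  \<comment> \<open>The coefficients \<open>\<psi>\<close> need not be homogeneous, so the degrees
    are compared after taking components.\<close>
  have "hcomp (e - b c) (cominor n M c j * \<psi> j) = 0" if j: "j < n + 2" for j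
  proof -
    have "homogeneous (d - b c - b j) (cominor n M c j)"
      unfolding d by (rule homogeneous_cominor[OF M])
    then have "hcomp (e - b c) (cominor n M c j * \<psi> j) = cominor n M c j * hcomp (e - b c - (d - b c - b j)) (\<psi> j)"
      by (rule hcomp_mult_left)
    moreover have "hcomp (e - b c - (d - b c - b j)) (\<psi> j) = 0"
      by (rule poly_mapping_eqI) (use low[OF j] in \<open>simp add: lookup_hcomp\<close>)
    ultimately show ?thesis by simp
  qed
  then have "hcomp (e - b c) (U c) = 0" unfolding \<psi>[OF c] hcomp_sum by simp
  then show ?thesis using hcomp_homogeneous[OF U(2)[OF c], of "e - b c"] by simp
qed

text \<open>The section of least degree on the generic line is fixed by the derivation, hence up to a factor it does
  not depend on the line and comes from a syzygy on the plane.\<close>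

lemma generic_kernel_descends:
  fixes M :: "nat \<Rightarrow> nat \<Rightarrow> (3, 'k::field_char_0) mpoly" and a b :: "nat \<Rightarrow> int"
  assumes M: "\<And>r c. r < n \<Longrightarrow> c < n + 2 \<Longrightarrow> homogeneous (b c - a r) (M r c)"
    and span: "\<And>v. mvar v ^ N \<in> cominor_span n M"
    and d: "d = (\<Sum>c<n+2. b c) - (\<Sum>r<n. a r)"
    and e: "2 * e + 1 < d"
    and u: "u \<in> graded_kernel n (n + 2) (\<lambda>r c. generic_restriction (M r c)) b e"
    and c0: "c0 < n + 2" "u c0 \<noteq> 0"
  obtains U where "\<And>r. r < n \<Longrightarrow> (\<Sum>c<n+2. M r c * U c) = 0"
    and "\<And>c. c < n + 2 \<Longrightarrow> homogeneous (e - b c) (U c)" and "U c0 \<noteq> 0"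
proof -
  interpret T: comm_ring_hom "to_line :: 'k poly poly poly \<Rightarrow> _" by (rule comm_ring_hom_to_line)
  interpret F: comm_ring_hom "from_line :: 'k poly poly poly \<Rightarrow> _" by (rule comm_ring_hom_from_line)
  interpret C: comm_ring_hom "plane_chart :: (3, 'k) mpoly \<Rightarrow> _" by (rule comm_ring_hom_plane_chart)
  \<comment> \<open>The kernel vector in the coordinates X, Z, \<alpha>, where the derivation is
    \<open>pderiv\<close>.\<close>
  define w where "w c = from_line (u c)" for c
  have w: "to_line (w c) = u c" for c by (simp add: w_def to_line_from_line)
  have wker: "(\<Sum>c<n+2. [:plane_chart (M r c):] * w c) = 0" if r: "r < n" for r
  proof -
    have "to_line (\<Sum>c<n+2. [:plane_chart (M r c):] * w c) = (\<Sum>c<n+2. generic_restriction (M r c) * u c)"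
      by (simp only: T.hom_sum T.hom_mult to_line_plane_chart w)
    then have "to_line (\<Sum>c<n+2. [:plane_chart (M r c):] * w c) = 0" using graded_kernelD(1)[OF u r] by simp
    then have "from_line (to_line (\<Sum>c<n+2. [:plane_chart (M r c):] * w c)) = 0" by (simp only: F.hom_zero)
    then show ?thesis by (simp only: from_line_to_line)
  qed
  \<comment> \<open>The matrix entries depend only on the point and are constant in \<alpha>, so the
    derivation preserves the kernel.\<close>
  have dker: "(\<Sum>c<n+2. [:plane_chart (M r c):] * pderiv (w c)) = 0" if r: "r < n" for r
  proof -
    have "pderiv (\<Sum>c<n+2. [:plane_chart (M r c):] * w c) = (\<Sum>c<n+2. [:plane_chart (M r c):] * pderiv (w c))"
      by (simp add: pderiv_sum pderiv_smult)
    then show ?thesis using wker[OF r] by simp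
  qed
  define v where "v c = to_line (pderiv (w c))" for c
  have v: "v \<in> graded_kernel n (n + 2) (\<lambda>r c. generic_restriction (M r c)) b (e + 1)"
  proof (rule graded_kernelI)
    fix r assume r: "r < n"
    have "(\<Sum>c<n+2. generic_restriction (M r c) * v c) = to_line (\<Sum>c<n+2. [:plane_chart (M r c):] * pderiv (w c))"
      by (simp only: T.hom_sum T.hom_mult to_line_plane_chart v_def)
    then show "(\<Sum>c<n+2. generic_restriction (M r c) * v c) = 0"
      unfolding dker[OF r] by simp
  next
    fix c assume "c < n + 2"
    then show "degree_bound (e + 1 - b c) (v c)"
      using degree_bound_line_derivation[OF graded_kernelD(2)[OF u]] by (simp add: v_def w_def diff_add_eq)
  qed
  obtain i0 k0 s where top: "i0 < n + 2" "k0 < n + 2" "int s = d - b i0 - b k0"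
    "poly.coeff (cominor n (\<lambda>r c. generic_restriction (M r c)) i0 k0) s \<noteq> 0"
    using line_minors(2)[OF comm_ring_hom_pconst2 M span] unfolding d by metis
  have one: "1 \<in> cominor_span n (\<lambda>r c. generic_restriction (M r c))"
    by (rule line_minors(1)[OF comm_ring_hom_pconst2 M span])
  \<comment> \<open>The degrees \<open>e\<close> and \<open>e + 1\<close> add up to less than
    \<open>d\<close>; this is the origin of the bound on \<open>2 * e + 1\<close>.\<close>
  have wedge: "w c * pderiv (w f) = w f * pderiv (w c)" if "c < n + 2" "f < n + 2" for c f
  proof -
    have "u c * v f = u f * v c"
      using e by (intro kernel_wedge_eq_zero[OF one top graded_kernelD[OF u] graded_kernelD[OF v] _ that]) auto
    then have "to_line (w c * pderiv (w f)) = to_line (w f * pderiv (w c))"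
      by (simp only: T.hom_mult w v_def)
    then show ?thesis by (metis from_line_to_line)
  qed
  have "w c0 \<noteq> 0" using c0(2) w[of c0] T.hom_zero by metis
  then obtain h y where h: "h \<noteq> 0" and hy: "\<And>c. c < n + 2 \<Longrightarrow> w c = h * [:y c:]"
    using proportional_derivative[of "n + 2" w c0, OF wedge c0(1)] by metis
  have yker: "(\<Sum>c<n+2. plane_chart (M r c) * y c) = 0" if r: "r < n" for r
  proof -
    have "h * [:\<Sum>c<n+2. plane_chart (M r c) * y c:] = (\<Sum>c<n+2. [:plane_chart (M r c):] * w c)"
    proof -
      have const_sum: "[:sum f A:] = (\<Sum>x\<in>A. [:f x:])" for f :: "nat \<Rightarrow> 'k poly poly" and A
        by (rule poly_eqI) (simp add: coeff_sum coeff_pCons split: nat.splits)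
      have const_mult: "[:p * q:] = [:p:] * [:q:]" for p q :: "'k poly poly" by simp
      have "h * [:\<Sum>c<n+2. plane_chart (M r c) * y c:] = (\<Sum>c<n+2. [:plane_chart (M r c):] * (h * [:y c:]))"
        by (simp only: const_sum const_mult sum_distrib_left mult.left_commute)
      also have "\<dots> = (\<Sum>c<n+2. [:plane_chart (M r c):] * w c)"
        by (intro sum.cong refl) (simp only: hy lessThan_iff)
      finally show ?thesis .
    qed
    then have "h * [:\<Sum>c<n+2. plane_chart (M r c) * y c:] = 0" using wker[OF r] by simp
    then show ?thesis using h by (simp only: mult_eq_0_iff pCons_eq_0_iff) simp
  qed
  \<comment> \<open>Dividing a kernel vector by the common factor \<open>h\<close> cannot raise the
    degree in X.\<close>
  have "degree_bound (e - b c) (to_line [:y c:])" if c: "c < n + 2" for c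
  proof (cases "to_line [:y c:] = 0")
    case False
    have hz: "to_line h \<noteq> 0" using h by (metis from_line_to_line F.hom_zero)
    have eq: "u c = to_line h * to_line [:y c:]" using hy[OF c] w[of c] by (simp only: T.hom_mult)
    have "int (degree (u c)) \<le> e - b c"
      using graded_kernelD(2)[OF u c] eq hz False by (intro degree_bound_degree) auto
    then have "int (degree (to_line [:y c:])) \<le> e - b c"
      using degree_mult_eq[OF hz False] unfolding eq by linarith
    then show ?thesis unfolding degree_bound_def by (auto intro: coeff_eq_0)
  qed simp
  then have "\<forall>c. c < n + 2 \<longrightarrow> (\<exists>p. homogeneous (e - b c) p \<and> plane_chart p = y c)"
    using homogenization_of_bounded by metis
  then obtain U where U: "\<And>c. c < n + 2 \<Longrightarrow> homogeneous (e - b c) (U c) \<and> plane_chart (U c) = y c" by metis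
  show ?thesis
  proof (rule that[of U])
    fix r assume r: "r < n"
    show "(\<Sum>c<n+2. M r c * U c) = 0"
    proof (rule plane_chart_injective)
      have "homogeneous (e - a r) (M r c * U c)" if "c < n + 2" for c
        using homogeneous_mult[OF M[OF r that] conjunct1[OF U[OF that]]] by simp
      then show "homogeneous (e - a r) (\<Sum>c<n+2. M r c * U c)" by (intro homogeneous_sum) simp
      have "plane_chart (\<Sum>c<n+2. M r c * U c) = (\<Sum>c<n+2. plane_chart (M r c) * y c)"
        using U by (simp add: C.hom_sum C.hom_mult)
      then show "plane_chart (\<Sum>c<n+2. M r c * U c) = 0" using yker[OF r] by simp
    qed
  next
    show "U c0 \<noteq> 0"
    proof
      assume "U c0 = 0"
      then have "y c0 = 0" using U[OF c0(1)] C.hom_zero by metis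
      then show False using hy[OF c0(1)] \<open>w c0 \<noteq> 0\<close> by simp
    qed
  qed (use U in blast)
qed

section \<open>Specialising the generic line to a line over the field\<close>

lemma comm_ring_hom_poly: "comm_ring_hom (\<lambda>p. poly p x)"
  by standard simp_all

lemma bivariate_nonzero_point:
  fixes h :: "'k::field_char_0 poly poly"
  assumes "h \<noteq> 0"
  obtains x y where "hom_ext (\<lambda>q. poly q x) y h \<noteq> 0"
proof -
  have inf: "infinite (UNIV :: 'k set)" by (rule infinite_UNIV_char_0)
  obtain x where x: "poly (lead_coeff h) x \<noteq> 0"
  proof -
    have "finite {x. poly (lead_coeff h) x = 0}" using assms by (intro poly_roots_finite) simp
    then have "{x. poly (lead_coeff h) x = 0} \<noteq> UNIV" using inf by metis
    then show ?thesis using that by blast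
  qed
  have "poly.coeff (map_poly (\<lambda>q. poly q x) h) (degree h) \<noteq> 0"
    using x by (simp add: coeff_map_poly)
  then have "map_poly (\<lambda>q. poly q x) h \<noteq> 0" by (metis coeff_0)
  then have "finite {y. poly (map_poly (\<lambda>q. poly q x) h) y = 0}" by (rule poly_roots_finite)
  then have "{y. poly (map_poly (\<lambda>q. poly q x) h) y = 0} \<noteq> UNIV" using inf by metis
  then show ?thesis using that unfolding hom_ext_def by blast
qed

lemma specialize_generic_restriction:
  fixes p :: "(3, 'k::comm_ring_1) mpoly"
  defines "ev x y \<equiv> hom_ext (\<lambda>q :: 'k poly. poly q x) y"
  shows "map_poly (ev x y) (generic_restriction p) = restrict_line (\<lambda>c. c) x y p"
proof -
  have ev: "comm_ring_hom (ev x y)"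
    unfolding ev_def by (intro comm_ring_hom_hom_ext comm_ring_hom_poly)
  interpret ev: comm_ring_hom "ev x y" by (rule ev)
  interpret me: map_poly_comm_ring_hom "ev x y" ..
  have gens: "ev x y [:[:c:]:] = c" "ev x y [:[:0, 1:]:] = x" "ev x y [:0, 1:] = y" for c
    by (simp_all only: ev_def hom_ext_const hom_ext_X comm_ring_hom_poly) simp_all
  then have gens': "ev x y [:pCons 0 1:] = x" "ev x y (pCons 0 1) = y" by simp_all
  have 3: "v = 0 \<or> v = 1 \<or> v = 2" for v :: 3
    using UNIV_I[of v] unfolding UNIV_three by simp
  have "map_poly (ev x y) (generic_restriction p) = mpeval (\<lambda>c. [:c:]) (line_vars x y) p"
  proof (rule mpoly_hom_eq_mpeval[OF _ comm_ring_hom_pconst])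
    show "comm_ring_hom (\<lambda>p. map_poly (ev x y) (generic_restriction p))"
      by (rule comm_ring_hom_comp[OF me.comm_ring_hom_axioms comm_ring_hom_restrict_line[OF comm_ring_hom_pconst2]])
    show "map_poly (ev x y) (generic_restriction (mconst c)) = [:c:]" for c
      unfolding restrict_line_mvar[OF comm_ring_hom_pconst2] by (simp add: ev.map_poly_pCons_hom gens)
    show "map_poly (ev x y) (generic_restriction (mvar v)) = line_vars x y v" for v
      using 3[of v]
      by (elim disjE)
        (simp_all add: restrict_line_mvar[OF comm_ring_hom_pconst2] ev.map_poly_pCons_hom gens' line_vars_def)
  qed
  then show ?thesis by (simp add: restrict_line_def)
qed

text \<open>A nonzero kernel vector over K[\<alpha>][\<beta>] would descend to a syzygy of too low a
  degree. So elimination ends with a nonzero polynomial in \<alpha> and \<beta>, and any line where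
  it does not vanish will do.\<close>

lemma exists_line_without_kernel:
  fixes M :: "nat \<Rightarrow> nat \<Rightarrow> (3, 'k::field_char_0) mpoly" and a b :: "nat \<Rightarrow> int"
  assumes M: "\<And>r c. r < n \<Longrightarrow> c < n + 2 \<Longrightarrow> homogeneous (b c - a r) (M r c)"
    and span: "\<And>v. mvar v ^ N \<in> cominor_span n M"
    and d: "d = (\<Sum>c<n+2. b c) - (\<Sum>r<n. a r)"
    and e: "2 * e + 1 < d" and low: "\<And>k. k < n + 2 \<Longrightarrow> e + b k < d"
  obtains \<alpha> \<beta> where "\<forall>u\<in>graded_kernel n (n + 2) (\<lambda>r c. restrict_line (\<lambda>c. c) \<alpha> \<beta> (M r c)) b e. \<forall>c<n+2. u c = 0"
proof -
  define G where "G r c = generic_restriction (M r c)" for r c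
  define S where "S c = {..<nat (e - b c + 1)}" for c
  define J where "J = Sigma {..<n+2} S"
  \<comment> \<open>\<open>generic_kernel\<close> speaks of all row indices, so rows outside the
    matrix are set to zero.\<close>
  define T where "T i p = (if fst i < n then poly.coeff (Polynomial.monom 1 (snd p) * G (fst i) (fst p)) (snd i) else 0)"
    for i p :: "nat \<times> nat"
  have finS: "finite (S c)" for c by (simp add: S_def)
  have fin: "finite J" by (simp add: J_def finS)
  have GT: "poly.coeff (\<Sum>c<n+2. G r c * (\<Sum>s\<in>S c. Polynomial.monom (x (c, s)) s)) t = (\<Sum>p\<in>J. T (r, t) p * x p)"
    if "r < n" for x r t
    unfolding J_def T_def using that
    by (subst coeff_matrix_times_monoms[OF finS]) (auto intro!: sum.cong)
  from generic_kernel[OF fin, of T] show ?thesis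
  proof (elim disjE exE conjE)
    fix x assume x: "\<exists>p\<in>J. x p \<noteq> 0" "\<forall>i. (\<Sum>p\<in>J. T i p * x p) = 0"
    define u where "u c = (\<Sum>s\<in>S c. Polynomial.monom (x (c, s)) s)" for c
    have u: "u \<in> graded_kernel n (n + 2) (\<lambda>r c. generic_restriction (M r c)) b e"
    proof (rule graded_kernelI)
      show "(\<Sum>c<n+2. generic_restriction (M r c) * u c) = 0" if "r < n" for r
        by (rule poly_eqI) (use GT[OF that, of x] x(2) in \<open>simp add: u_def G_def\<close>)
      show "degree_bound (e - b c) (u c)" for c
        unfolding u_def S_def by (rule degree_bound_sum_monoms)
    qed
    obtain c s where cs: "c < n + 2" "s \<in> S c" "x (c, s) \<noteq> 0" using x(1) unfolding J_def by auto
    have "poly.coeff (u c) s \<noteq> 0" using cs by (simp add: u_def coeff_sum_monoms[OF finS])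
    then have uc: "u c \<noteq> 0" by auto
    have False
    proof (rule generic_kernel_descends[OF M span d e u cs(1) uc])
      fix U assume U: "\<And>r. r < n \<Longrightarrow> (\<Sum>c<n+2. M r c * U c) = 0"
        "\<And>c. c < n + 2 \<Longrightarrow> homogeneous (e - b c) (U c)" "U c \<noteq> 0"
      have "U c = 0" by (rule no_low_degree_syzygy[OF M span d low U(1,2) cs(1)])
      then show False using U(3) by contradiction
    qed
    then show ?thesis ..
  next
    fix h :: "'k poly poly"
    assume h: "h \<noteq> 0" "\<forall>(ev :: 'k poly poly \<Rightarrow> 'k) y. comm_ring_hom ev \<longrightarrow> ev h \<noteq> 0 \<longrightarrow>
       (\<forall>i. (\<Sum>j\<in>J. ev (T i j) * y j) = 0) \<longrightarrow> (\<forall>j\<in>J. y j = 0)"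
    obtain x y where xy: "hom_ext (\<lambda>q. poly q x) y h \<noteq> 0" using bivariate_nonzero_point[OF h(1)] by blast
    define ev where "ev = hom_ext (\<lambda>q :: 'k poly. poly q x) y"
    have ev: "comm_ring_hom ev" unfolding ev_def by (intro comm_ring_hom_hom_ext comm_ring_hom_poly)
    interpret ev: comm_ring_hom ev by (rule ev)
    interpret me: map_poly_comm_ring_hom ev ..
    define L where "L r c = restrict_line (\<lambda>c. c) x y (M r c)" for r c
    have GL: "map_poly ev (G r c) = L r c" for r c
      unfolding G_def L_def ev_def by (rule specialize_generic_restriction)
    have evT: "ev (T (r, t) p) = poly.coeff (Polynomial.monom 1 (snd p) * L r (fst p)) t" if "r < n" for r t p
    proof -
      have "ev (T (r, t) p) = poly.coeff (map_poly ev (Polynomial.monom 1 (snd p) * G r (fst p))) t"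
        using that by (simp add: T_def coeff_map_poly)
      then show ?thesis by (simp add: me.hom_mult GL map_poly_monom)
    qed
    have "u c = 0" if u: "u \<in> graded_kernel n (n + 2) L b e" and c: "c < n + 2" for u c
    proof -
      \<comment> \<open>The coefficients of a kernel vector on the special line solve the
        specialised linear system.\<close>
      define z where "z p = poly.coeff (u (fst p)) (snd p)" for p
      have us: "u c = (\<Sum>s\<in>S c. Polynomial.monom (z (c, s)) s)" if "c < n + 2" for c
      proof (rule poly_eqI)
        fix s
        show "poly.coeff (u c) s = poly.coeff (\<Sum>s\<in>S c. Polynomial.monom (z (c, s)) s) s"
          unfolding coeff_sum_monoms[OF finS] using graded_kernelD(2)[OF u that]
          by (auto simp: z_def S_def degree_bound_def)
      qed
      have "(\<Sum>p\<in>J. ev (T i p) * z p) = 0" for i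
      proof (cases "fst i < n")
        case True
        have "(\<Sum>p\<in>J. ev (T i p) * z p) = (\<Sum>(c, s)\<in>J. poly.coeff (Polynomial.monom 1 s * L (fst i) c) (snd i) * z (c, s))"
          by (rule sum.cong) (use evT[OF True, of "snd i"] in auto)
        also have "\<dots> = poly.coeff (\<Sum>c<n+2. L (fst i) c * (\<Sum>s\<in>S c. Polynomial.monom (z (c, s)) s)) (snd i)"
          unfolding J_def by (rule coeff_matrix_times_monoms[OF finS, symmetric])
        also have "(\<Sum>c<n+2. L (fst i) c * (\<Sum>s\<in>S c. Polynomial.monom (z (c, s)) s)) = (\<Sum>c<n+2. L (fst i) c * u c)"
          by (rule sum.cong) (simp_all add: us)
        also have "\<dots> = 0" using graded_kernelD(1)[OF u True] .
        finally show ?thesis by simp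
      qed (simp add: T_def)
      then have "\<forall>p\<in>J. z p = 0" using h(2) ev xy unfolding ev_def by blast
      then show ?thesis unfolding us[OF c] using c by (intro sum.neutral) (auto simp: J_def)
    qed
    then show ?thesis using that unfolding L_def by blast
  qed
qed


section \<open>Primes in the polynomial ring in three variables\<close>

text \<open>Modulo \<open>Q'\<close> only the constant coefficient survives, and it is zero by
  injectivity; modulo \<open>Q\<close> the factor \<open>f\<close> then cancels and leaves a shorter
  polynomial. Each strict inclusion of primes thus adds one algebraically independent
  element.\<close>

lemma hom_ext_independent:
  fixes H :: "'a::comm_ring_1 \<Rightarrow> 'b::comm_ring_1"
  assumes H: "comm_ring_hom H" and Q: "primeideal Q ring_of_type_algebra" "primeideal Q' ring_of_type_algebra" "Q \<subseteq> Q'"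
    and f: "f \<in> Q'" "f \<notin> Q" and inj: "\<And>a. H a \<in> Q' \<Longrightarrow> a = 0"
    and p: "hom_ext H f p \<in> Q"
  shows "p = 0"
  using p
proof (induction p)
  case (pCons a p)
  have id': "x + y \<in> Q'" "r * x \<in> Q'" if "x \<in> Q'" "y \<in> Q'" for x y r
    using Q(2) that unfolding primeideal_ring_of_type_algebra_iff ideal_ring_of_type_algebra_iff by blast+
  have eq: "hom_ext H f (pCons a p) = H a + f * hom_ext H f p" by (rule hom_ext_pCons[OF H])
  have "H a + f * hom_ext H f p \<in> Q'" using pCons.prems Q(3) unfolding eq by blast
  moreover have "- hom_ext H f p * f \<in> Q'" using id'(2)[OF f(1) f(1)] .
  ultimately have "(H a + f * hom_ext H f p) + (- hom_ext H f p * f) \<in> Q'" by (rule id'(1))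
  then have "H a \<in> Q'" by (simp add: mult.commute)
  then have a: "a = 0" by (rule inj)
  interpret H: comm_ring_hom H by fact
  have "hom_ext H f (pCons a p) = f * hom_ext H f p" unfolding eq by (simp add: a)
  then have "f * hom_ext H f p \<in> Q" using pCons.prems by simp
  then have "hom_ext H f p \<in> Q" using f(2) Q(1) unfolding primeideal_ring_of_type_algebra_iff by blast
  then show ?case using pCons.IH a by simp
qed simp

section \<open>Four polynomials in three variables are algebraically dependent\<close>

definition exponents_le :: "nat \<Rightarrow> ('v, 'k::zero) mpoly \<Rightarrow> bool" where
  "exponents_le E p \<longleftrightarrow> (\<forall>t\<in>Poly_Mapping.keys p. \<forall>v. Poly_Mapping.lookup t v \<le> E)"

lemma exponents_le_mult:
  fixes p q :: "('v, 'k::comm_ring_1) mpoly"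
  assumes "exponents_le E p" "exponents_le F q"
  shows "exponents_le (E + F) (p * q)"
  unfolding exponents_le_def
proof (intro ballI allI)
  fix t v assume "t \<in> Poly_Mapping.keys (p * q)"
  then obtain a b where "t = a + b" "a \<in> Poly_Mapping.keys p" "b \<in> Poly_Mapping.keys q"
    using keys_mult[of p q] by blast
  then show "Poly_Mapping.lookup t v \<le> E + F"
    using assms unfolding exponents_le_def by (simp add: lookup_add add_mono)
qed

lemma exponents_le_power:
  fixes p :: "('v, 'k::comm_ring_1) mpoly"
  assumes "exponents_le E p"
  shows "exponents_le (k * E) (p ^ k)"
proof (induction k)
  case 0
  have "Poly_Mapping.keys (1 :: ('v, 'k) mpoly) \<subseteq> {0}" unfolding single_one[symmetric] by simp
  then show ?case unfolding exponents_le_def by (auto simp del: keys_one)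
next
  case (Suc k)
  then show ?case using exponents_le_mult[OF assms Suc] by simp
qed

lemma exponents_le_mono: "exponents_le E p \<Longrightarrow> E \<le> F \<Longrightarrow> exponents_le F p"
  unfolding exponents_le_def by (meson order_trans)

lemma exists_exponents_le:
  fixes p :: "('v::finite, 'k::zero) mpoly"
  shows "\<exists>E. exponents_le E p"
proof -
  define S where "S = (\<lambda>(t, v). Poly_Mapping.lookup t v) ` (Poly_Mapping.keys p \<times> UNIV)"
  have "finite S" by (simp add: S_def)
  then have "Poly_Mapping.lookup t v \<le> Max S" if "t \<in> Poly_Mapping.keys p" for t v
    using that by (intro Max_ge) (force simp: S_def)+
  then show ?thesis unfolding exponents_le_def by blast
qed

lemma hom_ext_sum_monoms:
  assumes "comm_ring_hom g"
  shows "hom_ext g s (\<Sum>i<N. Polynomial.monom (q i) i) = (\<Sum>i<N. g (q i) * s ^ i)"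
proof -
  interpret g: comm_ring_hom g by fact
  interpret E: comm_ring_hom "hom_ext g s" by (rule comm_ring_hom_hom_ext[OF assms])
  have "hom_ext g s (Polynomial.monom c i) = g c * s ^ i" for c i
    by (induction i) (simp_all add: monom_0 monom_Suc hom_ext_pCons[OF assms] hom_ext_const[OF assms] mult_ac)
  then show ?thesis by (simp add: E.hom_sum)
qed


lemma no_independent_quadruple:
  fixes H :: "'k::field poly poly poly poly \<Rightarrow> (3, 'k) mpoly" and f1 f2 f3 f4 :: "(3, 'k) mpoly"
  defines "H \<equiv> hom_ext (hom_ext (hom_ext (hom_ext (\<lambda>c. mconst c) f1) f2) f3) f4"
  assumes inj: "\<And>p. H p = 0 \<Longrightarrow> p = 0"
  shows False
proof -
  have hom0: "comm_ring_hom (\<lambda>c :: 'k. mconst c :: (3, 'k) mpoly)"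
    by standard (simp_all add: single_add mult_single)
  note homs = hom0 comm_ring_hom_hom_ext
  obtain E1 E2 E3 E4 where E: "exponents_le E1 f1" "exponents_le E2 f2" "exponents_le E3 f3" "exponents_le E4 f4"
    using exists_exponents_le by metis
  define D where "D = E1 + E2 + E3 + E4 + 1"
  have fD: "exponents_le D f1" "exponents_le D f2" "exponents_le D f3" "exponents_le D f4"
    using E by (auto simp: D_def intro: exponents_le_mono)
  \<comment> \<open>Products with exponents below \<open>N\<close> give N^4 unknowns. Their
    monomials have exponents at most 4 N D, hence (4 N D + 1)^3 equations, which is at most 125 D^3
    N^3 since N D is positive; this \<open>N\<close> makes that less than N^4.\<close>
  define N where "N = 125 * D ^ 3 + 1"
  define J where "J = {..<N} \<times> {..<N} \<times> {..<N} \<times> {..<N}"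
  define I where "I = {..4 * N * D} \<times> {..4 * N * D} \<times> {..4 * N * D}"
  define F where "F p = (case p of (i, j, k, l) \<Rightarrow> f1 ^ i * f2 ^ j * f3 ^ k * f4 ^ l)" for p
  define mon where "mon q = (case q of (i, j, k) \<Rightarrow>
    Poly_Mapping.single 0 i + Poly_Mapping.single 1 j + Poly_Mapping.single (2::3) k)" for q :: "nat \<times> nat \<times> nat"
  have card: "card I < card J"
  proof -
    have "(4 * N * D + 1) ^ 3 \<le> (5 * N * D) ^ 3"
    proof (intro power_mono)
      have "1 \<le> N * D" by (simp add: N_def D_def)
      moreover have "5 * N * D = 4 * N * D + N * D" by (simp add: algebra_simps)
      ultimately show "4 * N * D + 1 \<le> 5 * N * D" by linarith
    qed simp
    also have "\<dots> = 125 * D ^ 3 * N ^ 3" by (simp add: power_mult_distrib)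
    also have "\<dots> < N * N ^ 3" by (rule mult_strict_right_mono) (simp_all add: N_def)
    finally have "(4 * N * D + 1) ^ 3 < N * N ^ 3" .
    moreover have "card I = (4 * N * D + 1) ^ 3"
      by (simp only: I_def card_cartesian_product card_atMost power3_eq_cube Suc_eq_plus1 mult.assoc)
    moreover have "card J = N * N ^ 3"
      by (simp only: J_def card_cartesian_product card_lessThan power3_eq_cube mult.assoc)
    ultimately show ?thesis by (simp only:)
  qed
  have "finite I" "finite J" by (simp_all add: I_def J_def)
  then obtain x where x: "\<exists>p\<in>J. x p \<noteq> 0"
    "\<forall>q\<in>I. (\<Sum>p\<in>J. Poly_Mapping.lookup (F p) (mon q) * x p) = 0"
    using underdetermined_system[of J I "\<lambda>q p. Poly_Mapping.lookup (F p) (mon q)"] card by blast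
  have FE: "exponents_le (4 * N * D) (F p)" if "p \<in> J" for p
  proof -
    obtain i j k l where p: "p = (i, j, k, l)" by (cases p)
    have "exponents_le (i * D + j * D + k * D + l * D) (F p)"
      unfolding p F_def by (simp only: prod.case) (intro exponents_le_mult exponents_le_power fD)
    moreover have "i * D + j * D + k * D + l * D \<le> N * D + N * D + N * D + N * D"
      using that p by (intro add_mono mult_right_mono) (auto simp: J_def)
    ultimately show ?thesis by (elim exponents_le_mono) simp
  qed
  have zero: "(\<Sum>p\<in>J. mconst (x p) * F p) = 0"
  proof (rule poly_mapping_eqI)
    fix t :: "3 \<Rightarrow>\<^sub>0 nat"
    have lk: "Poly_Mapping.lookup (\<Sum>p\<in>J. mconst (x p) * F p) t = (\<Sum>p\<in>J. Poly_Mapping.lookup (F p) t * x p)"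
    proof -
      have "Poly_Mapping.lookup (mconst c * q) t = Poly_Mapping.lookup q t * c" for c :: 'k and q
      proof (induction q rule: mpoly_induct)
        case (single s d)
        show ?case by (simp add: mult_single lookup_single when_def mult.commute)
      qed (simp add: distrib_left distrib_right lookup_add)
      then show ?thesis by (simp add: lookup_sum)
    qed
    show "Poly_Mapping.lookup (\<Sum>p\<in>J. mconst (x p) * F p) t = Poly_Mapping.lookup 0 t"
    proof (cases "\<forall>v. Poly_Mapping.lookup t v \<le> 4 * N * D")
      case True
      define q where "q = (Poly_Mapping.lookup t 0, Poly_Mapping.lookup t 1, Poly_Mapping.lookup t 2)"
      have "t = mon q"
        by (rule monomial_three_eqI) (simp_all add: q_def mon_def lookup_add lookup_single)
      moreover have "q \<in> I" using True by (simp add: q_def I_def)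
      ultimately show ?thesis using x(2) lk by simp
    next
      case False
      then have "Poly_Mapping.lookup (F p) t = 0" if "p \<in> J" for p
        using FE[OF that] unfolding exponents_le_def by (metis in_keys_iff)
      then show ?thesis using lk by simp
    qed
  qed
  define P where "P = (\<Sum>l<N. Polynomial.monom (\<Sum>k<N. Polynomial.monom (\<Sum>j<N. Polynomial.monom
    (\<Sum>i<N. Polynomial.monom (x (i, j, k, l)) i) j) k) l)"
  have "H P = (\<Sum>l<N. (\<Sum>k<N. (\<Sum>j<N. (\<Sum>i<N. mconst (x (i, j, k, l)) * f1 ^ i) * f2 ^ j) * f3 ^ k) * f4 ^ l)"
    unfolding H_def P_def by (simp only: hom_ext_sum_monoms homs)
  also have "\<dots> = (\<Sum>l<N. \<Sum>k<N. \<Sum>j<N. \<Sum>i<N. mconst (x (i, j, k, l)) * F (i, j, k, l))"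
    by (simp add: sum_distrib_right F_def mult.assoc)
  also have "\<dots> = (\<Sum>i<N. \<Sum>j<N. \<Sum>k<N. \<Sum>l<N. mconst (x (i, j, k, l)) * F (i, j, k, l))"
  proof -
    define S where "S i j k l = mconst (x (i, j, k, l)) * F (i, j, k, l)" for i j k l
    have "(\<Sum>l<N. \<Sum>k<N. \<Sum>j<N. \<Sum>i<N. S i j k l) = (\<Sum>l<N. \<Sum>k<N. \<Sum>i<N. \<Sum>j<N. S i j k l)"
      by (intro sum.cong refl sum.swap)
    also have "\<dots> = (\<Sum>l<N. \<Sum>i<N. \<Sum>k<N. \<Sum>j<N. S i j k l)"
      by (intro sum.cong refl sum.swap)
    also have "\<dots> = (\<Sum>i<N. \<Sum>l<N. \<Sum>k<N. \<Sum>j<N. S i j k l)" by (rule sum.swap)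
    also have "\<dots> = (\<Sum>i<N. \<Sum>l<N. \<Sum>j<N. \<Sum>k<N. S i j k l)"
      by (intro sum.cong refl sum.swap)
    also have "\<dots> = (\<Sum>i<N. \<Sum>j<N. \<Sum>l<N. \<Sum>k<N. S i j k l)"
      by (intro sum.cong refl sum.swap)
    also have "\<dots> = (\<Sum>i<N. \<Sum>j<N. \<Sum>k<N. \<Sum>l<N. S i j k l)"
      by (intro sum.cong refl sum.swap)
    finally show ?thesis by (simp only: S_def)
  qed
  also have "\<dots> = (\<Sum>p\<in>J. mconst (x p) * F p)"
    unfolding J_def by (simp add: sum.cartesian_product case_prod_beta)
  finally have "P = 0" using zero inj by simp
  have "x (i, j, k, l) = 0" if "i < N" "j < N" "k < N" "l < N" for i j k l
  proof -
    have "poly.coeff (poly.coeff (poly.coeff (poly.coeff P l) k) j) i = x (i, j, k, l)"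
      using that by (simp add: P_def coeff_sum_monoms)
    then show ?thesis using \<open>P = 0\<close> by simp
  qed
  then show False using x(1) by (auto simp: J_def)
qed

lemma mconst_in_primeideal:
  fixes Q :: "('v, 'k::field) mpoly set"
  assumes "primeideal Q ring_of_type_algebra" "mconst c \<in> Q"
  shows "c = 0"
proof (rule ccontr)
  assume "c \<noteq> 0"
  then have "mconst (inverse c) * mconst c = (1 :: ('v, 'k) mpoly)" by (simp add: mult_single)
  moreover have "mconst (inverse c) * mconst c \<in> Q" "1 \<notin> Q"
    using assms unfolding primeideal_ring_of_type_algebra_iff ideal_ring_of_type_algebra_iff by blast+
  ultimately show False by simp
qed

text \<open>Choose one element in each difference of successive primes and adjoin them from the top
  down. Constants inject modulo the largest prime, and injectivity persists modulo the next smaller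
  prime after each adjunction; at the bottom four independent elements in three variables
  result.\<close>

lemma no_prime_chain_of_length_four:
  fixes Q :: "nat \<Rightarrow> (3, 'k::field) mpoly set"
  assumes prime: "\<And>i. i \<le> 4 \<Longrightarrow> primeideal (Q i) ring_of_type_algebra"
    and strict: "\<And>i. i < 4 \<Longrightarrow> Q i \<subset> Q (Suc i)"
  shows False
proof -
  have hom0: "comm_ring_hom (\<lambda>c :: 'k. mconst c :: (3, 'k) mpoly)"
    by standard (simp_all add: single_add mult_single)
  have "\<exists>f. f \<in> Q (Suc i) \<and> f \<notin> Q i" if "i < 4" for i using strict[OF that] by blast
  then obtain f where f: "\<And>i. i < 4 \<Longrightarrow> f i \<in> Q (Suc i)" "\<And>i. i < 4 \<Longrightarrow> f i \<notin> Q i" by metis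
  define H1 where "H1 = hom_ext (\<lambda>c. mconst c) (f 3)"
  define H2 where "H2 = hom_ext H1 (f 2)"
  define H3 where "H3 = hom_ext H2 (f 1)"
  define H4 where "H4 = hom_ext H3 (f 0)"
  have hom: "comm_ring_hom H1" "comm_ring_hom H2" "comm_ring_hom H3"
    unfolding H1_def H2_def H3_def by (intro comm_ring_hom_hom_ext hom0)+
  have step: "p = 0" if "comm_ring_hom H" "i < 4" "\<And>a. H a \<in> Q (Suc i) \<Longrightarrow> a = 0" "hom_ext H (f i) p \<in> Q i"
    for H :: "'a::comm_ring_1 \<Rightarrow> (3, 'k) mpoly" and i p
    using that by (intro hom_ext_independent[OF that(1) prime[of i] prime[of "Suc i"] _ f(1,2)[OF that(2)] that(3,4)])
      (use strict[OF that(2)] in auto)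
  have 1: "p = 0" if "H1 p \<in> Q 3" for p
    using step[of "\<lambda>c. mconst c" 3 p, OF hom0] that mconst_in_primeideal[OF prime[of 4]] unfolding H1_def by simp
  have 2: "p = 0" if "H2 p \<in> Q 2" for p
    using step[of H1 2 p, OF hom(1)] that 1 unfolding H2_def by (simp add: numeral_eq_Suc)
  have 3: "p = 0" if "H3 p \<in> Q 1" for p
    using step[of H2 1 p, OF hom(2)] that 2 unfolding H3_def by (simp add: numeral_eq_Suc)
  have 4: "p = 0" if "H4 p \<in> Q 0" for p
    using step[of H3 0 p, OF hom(3)] that 3 unfolding H4_def by simp
  have "0 \<in> Q 0"
    using prime[of 0] unfolding primeideal_ring_of_type_algebra_iff ideal_ring_of_type_algebra_iff by simp
  then have "p = 0" if "H4 p = 0" for p using 4 that by metis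
  then show False
    using no_independent_quadruple[of "f 3" "f 2" "f 1" "f 0"] unfolding H4_def H3_def H2_def H1_def by blast
qed


section \<open>Homogeneous ideals and homogeneous primes\<close>

definition homogeneous_ideal :: "('v::finite, 'k::comm_ring_1) mpoly set \<Rightarrow> bool" where
  "homogeneous_ideal J \<longleftrightarrow> ideal J ring_of_type_algebra \<and> (\<forall>r. \<forall>p\<in>J. hcomp r p \<in> J)"

lemma homogeneous_idealD:
  assumes "homogeneous_ideal J"
  shows "0 \<in> J" "x \<in> J \<Longrightarrow> y \<in> J \<Longrightarrow> x + y \<in> J" "x \<in> J \<Longrightarrow> r * x \<in> J" "x \<in> J \<Longrightarrow> hcomp s x \<in> J"
  using assms unfolding homogeneous_ideal_def ideal_ring_of_type_algebra_iff by blast+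

lemma ideal_sum:
  fixes J :: "'a::comm_ring_1 set"
  assumes "ideal J ring_of_type_algebra" "\<And>i. i \<in> A \<Longrightarrow> f i \<in> J"
  shows "sum f A \<in> J"
  using assms(2)
proof (induction A rule: infinite_finite_induct)
  case (insert x F)
  then show ?case using assms(1) unfolding ideal_ring_of_type_algebra_iff by simp
qed (use assms(1) in \<open>simp_all add: ideal_ring_of_type_algebra_iff\<close>)

lemma homogeneous_ideal_insert:
  assumes J: "homogeneous_ideal J" and a: "homogeneous s a"
  shows "homogeneous_ideal {p + q * a | p q. p \<in> J}"
  unfolding homogeneous_ideal_def ideal_ring_of_type_algebra_iff
proof (intro conjI ballI allI)
  let ?K = "{p + q * a | p q. p \<in> J}"
  have "0 + 0 * a \<in> ?K" using homogeneous_idealD(1)[OF J] by blast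
  then show "0 \<in> ?K" by simp
  fix x assume "x \<in> ?K"
  then obtain p q where x: "x = p + q * a" "p \<in> J" by blast
  show "r * x \<in> ?K" for r
  proof -
    have "r * x = r * p + (r * q) * a" unfolding x by (simp add: algebra_simps)
    then show ?thesis using homogeneous_idealD(3)[OF J x(2)] by blast
  qed
  show "hcomp r x \<in> ?K" for r
  proof -
    have "hcomp r x = hcomp r p + hcomp (r - s) q * a" unfolding x by (simp add: hcomp_add hcomp_mult[OF a])
    then show ?thesis using homogeneous_idealD(4)[OF J x(2)] by blast
  qed
  fix y assume "y \<in> ?K"
  then obtain p' q' where y: "y = p' + q' * a" "p' \<in> J" by blast
  have "x + y = (p + p') + (q + q') * a" unfolding x y by (simp add: algebra_simps)
  then show "x + y \<in> ?K" using homogeneous_idealD(2)[OF J x(2) y(2)] by blast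
qed

lemma hcomp_not_in_ideal:
  assumes J: "homogeneous_ideal J" and f: "f \<notin> J"
  obtains r where "hcomp (int r) f \<notin> J" "\<And>i. i < r \<Longrightarrow> hcomp (int i) f \<in> J"
proof -
  define S where "S = monomial_degree ` Poly_Mapping.keys f"
  have "(\<Sum>r\<in>int ` S. hcomp r f) = f"
    by (rule sum_hcomp) (auto simp: S_def)
  then have "\<exists>i. hcomp (int i) f \<notin> J"
    using ideal_sum[of J "int ` S" "\<lambda>r. hcomp r f"] f J unfolding homogeneous_ideal_def by (metis imageE)
  then have "hcomp (int (LEAST i. hcomp (int i) f \<notin> J)) f \<notin> J" by (rule LeastI_ex)
  then show ?thesis using that not_less_Least by blast
qed

text \<open>For two elements outside \<open>J\<close>, take their lowest components outside
  \<open>J\<close>, of degrees r and s. In the component of degree r + s of the product, every other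
  term has a factor in \<open>J\<close>.\<close>

lemma homogeneous_ideal_primeI:
  fixes J :: "('v::finite, 'k::comm_ring_1) mpoly set"
  assumes J: "homogeneous_ideal J" and one: "1 \<notin> J"
    and prime: "\<And>a b r s. homogeneous r a \<Longrightarrow> homogeneous s b \<Longrightarrow> a * b \<in> J \<Longrightarrow> a \<in> J \<or> b \<in> J"
  shows "primeideal J ring_of_type_algebra"
  unfolding primeideal_ring_of_type_algebra_iff
proof (intro conjI allI impI one)
  show id: "ideal J ring_of_type_algebra" using J by (simp add: homogeneous_ideal_def)
  fix f g :: "('v, 'k) mpoly" assume fg: "f * g \<in> J"
  show "f \<in> J \<or> g \<in> J"
  proof (rule ccontr)
    assume "\<not> (f \<in> J \<or> g \<in> J)"
    then have nf: "f \<notin> J" and ng: "g \<notin> J" by simp_all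
    obtain r where r: "hcomp (int r) f \<notin> J" "\<And>i. i < r \<Longrightarrow> hcomp (int i) f \<in> J"
      using hcomp_not_in_ideal[OF J nf] by blast
    obtain s where s: "hcomp (int s) g \<notin> J" "\<And>i. i < s \<Longrightarrow> hcomp (int i) g \<in> J"
      using hcomp_not_in_ideal[OF J ng] by blast
    define S where "S = insert r (monomial_degree ` Poly_Mapping.keys f)"
    have fin: "finite S" by (simp add: S_def)
    have fS: "f = (\<Sum>i\<in>S. hcomp (int i) f)"
    proof -
      have "(\<Sum>i\<in>int ` S. hcomp i f) = f" by (rule sum_hcomp) (auto simp: S_def)
      then show ?thesis by (simp add: sum.reindex)
    qed
    have "hcomp (int r + int s) (f * g) = (\<Sum>i\<in>S. hcomp (int i) f * hcomp (int r + int s - int i) g)"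
    proof -
      have "hcomp (int r + int s) (f * g) = hcomp (int r + int s) (\<Sum>i\<in>S. hcomp (int i) f * g)"
        using fS by (metis sum_distrib_right)
      then show ?thesis by (simp add: hcomp_sum hcomp_mult_left[OF homogeneous_hcomp])
    qed
    also have "\<dots> = hcomp (int r) f * hcomp (int s) g
        + (\<Sum>i\<in>S - {r}. hcomp (int i) f * hcomp (int r + int s - int i) g)"
      using fin by (subst sum.remove[of S r]) (auto simp: S_def)
    finally have eq: "hcomp (int r) f * hcomp (int s) g = hcomp (int r + int s) (f * g)
        + (- 1) * (\<Sum>i\<in>S - {r}. hcomp (int i) f * hcomp (int r + int s - int i) g)" by simp
    have "hcomp (int i) f * hcomp (int r + int s - int i) g \<in> J" if "i \<in> S - {r}" for i
    proof (cases "i < r")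
      case True
      then show ?thesis using r(2) homogeneous_idealD(3)[OF J] by (metis mult.commute)
    next
      case False
      then have "i > r" using that by simp
      have "hcomp (int r + int s - int i) g \<in> J"
      proof (cases "int r + int s - int i < 0")
        case True
        then have "hcomp (int r + int s - int i) g = 0"
          by (intro poly_mapping_eqI) (simp add: lookup_hcomp)
        then show ?thesis using homogeneous_idealD(1)[OF J] by simp
      next
        case False
        then have "int r + int s - int i = int (r + s - i)" "r + s - i < s" using \<open>i > r\<close> by auto
        then show ?thesis using s(2) by metis
      qed
      then show ?thesis using homogeneous_idealD(3)[OF J] by blast
    qed
    then have rest: "(\<Sum>i\<in>S - {r}. hcomp (int i) f * hcomp (int r + int s - int i) g) \<in> J" by (intro ideal_sum[OF id])
    have "hcomp (int r) f * hcomp (int s) g \<in> J"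
      unfolding eq
      by (rule homogeneous_idealD(2)[OF J homogeneous_idealD(4)[OF J fg] homogeneous_idealD(3)[OF J rest]])
    then show False using prime[OF homogeneous_hcomp homogeneous_hcomp] r(1) s(1) by blast
  qed
qed

text \<open>Zorn's lemma gives a maximal homogeneous ideal avoiding the powers of \<open>x\<close>.
  Primeness may be tested on homogeneous elements, and adjoining such an element keeps the ideal
  homogeneous.\<close>

lemma exists_homogeneous_prime:
  fixes J :: "('v::finite, 'k::comm_ring_1) mpoly set"
  assumes J: "homogeneous_ideal J" and x: "\<And>k. x ^ k \<notin> J"
  obtains P where "primeideal P ring_of_type_algebra" "homogeneous_ideal P" "J \<subseteq> P" "x \<notin> P"
proof -
  define A where "A = {K. homogeneous_ideal K \<and> J \<subseteq> K \<and> (\<forall>k. x ^ k \<notin> K)}"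
  have "J \<in> A" using J x by (simp add: A_def)
  moreover have "\<Union>C \<in> A" if C: "C \<noteq> {}" "subset.chain A C" for C
  proof -
    have mem: "homogeneous_ideal K" "J \<subseteq> K" "\<forall>k. x ^ k \<notin> K" if "K \<in> C" for K
      using that C(2) by (auto simp: A_def subset.chain_def)
    have "homogeneous_ideal (\<Union>C)"
      unfolding homogeneous_ideal_def ideal_ring_of_type_algebra_iff
    proof (intro conjI ballI allI)
      show "0 \<in> \<Union>C" using C(1) mem(1) homogeneous_idealD(1) by blast
      show "r * p \<in> \<Union>C" if "p \<in> \<Union>C" for p r using that mem(1) homogeneous_idealD(3) by blast
      show "hcomp r p \<in> \<Union>C" if "p \<in> \<Union>C" for p r using that mem(1) homogeneous_idealD(4) by blast
      fix p q assume "p \<in> \<Union>C" "q \<in> \<Union>C"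
      then obtain K L where KL: "K \<in> C" "L \<in> C" "p \<in> K" "q \<in> L" by blast
      then have "K \<subseteq> L \<or> L \<subseteq> K" using C(2) unfolding subset.chain_def by blast
      then show "p + q \<in> \<Union>C"
      proof
        assume "K \<subseteq> L"
        then show ?thesis using KL homogeneous_idealD(2)[OF mem(1)[OF KL(2)], of p q] by blast
      next
        assume "L \<subseteq> K"
        then show ?thesis using KL homogeneous_idealD(2)[OF mem(1)[OF KL(1)], of p q] by blast
      qed
    qed
    moreover have "J \<subseteq> \<Union>C" using C(1) mem(2) by blast
    moreover have "\<forall>k. x ^ k \<notin> \<Union>C" using mem(3) by blast
    ultimately show ?thesis by (simp add: A_def)
  qed
  ultimately obtain P where P: "P \<in> A" "\<And>K. K \<in> A \<Longrightarrow> P \<subseteq> K \<Longrightarrow> K = P"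
    using subset_Zorn_nonempty[of A] by blast
  have hP: "homogeneous_ideal P" and JP: "J \<subseteq> P" and xP: "\<And>k. x ^ k \<notin> P" using P(1) by (auto simp: A_def)
  \<comment> \<open>By maximality the ideal enlarged by \<open>a\<close> contains a power of
    \<open>x\<close>. Multiplying two such expressions would put a power of \<open>x\<close> into
    \<open>P\<close>.\<close>
  have power: "\<exists>k p q. p \<in> P \<and> x ^ k = p + q * a" if a: "homogeneous s a" "a \<notin> P" for s a
  proof (rule ccontr)
    let ?K = "{p + q * a | p q. p \<in> P}"
    assume no: "\<not> ?thesis"
    have sub: "P \<subseteq> ?K"
    proof
      fix p assume "p \<in> P"
      moreover have "p = p + 0 * a" by simp
      ultimately show "p \<in> ?K" by blast
    qed
    then have "?K \<in> A" using homogeneous_ideal_insert[OF hP a(1)] JP no unfolding A_def by blast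
    then have "?K = P" using sub by (rule P(2))
    moreover have "0 + 1 * a \<in> ?K" using homogeneous_idealD(1)[OF hP] by blast
    ultimately show False using a(2) by simp
  qed
  have "primeideal P ring_of_type_algebra"
  proof (rule homogeneous_ideal_primeI[OF hP])
    show "1 \<notin> P" using xP[of 0] by simp
    fix a b :: "('v, 'k) mpoly" and r s
    assume a: "homogeneous r a" and b: "homogeneous s b" and ab: "a * b \<in> P"
    show "a \<in> P \<or> b \<in> P"
    proof (rule ccontr)
      assume "\<not> (a \<in> P \<or> b \<in> P)"
      then obtain k p q l p' q' where 1: "p \<in> P" "x ^ k = p + q * a" "p' \<in> P" "x ^ l = p' + q' * b"
        using power[OF a] power[OF b] by blast
      have "x ^ (k + l) = (p' + q' * b) * p + ((q * a) * p' + (q * q') * (a * b))"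
        unfolding power_add 1(2,4) by (simp add: algebra_simps)
      also have "\<dots> \<in> P"
        using homogeneous_idealD(3)[OF hP 1(1)] homogeneous_idealD(3)[OF hP 1(3)] homogeneous_idealD(3)[OF hP ab]
        by (intro homogeneous_idealD(2)[OF hP])
      finally show False using xP by blast
    qed
  qed
  moreover have "x \<notin> P" using xP[of 1] by simp
  ultimately show ?thesis using that hP JP by blast
qed

section \<open>The irrelevant ideal and heights of homogeneous primes\<close>

lemma mpeval_zero:
  fixes p :: "('v::finite, 'k::comm_ring_1) mpoly"
  shows "mpeval (\<lambda>c. c) (\<lambda>_. 0) p = Poly_Mapping.lookup p 0"
proof -
  note mpeval = comm_ring_hom.mpeval_single[OF comm_ring_hom_id] comm_ring_hom.mpeval_add[OF comm_ring_hom_id]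
  show ?thesis
  proof (induction p rule: mpoly_induct)
    case (single t c)
    show ?case
    proof (cases "t = 0")
      case False
      then obtain v where "Poly_Mapping.lookup t v \<noteq> 0" by (metis lookup_zero poly_mapping_eqI)
      then have "(0 :: 'k) ^ Poly_Mapping.lookup t v = 0" by (rule zero_power[OF neq0_conv[THEN iffD1]])
      then have "\<exists>v\<in>UNIV. (0 :: 'k) ^ Poly_Mapping.lookup t v = 0" by (rule bexI) (rule UNIV_I)
      then have "(\<Prod>v\<in>UNIV. (0 :: 'k) ^ Poly_Mapping.lookup t v) = 0" by (rule prod_zero[OF finite])
      then show ?thesis using False by (simp add: mpeval lookup_single)
    qed (simp add: mpeval)
  qed (simp add: mpeval lookup_add)
qed

lemma primeideal_zero_constant_term:
  "primeideal {p :: ('v::finite, 'k::field) mpoly. Poly_Mapping.lookup p 0 = 0} ring_of_type_algebra"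
proof -
  interpret E: comm_ring_hom "mpeval (\<lambda>c :: 'k. c) (\<lambda>_ :: 'v. 0)"
    by (rule comm_ring_hom.comm_ring_hom_mpeval[OF comm_ring_hom_id])
  show ?thesis
    unfolding mpeval_zero[symmetric] primeideal_ring_of_type_algebra_iff ideal_ring_of_type_algebra_iff
    by (auto simp: E.hom_add E.hom_mult)
qed

lemma prime_height_ge_chain:
  fixes P :: "'a set"
  assumes "enat (Suc k) \<le> prime_height R P"
  obtains m Q where "Suc k \<le> m" "\<And>i. i \<le> m \<Longrightarrow> primeideal (Q i) R" "\<And>i. i < m \<Longrightarrow> Q i \<subset> Q (Suc i)" "Q m = P"
proof -
  have "\<exists>m Q. Suc k \<le> m \<and> (\<forall>i\<le>m. primeideal (Q i) R) \<and> (\<forall>i<m. Q i \<subset> Q (Suc i)) \<and> Q m = P"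
  proof (rule ccontr)
    assume no: "\<not> ?thesis"
    have "prime_height R P \<le> enat k"
      unfolding prime_height_def
    proof (rule SUP_least)
      fix m assume "m \<in> {m. \<exists>Q :: nat \<Rightarrow> 'a set. (\<forall>i\<le>m. primeideal (Q i) R) \<and> (\<forall>i<m. Q i \<subset> Q (Suc i)) \<and> Q m = P}"
      then have "\<not> Suc k \<le> m" using no by blast
      then show "enat m \<le> enat k" by simp
    qed
    then have "enat (Suc k) \<le> enat k" using assms by (rule order_trans[rotated])
    then show False by simp
  qed
  then show ?thesis using that by blast
qed

text \<open>A homogeneous prime containing the minors but not the variable is properly contained in the
  irrelevant ideal, which would get a chain of primes of length four.\<close>

lemma mvar_power_in_cominor_span:
  fixes M :: "nat \<Rightarrow> nat \<Rightarrow> (3, 'k::field) mpoly" and a b :: "nat \<Rightarrow> int"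
  assumes M: "\<And>r c. r < n \<Longrightarrow> c < n + 2 \<Longrightarrow> homogeneous (b c - a r) (M r c)"
    and I: "I \<subseteq> cominor_span n M" and codim: "codimension ring_of_type_algebra I = 3"
  shows "\<exists>k. mvar v ^ k \<in> cominor_span n M"
proof (rule ccontr)
  assume no: "\<not> ?thesis"
  have J: "homogeneous_ideal (cominor_span n M)"
    unfolding homogeneous_ideal_def
  proof (intro conjI ideal_cominor_span allI ballI)
    fix r p assume "p \<in> cominor_span n M"
    then obtain e where e: "p = (\<Sum>i<n+2. \<Sum>k<n+2. e i k * cominor n M i k)"
      unfolding cominor_span_def by blast
    have "hcomp r p = (\<Sum>i<n+2. \<Sum>k<n+2. hcomp (r - ((\<Sum>c<n+2. b c) - (\<Sum>r<n. a r) - b i - b k)) (e i k) * cominor n M i k)"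
      unfolding e hcomp_sum by (intro sum.cong refl hcomp_mult homogeneous_cominor M)
    then show "hcomp r p \<in> cominor_span n M"
      unfolding cominor_span_def
      by (intro CollectI exI[of _ "\<lambda>i k. hcomp (r - ((\<Sum>c<n+2. b c) - (\<Sum>r<n. a r) - b i - b k)) (e i k)"] conjI TrueI)
  qed
  obtain P where P: "primeideal P ring_of_type_algebra" "homogeneous_ideal P" "cominor_span n M \<subseteq> P" "mvar v \<notin> P"
    using exists_homogeneous_prime[OF J, of "mvar v"] no by blast
  have "codimension ring_of_type_algebra I \<le> prime_height ring_of_type_algebra P"
    unfolding codimension_def by (rule INF_lower) (use P I in auto)
  then have "enat (Suc 2) \<le> prime_height ring_of_type_algebra P"
    unfolding codim by (simp add: numeral_eq_enat eval_nat_numeral)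
  then obtain m Q where Q: "Suc 2 \<le> m" "\<And>i. i \<le> m \<Longrightarrow> primeideal (Q i) ring_of_type_algebra"
    "\<And>i. i < m \<Longrightarrow> Q i \<subset> Q (Suc i)" "Q m = P"
    using prime_height_ge_chain by metis
  define irr where "irr = {p :: (3, 'k) mpoly. Poly_Mapping.lookup p 0 = 0}"
  \<comment> \<open>The constant term is the component of degree 0; it lies in the prime and is
    therefore zero.\<close>
  have "P \<subseteq> irr"
  proof (rule subsetI, rule ccontr)
    fix p assume p: "p \<in> P" "p \<notin> irr"
    have "monomial_degree t = 0 \<longleftrightarrow> t = 0" for t :: "3 \<Rightarrow>\<^sub>0 nat"
      by (auto simp: monomial_degree_def intro: poly_mapping_eqI)
    then have "hcomp 0 p = mconst (Poly_Mapping.lookup p 0)"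
      by (intro poly_mapping_eqI) (auto simp: lookup_hcomp lookup_single when_def)
    then have "mconst (Poly_Mapping.lookup p 0) \<in> P" using homogeneous_idealD(4)[OF P(2) p(1), of 0] by simp
    then show False using mconst_in_primeideal[OF P(1)] p(2) by (simp add: irr_def)
  qed
  moreover have "mvar v \<in> irr"
    using lookup_mvar_power_mult[of v 1 1 0] by (simp add: irr_def)
  ultimately have strict: "P \<subset> irr" using P(4) by blast
  \<comment> \<open>The last four members of the chain ending in \<open>P\<close>, followed by the
    irrelevant ideal.\<close>
  define C where "C i = (if i = 4 then irr else Q (m - 3 + i))" for i
  show False
  proof (rule no_prime_chain_of_length_four[of C])
    fix i :: nat assume i: "i \<le> 4"
    show "primeideal (C i) ring_of_type_algebra"
    proof (cases "i = 4")
      case True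
      then show ?thesis by (simp add: C_def irr_def primeideal_zero_constant_term)
    next
      case False
      then show ?thesis using i Q(1) Q(2)[of "m - 3 + i"] by (simp add: C_def)
    qed
  next
    fix i :: nat assume i: "i < 4"
    show "C i \<subset> C (Suc i)"
    proof (cases "i = 3")
      case True
      then show ?thesis using strict Q(1,4) by (simp add: C_def)
    next
      case False
      then show ?thesis using i Q(1) Q(3)[of "m - 3 + i"] by (simp add: C_def)
    qed
  qed
qed


section \<open>Multiplication by a linear form on the cokernel\<close>

lemma coset_module_vec:
  "H +>\<^bsub>module_vec TYPE('a::comm_ring_1) n\<^esub> v = (\<lambda>h. h + v) ` H"
  by (auto simp: a_r_coset_def r_coset_def module_vec_def)

lemma matrix_image_closed:
  fixes A :: "'a::comm_ring_1 mat"
  assumes A: "A \<in> carrier_mat n N"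
  shows "0\<^sub>v n \<in> matrix_image A"
    and "x \<in> matrix_image A \<Longrightarrow> y \<in> matrix_image A \<Longrightarrow> x + y \<in> matrix_image A"
    and "x \<in> matrix_image A \<Longrightarrow> r \<cdot>\<^sub>v x \<in> matrix_image A"
    and "x \<in> matrix_image A \<Longrightarrow> x \<in> carrier_vec n"
proof -
  have im: "matrix_image A = {A *\<^sub>v w | w. w \<in> carrier_vec N}" using A by (simp add: matrix_image_def)
  show "0\<^sub>v n \<in> matrix_image A"
    unfolding im using A by (intro CollectI exI[of _ "0\<^sub>v N"] conjI eq_vecI) auto
  show "x + y \<in> matrix_image A" if "x \<in> matrix_image A" "y \<in> matrix_image A"
  proof -
    obtain u w where uw: "x = A *\<^sub>v u" "u \<in> carrier_vec N" "y = A *\<^sub>v w" "w \<in> carrier_vec N"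
      using \<open>x \<in> matrix_image A\<close> \<open>y \<in> matrix_image A\<close> unfolding im by blast
    then show ?thesis
      unfolding im using mult_add_distrib_mat_vec[OF A uw(2,4)] by (intro CollectI exI[of _ "u + w"]) simp
  qed
  show "r \<cdot>\<^sub>v x \<in> matrix_image A" if x: "x \<in> matrix_image A"
  proof -
    obtain u where u: "x = A *\<^sub>v u" "u \<in> carrier_vec N" using x unfolding im by blast
    have "r \<cdot>\<^sub>v x = A *\<^sub>v (r \<cdot>\<^sub>v u)"
      unfolding u(1) using A u(2) by (intro eq_vecI) (auto simp: scalar_prod_def sum_distrib_left mult_ac)
    then show ?thesis unfolding im using u(2) by (intro CollectI exI[of _ "r \<cdot>\<^sub>v u"]) simp
  qed
  show "x \<in> carrier_vec n" if "x \<in> matrix_image A"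
    using that A unfolding im by auto
qed

lemma coset_eq_iff:
  fixes A :: "'a::comm_ring_1 mat"
  assumes A: "A \<in> carrier_mat n N" and v: "v \<in> carrier_vec n" and w: "w \<in> carrier_vec n"
  shows "(\<lambda>h. h + v) ` matrix_image A = (\<lambda>h. h + w) ` matrix_image A \<longleftrightarrow> v - w \<in> matrix_image A"
proof
  assume eq: "(\<lambda>h. h + v) ` matrix_image A = (\<lambda>h. h + w) ` matrix_image A"
  have "0\<^sub>v n + v \<in> (\<lambda>h. h + w) ` matrix_image A"
    unfolding eq[symmetric] using matrix_image_closed(1)[OF A] by blast
  then have "v \<in> (\<lambda>h. h + w) ` matrix_image A" using v by simp
  then obtain h where h: "h \<in> matrix_image A" "v = h + w" by blast
  have "v - w = h" unfolding h(2) using matrix_image_closed(4)[OF A h(1)] w by (intro eq_vecI) auto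
  then show "v - w \<in> matrix_image A" using h by simp
next
  assume vw: "v - w \<in> matrix_image A"
  have "h + v \<in> (\<lambda>h. h + w) ` matrix_image A" if h: "h \<in> matrix_image A" for h
  proof -
    have "h + v = (h + (v - w)) + w" using v w matrix_image_closed(4)[OF A h] by (intro eq_vecI) auto
    then show ?thesis using matrix_image_closed(2)[OF A h vw] by blast
  qed
  moreover have "h + w \<in> (\<lambda>h. h + v) ` matrix_image A" if h: "h \<in> matrix_image A" for h
  proof -
    have "h + w = (h + (- 1) \<cdot>\<^sub>v (v - w)) + v" using v w matrix_image_closed(4)[OF A h] by (intro eq_vecI) auto
    then show ?thesis using matrix_image_closed(2)[OF A h matrix_image_closed(3)[OF A vw]] by blast
  qed
  ultimately show "(\<lambda>h. h + v) ` matrix_image A = (\<lambda>h. h + w) ` matrix_image A" by blast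
qed

lemma smult_coset_coker:
  fixes A :: "'a::comm_ring_1 mat"
  assumes A: "A \<in> carrier_mat n N" and v: "v \<in> carrier_vec n"
  shows "l \<odot>\<^bsub>coker A\<^esub> ((\<lambda>h. h + v) ` matrix_image A) = (\<lambda>h. h + l \<cdot>\<^sub>v v) ` matrix_image A"
proof -
  have "l \<odot>\<^bsub>coker A\<^esub> ((\<lambda>h. h + v) ` matrix_image A)
      = (\<Union>h\<in>matrix_image A. (\<lambda>h'. h' + l \<cdot>\<^sub>v (h + v)) ` matrix_image A)"
    by (simp add: coker_def quotient_module_def coset_module_vec) (simp add: module_vec_def)
  also have "\<dots> = (\<Union>h\<in>matrix_image A. (\<lambda>h. h + l \<cdot>\<^sub>v v) ` matrix_image A)"
  proof (rule SUP_cong[OF refl])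
    fix h assume h: "h \<in> matrix_image A"
    have hc: "h \<in> carrier_vec n" by (rule matrix_image_closed(4)[OF A h])
    have "l \<cdot>\<^sub>v (h + v) - l \<cdot>\<^sub>v v = l \<cdot>\<^sub>v h" using hc v by (intro eq_vecI) (auto simp: algebra_simps)
    then have "l \<cdot>\<^sub>v (h + v) - l \<cdot>\<^sub>v v \<in> matrix_image A" using matrix_image_closed(3)[OF A h] by simp
    then show "(\<lambda>h'. h' + l \<cdot>\<^sub>v (h + v)) ` matrix_image A = (\<lambda>h. h + l \<cdot>\<^sub>v v) ` matrix_image A"
      using hc v by (subst coset_eq_iff[OF A]) auto
  qed
  also have "\<dots> = (\<lambda>h. h + l \<cdot>\<^sub>v v) ` matrix_image A"
    using matrix_image_closed(1)[OF A] by auto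
  finally show ?thesis .
qed

text \<open>Maximal rank on representatives: injectivity through the kernel, surjectivity up to the
  image of \<open>A\<close>.\<close>

lemma weak_Lefschetz_cokerI:
  fixes A :: "('v::finite, 'k::comm_ring_1) mpoly mat"
  assumes A: "A \<in> carrier_mat n N" and l: "homogeneous 1 l"
    and rank: "\<And>j. (\<forall>v. v \<in> free_degree_part n a j \<longrightarrow> l \<cdot>\<^sub>v v \<in> matrix_image A \<longrightarrow> v \<in> matrix_image A) \<or>
      (\<forall>g. g \<in> free_degree_part n a (j + 1) \<longrightarrow> (\<exists>v\<in>free_degree_part n a j. g - l \<cdot>\<^sub>v v \<in> matrix_image A))"
  shows "weak_Lefschetz_property (coker A) (coker_degree_part A a)"
proof -
  define cs where "cs v = (\<lambda>h. h + v) ` matrix_image A" for v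
  have G: "coker_degree_part A a j = cs ` free_degree_part n a j" for j
    using A by (simp add: coker_degree_part_def coset_module_vec cs_def)
  have car: "v \<in> carrier_vec n" if "v \<in> free_degree_part n a j" for v j
    using that by (simp add: free_degree_part_def)
  have sm: "l \<odot>\<^bsub>coker A\<^esub> cs v = cs (l \<cdot>\<^sub>v v)" if "v \<in> carrier_vec n" for v
    unfolding cs_def by (rule smult_coset_coker[OF A that])
  have "inj_on (\<lambda>x. l \<odot>\<^bsub>coker A\<^esub> x) (coker_degree_part A a j) \<or>
      (\<lambda>x. l \<odot>\<^bsub>coker A\<^esub> x) ` coker_degree_part A a j = coker_degree_part A a (j + 1)" for j
    using rank[of j]
  proof
    assume inj: "\<forall>v. v \<in> free_degree_part n a j \<longrightarrow> l \<cdot>\<^sub>v v \<in> matrix_image A \<longrightarrow> v \<in> matrix_image A"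
    have "cs v = cs w" if vw: "v \<in> free_degree_part n a j" "w \<in> free_degree_part n a j"
      and eq: "l \<odot>\<^bsub>coker A\<^esub> cs v = l \<odot>\<^bsub>coker A\<^esub> cs w" for v w
    proof -
      have c: "v \<in> carrier_vec n" "w \<in> carrier_vec n" using vw car by blast+
      have "cs (l \<cdot>\<^sub>v v) = cs (l \<cdot>\<^sub>v w)" using eq sm c by simp
      then have "l \<cdot>\<^sub>v v - l \<cdot>\<^sub>v w \<in> matrix_image A"
        unfolding cs_def using c by (subst (asm) coset_eq_iff[OF A]) auto
      moreover have "l \<cdot>\<^sub>v v - l \<cdot>\<^sub>v w = l \<cdot>\<^sub>v (v - w)" using c by (intro eq_vecI) (auto simp: algebra_simps)
      moreover have "v - w \<in> free_degree_part n a j"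
      proof -
        have "homogeneous (j - a i) (vec_index v i - vec_index w i)" if "i < n" for i
          by (rule homogeneous_diff) (use vw that in \<open>simp_all add: free_degree_part_def\<close>)
        then show ?thesis using c by (simp add: free_degree_part_def)
      qed
      ultimately have "v - w \<in> matrix_image A" using inj by simp
      then show ?thesis unfolding cs_def using c by (subst coset_eq_iff[OF A]) auto
    qed
    then show ?thesis unfolding G by (intro disjI1 inj_onI) blast
  next
    assume surj: "\<forall>g. g \<in> free_degree_part n a (j + 1) \<longrightarrow> (\<exists>v\<in>free_degree_part n a j. g - l \<cdot>\<^sub>v v \<in> matrix_image A)"
    have "(\<lambda>x. l \<odot>\<^bsub>coker A\<^esub> x) ` cs ` free_degree_part n a j = (\<lambda>v. cs (l \<cdot>\<^sub>v v)) ` free_degree_part n a j"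
      unfolding image_image by (rule image_cong[OF refl]) (simp add: sm car)
    also have "\<dots> = cs ` free_degree_part n a (j + 1)"
    proof
      have "l \<cdot>\<^sub>v v \<in> free_degree_part n a (j + 1)" if v: "v \<in> free_degree_part n a j" for v
      proof -
        have "homogeneous (j + 1 - a i) (l * vec_index v i)" if "i < n" for i
        proof -
          have "homogeneous (1 + (j - a i)) (l * vec_index v i)"
            using v that by (intro homogeneous_mult[OF l]) (simp add: free_degree_part_def)
          then show ?thesis by (simp add: algebra_simps)
        qed
        then show ?thesis using car[OF v] by (simp add: free_degree_part_def)
      qed
      then show "(\<lambda>v. cs (l \<cdot>\<^sub>v v)) ` free_degree_part n a j \<subseteq> cs ` free_degree_part n a (j + 1)" by blast
      show "cs ` free_degree_part n a (j + 1) \<subseteq> (\<lambda>v. cs (l \<cdot>\<^sub>v v)) ` free_degree_part n a j"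
      proof (rule image_subsetI)
        fix g :: "('v, 'k) mpoly vec" assume g: "g \<in> free_degree_part n a (j + 1)"
        then obtain v where v: "v \<in> free_degree_part n a j" "g - l \<cdot>\<^sub>v v \<in> matrix_image A" using surj by blast
        have "cs g = cs (l \<cdot>\<^sub>v v)"
          unfolding cs_def using v(2) car[OF v(1)] car[OF g] by (subst coset_eq_iff[OF A]) auto
        then show "cs g \<in> (\<lambda>v. cs (l \<cdot>\<^sub>v v)) ` free_degree_part n a j" using v(1) by blast
      qed
    qed
    finally show ?thesis unfolding G by (rule disjI2)
  qed
  then show ?thesis unfolding weak_Lefschetz_property_def using l by blast
qed


theorem theorem4p3:
  fixes n :: nat
    and a b :: "nat \<Rightarrow> int"
    and \<phi> :: "(3, 'k::{alg_closed_field, field_char_0}) mpoly mat"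
    and d d' :: int
  assumes "n > 0"
    and "\<And>i j. i \<le> j \<Longrightarrow> j < n \<Longrightarrow> a i \<le> a j"
    and "\<And>i j. i \<le> j \<Longrightarrow> j < n + 2 \<Longrightarrow> b i \<le> b j"
    and "\<phi> \<in> carrier_mat n (n + 2)"
    and "\<And>i j. i < n \<Longrightarrow> j < n + 2 \<Longrightarrow>
           \<phi> $$ (i, j) = 0 \<or> (b j - a i > 0 \<and> homogeneous (b j - a i) (\<phi> $$ (i, j)))"
    and "codimension ring_of_type_algebra (minors_ideal n \<phi>) = 3"
    and "d = (\<Sum>j<n+2. b j) - (\<Sum>i<n. a i)"
    and "d' = (\<Sum>i<n. b i - a i)"
    and "a 0 = 0"
    and "(even d \<and> d' + 2 + b n > b (n + 1)) \<or> (odd d \<and> d' + 1 + b n > b (n + 1))"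
  shows "weak_Lefschetz_property (coker \<phi>) (coker_degree_part \<phi> a)"
proof -
  define M where "M r c = \<phi> $$ (r, c)" for r c
  have M: "homogeneous (b c - a r) (M r c)" if "r < n" "c < n + 2" for r c
    using assms(5)[OF that] by (auto simp: M_def)
  have I: "minors_ideal n \<phi> \<subseteq> cominor_span n M"
    using minors_ideal_subset_cominor_span[OF assms(4)] unfolding M_def .
  obtain N where span: "\<And>v. mvar v ^ N \<in> cominor_span n M"
  proof -
    have "\<forall>v :: 3. \<exists>k. mvar v ^ k \<in> cominor_span n M"
      using mvar_power_in_cominor_span[OF M I assms(6)] by blast
    then obtain k where k: "\<And>v :: 3. mvar v ^ k v \<in> cominor_span n M" by metis
    have "mvar v ^ (\<Sum>v\<in>UNIV. k v) \<in> cominor_span n M" for v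
    proof -
      have "k v \<le> (\<Sum>v\<in>UNIV. k v)" by (rule member_le_sum) simp_all
      then have "mvar v ^ (\<Sum>v\<in>UNIV. k v) = mvar v ^ ((\<Sum>v\<in>UNIV. k v) - k v) * (mvar v ^ k v :: (3, 'k) mpoly)"
        by (simp flip: power_add)
      then show ?thesis
        using ideal_cominor_span[of n M] k[of v] unfolding ideal_ring_of_type_algebra_iff by metis
    qed
    then show thesis by (rule that)
  qed
  define m where "m = d div 2"
  have "d = d' + b n + b (n + 1)"
    using assms(7,8) by (simp add: sum_bordered_rows sum_subtractf)
  \<comment> \<open>Both cases say that 2 b (n + 1) is at most d: case (a) gives 2 b (n + 1) < d + 2
    with d even, and case (b) gives 2 b (n + 1) < d + 1.\<close>
  then have "b (n + 1) \<le> m"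
    using assms(10) unfolding m_def by presburger
  then have bm: "b c \<le> m" if "c < n + 2" for c
    using assms(3)[of c "n + 1"] that by linarith
  have am: "a r \<le> m - 1" if r: "r < n" for r
  proof -
    \<comment> \<open>For a zero row the unit vector would be a left kernel vector, which the minors
      annihilate. A nonzero entry has positive degree, so a r < b c \<le> m.\<close>
    have "\<exists>c<n+2. M r c \<noteq> 0"
    proof (rule ccontr)
      assume "\<not> ?thesis"
      then have "(\<Sum>s<n. std_row r s * M s c) = 0" if "c < n + 2" for c
        using that by (simp add: sum_std_row[OF r])
      then have "mvar 0 ^ N * std_row r r = (0 :: (3, 'k) mpoly)"
        by (rule cominor_span_cokernel[OF span _ r])
      then show False
        unfolding mvar_power std_row_def by (metis lookup_single_eq lookup_zero mult_1_right zero_neq_one)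
    qed
    then obtain c where "c < n + 2" "M r c \<noteq> 0" by blast
    then show ?thesis using assms(5)[OF r, of c] bm[of c] unfolding M_def by linarith
  qed
  \<comment> \<open>Both follow from 2 m \<le> d and b k \<le> m. The first makes a kernel vector of
    degree \<open>m - 1\<close> proportional to its derivative, the second puts \<open>m - 1\<close>
    below the Buchsbaum-Rim degrees.\<close>
  have low: "2 * (m - 1) + 1 < d" "m - 1 + b k < d" if "k < n + 2" for k
    using bm[OF that] unfolding m_def by presburger+
  obtain \<alpha> \<beta> where inj:
    "\<forall>u\<in>graded_kernel n (n + 2) (\<lambda>r c. restrict_line (\<lambda>c. c) \<alpha> \<beta> (M r c)) b (m - 1). \<forall>c<n+2. u c = 0"
    using exists_line_without_kernel[of n b a M N d "m - 1", OF M span assms(7) low(1)[of 0] low(2)] by auto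
  define L where "L r c = restrict_line (\<lambda>c. c) \<alpha> \<beta> (M r c)" for r c
  interpret R: comm_ring_hom "restrict_line (\<lambda>c :: 'k. c) \<alpha> \<beta>"
    by (rule comm_ring_hom_restrict_line[OF comm_ring_hom_id])
  define l :: "(3, 'k) mpoly" where "l = mvar 2 - mconst \<alpha> * mvar 0 - mconst \<beta> * mvar 1"
  have l: "homogeneous 1 l"
  proof -
    have "homogeneous (0 + 1) (mconst c * mvar v :: (3, 'k) mpoly)" for c v
      by (intro homogeneous_mult homogeneous_mconst homogeneous_mvar)
    then show ?thesis unfolding l_def by (intro homogeneous_diff homogeneous_mvar) simp_all
  qed
  have l_restrict: "restrict_line (\<lambda>c. c) \<alpha> \<beta> l = 0"
    by (simp add: l_def R.hom_minus R.hom_mult restrict_line_mvar[OF comm_ring_hom_id])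
  have l_nz: "l \<noteq> 0"
  proof
    assume "l = 0"
    then have "Poly_Mapping.lookup l (Poly_Mapping.single 2 1) = 0" by simp
    moreover have "Poly_Mapping.single v (Suc 0) \<noteq> Poly_Mapping.single 2 (Suc 0)" if "v \<noteq> 2" for v :: 3
    proof
      assume "Poly_Mapping.single v (Suc 0) = Poly_Mapping.single 2 (Suc 0)"
      then have "Poly_Mapping.lookup (Poly_Mapping.single v (Suc 0)) 2 = Suc 0" by simp
      then show False using that by (simp add: lookup_single)
    qed
    ultimately show False by (simp add: l_def lookup_minus mvar_def mult_single lookup_single when_def)
  qed
  have im: "v \<in> matrix_image \<phi> \<longleftrightarrow> v \<in> carrier_vec n \<and> (\<exists>f. \<forall>r<n. vec_index v r = (\<Sum>c<n+2. M r c * f c))" for v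
  proof
    assume "v \<in> matrix_image \<phi>"
    then obtain w where w: "v = \<phi> *\<^sub>v w" "w \<in> carrier_vec (n + 2)"
      using assms(4) unfolding matrix_image_def by auto
    then show "v \<in> carrier_vec n \<and> (\<exists>f. \<forall>r<n. vec_index v r = (\<Sum>c<n+2. M r c * f c))"
      using assms(4) by (auto simp: scalar_prod_def M_def lessThan_atLeast0 intro!: exI[of _ "vec_index w"])
  next
    assume "v \<in> carrier_vec n \<and> (\<exists>f. \<forall>r<n. vec_index v r = (\<Sum>c<n+2. M r c * f c))"
    then obtain f where f: "v \<in> carrier_vec n" "\<forall>r<n. vec_index v r = (\<Sum>c<n+2. M r c * f c)" by blast
    have "v = \<phi> *\<^sub>v vec (n + 2) f"
      using f assms(4) by (intro eq_vecI) (auto simp: scalar_prod_def M_def lessThan_atLeast0)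
    then show "v \<in> matrix_image \<phi>" using assms(4) unfolding matrix_image_def by auto
  qed
  show ?thesis
  proof (rule weak_Lefschetz_cokerI[OF assms(4) l])
    fix j
    show "(\<forall>v. v \<in> free_degree_part n a j \<longrightarrow> l \<cdot>\<^sub>v v \<in> matrix_image \<phi> \<longrightarrow> v \<in> matrix_image \<phi>) \<or>
      (\<forall>g. g \<in> free_degree_part n a (j + 1) \<longrightarrow> (\<exists>v\<in>free_degree_part n a j. g - l \<cdot>\<^sub>v v \<in> matrix_image \<phi>))"
    \<comment> \<open>The degree \<open>j + 1\<close> of the target decides: up to
      \<open>m - 1\<close> the kernel on the line is zero, and from \<open>m\<close> on the
      restricted matrix is surjective.\<close>
    proof (cases "j + 1 \<le> m - 1")
      case True
      have "v \<in> matrix_image \<phi>" if v: "v \<in> free_degree_part n a j" and lv: "l \<cdot>\<^sub>v v \<in> matrix_image \<phi>" for v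
      proof -
        have vh: "v \<in> carrier_vec n" "\<And>r. r < n \<Longrightarrow> homogeneous (j - a r) (vec_index v r)"
          using v by (auto simp: free_degree_part_def)
        obtain f where f: "\<And>r. r < n \<Longrightarrow> l * vec_index v r = (\<Sum>c<n+2. M r c * f c)"
          using lv vh(1) unfolding im by auto
        \<comment> \<open>The preimage \<open>f\<close> need not be homogeneous; its components of
          the matching degrees have the same image, as that image is homogeneous.\<close>
        define w where "w c = hcomp (j + 1 - b c) (f c)" for c
        have Mw: "(\<Sum>c<n+2. M r c * w c) = l * vec_index v r" if r: "r < n" for r
        proof -
          have "hcomp (j + 1 - a r) (M r c * f c) = M r c * w c" if "c < n + 2" for c
          proof -
            have "j + 1 - a r - (b c - a r) = j + 1 - b c" by simp
            then show ?thesis using hcomp_mult_left[OF M[OF r that], of "j + 1 - a r" "f c"] by (simp only: w_def)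
          qed
          then have "(\<Sum>c<n+2. M r c * w c) = hcomp (j + 1 - a r) (\<Sum>c<n+2. M r c * f c)"
            by (simp add: hcomp_sum)
          also have "\<dots> = hcomp (j + 1 - a r) (l * vec_index v r)" using f[OF r] by simp
          also have "\<dots> = l * vec_index v r"
            using hcomp_homogeneous[OF homogeneous_mult[OF l vh(2)[OF r]], of "j + 1 - a r"] by simp
          finally show ?thesis .
        qed
        define u where "u c = restrict_line (\<lambda>c. c) \<alpha> \<beta> (w c)" for c
        have u: "u \<in> graded_kernel n (n + 2) (\<lambda>r c. restrict_line (\<lambda>c. c) \<alpha> \<beta> (M r c)) b (m - 1)"
        proof (rule graded_kernelI)
          fix r assume r: "r < n"
          have "(\<Sum>c<n+2. restrict_line (\<lambda>c. c) \<alpha> \<beta> (M r c) * u c) = restrict_line (\<lambda>c. c) \<alpha> \<beta> (\<Sum>c<n+2. M r c * w c)"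
            by (simp add: R.hom_sum R.hom_mult u_def)
          then show "(\<Sum>c<n+2. restrict_line (\<lambda>c. c) \<alpha> \<beta> (M r c) * u c) = 0"
            unfolding Mw[OF r] by (simp add: R.hom_mult l_restrict)
        next
          fix c
          have "degree_bound (j + 1 - b c) (u c)"
            unfolding u_def w_def by (rule degree_bound_restrict_line[OF comm_ring_hom_id homogeneous_hcomp])
          then show "degree_bound (m - 1 - b c) (u c)" by (rule degree_bound_mono) (use True in simp)
        qed
        have u0: "restrict_line (\<lambda>c. c) \<alpha> \<beta> (w c) = 0" if "c < n + 2" for c
        proof -
          have "u c = 0" using bspec[OF inj u] that by blast
          then show ?thesis by (simp only: u_def)
        qed
        \<comment> \<open>A form vanishing on the line is a multiple of \<open>l\<close>. Cancelling
          \<open>l\<close> then expresses \<open>v\<close> itself through the columns.\<close>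
        have "\<exists>q. w c = l * q" if c: "c < n + 2" for c
        proof -
          have "homogeneous (j + 1 - b c) (w c)" unfolding w_def by (rule homogeneous_hcomp)
          then obtain q where "homogeneous (j + 1 - b c - 1) q" "w c = l * q"
            unfolding l_def by (rule restrict_line_kernel[OF _ u0[OF c]])
          then show ?thesis by (intro exI)
        qed
        then obtain q where q: "\<And>c. c < n + 2 \<Longrightarrow> w c = l * q c" by metis
        have "vec_index v r = (\<Sum>c<n+2. M r c * q c)" if r: "r < n" for r
        proof -
          have "l * vec_index v r = l * (\<Sum>c<n+2. M r c * q c)"
            unfolding Mw[OF r, symmetric] sum_distrib_left by (intro sum.cong refl) (simp add: q)
          then show ?thesis using l_nz by simp
        qed
        then show ?thesis unfolding im using vh(1) by blast
      qed
      then show ?thesis by blast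
    next
      case False
      have "\<exists>v\<in>free_degree_part n a j. g - l \<cdot>\<^sub>v v \<in> matrix_image \<phi>" if g: "g \<in> free_degree_part n a (j + 1)" for g
      proof -
        have gh: "g \<in> carrier_vec n" "\<And>r. r < n \<Longrightarrow> homogeneous (j + 1 - a r) (vec_index g r)"
          using g by (auto simp: free_degree_part_def)
        obtain i0 k0 s where top: "i0 < n + 2" "k0 < n + 2" "int s = d - b i0 - b k0"
          "poly.coeff (cominor n L i0 k0) s \<noteq> 0"
          using line_minors(2)[OF comm_ring_hom_id M span] unfolding assms(7) L_def[abs_def] by metis
        have one: "1 \<in> cominor_span n L"
          unfolding L_def[abs_def] by (rule line_minors(1)[OF comm_ring_hom_id M span])
        have entries: "degree_bound (b c - a r) (L r c)" if "r < n" "c < n + 2" for r c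
          unfolding L_def by (rule degree_bound_restrict_line[OF comm_ring_hom_id M[OF that]])
        have target: "degree_bound (j + 1 - a r) (restrict_line (\<lambda>c. c) \<alpha> \<beta> (vec_index g r))" if "r < n" for r
          by (rule degree_bound_restrict_line[OF comm_ring_hom_id gh(2)[OF that]])
        have "m \<le> j + 1" using False by simp
        from line_surjective[where M = L, OF entries one top assms(7) m_def bm am inj[folded L_def[abs_def]] this target]
        have "\<exists>f. (\<forall>c<n+2. degree_bound (j + 1 - b c) (f c)) \<and>
          (\<forall>r<n. (\<Sum>c<n+2. restrict_line (\<lambda>c. c) \<alpha> \<beta> (M r c) * f c) = restrict_line (\<lambda>c. c) \<alpha> \<beta> (vec_index g r))"
          unfolding L_def .
        then obtain f where f: "\<And>c. c < n + 2 \<Longrightarrow> degree_bound (j + 1 - b c) (f c)"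
          "\<And>r. r < n \<Longrightarrow> (\<Sum>c<n+2. restrict_line (\<lambda>c. c) \<alpha> \<beta> (M r c) * f c) = restrict_line (\<lambda>c. c) \<alpha> \<beta> (vec_index g r)"
          by blast
        have "\<forall>c. c < n + 2 \<longrightarrow> (\<exists>p. homogeneous (j + 1 - b c) p \<and> restrict_line (\<lambda>c. c) \<alpha> \<beta> p = f c)"
          using restrict_line_lift f(1) by metis
        then obtain p where p: "\<And>c. c < n + 2 \<Longrightarrow> homogeneous (j + 1 - b c) (p c) \<and> restrict_line (\<lambda>c. c) \<alpha> \<beta> (p c) = f c"
          by metis
        \<comment> \<open>Once the solution on the line is lifted to forms, its error vanishes on
          the line and is a multiple of \<open>l\<close>.\<close>
        have ex: "\<exists>q. homogeneous (j - a r) q \<and> vec_index g r - (\<Sum>c<n+2. M r c * p c) = l * q" if r: "r < n" for r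
        proof -
          have "homogeneous (j + 1 - a r) (M r c * p c)" if "c < n + 2" for c
            using homogeneous_mult[OF M[OF r that] conjunct1[OF p[OF that]]] by simp
          then have h: "homogeneous (j + 1 - a r) (vec_index g r - (\<Sum>c<n+2. M r c * p c))"
            using gh(2)[OF r] by (intro homogeneous_diff homogeneous_sum) auto
          have "restrict_line (\<lambda>c. c) \<alpha> \<beta> (\<Sum>c<n+2. M r c * p c)
              = (\<Sum>c<n+2. restrict_line (\<lambda>c. c) \<alpha> \<beta> (M r c) * f c)"
            using p by (simp add: R.hom_sum R.hom_mult)
          then have "restrict_line (\<lambda>c. c) \<alpha> \<beta> (vec_index g r - (\<Sum>c<n+2. M r c * p c)) = 0"
            using f(2)[OF r] by (simp add: R.hom_minus)
          then obtain q where q: "homogeneous (j + 1 - a r - 1) q" "vec_index g r - (\<Sum>c<n+2. M r c * p c) = l * q"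
            unfolding l_def by (rule restrict_line_kernel[OF h])
          have "j + 1 - a r - 1 = j - a r" by simp
          with q(1) have "homogeneous (j - a r) q" by (simp only:)
          then show ?thesis using q(2) by (intro exI conjI)
        qed
        define q where "q r = (SOME q. homogeneous (j - a r) q \<and> vec_index g r - (\<Sum>c<n+2. M r c * p c) = l * q)" for r
        have q: "homogeneous (j - a r) (q r)" "vec_index g r - (\<Sum>c<n+2. M r c * p c) = l * q r" if "r < n" for r
          using someI_ex[OF ex[OF that]] unfolding q_def by (rule conjunct1, rule conjunct2)
        have "vec n q \<in> free_degree_part n a j" using q(1) by (simp add: free_degree_part_def)
        moreover have "g - l \<cdot>\<^sub>v vec n q \<in> matrix_image \<phi>"
          unfolding im
        proof (intro conjI exI[of _ p] allI impI)
          show "g - l \<cdot>\<^sub>v vec n q \<in> carrier_vec n" using gh(1) by simp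
          fix r assume r: "r < n"
          have "vec_index (g - l \<cdot>\<^sub>v vec n q) r = vec_index g r - l * q r" using r gh(1) by simp
          also have "\<dots> = (\<Sum>c<n+2. M r c * p c)" using q(2)[OF r] by (simp add: algebra_simps)
          finally show "vec_index (g - l \<cdot>\<^sub>v vec n q) r = (\<Sum>c<n+2. M r c * p c)" .
        qed
        ultimately show ?thesis by blast
      qed
      then show ?thesis by blast
    qed
  qed
qed

end
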